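(* Let $n\in\mathbb N$, let $\lambda=\mathrm{diag}(\lambda_1,\dots,\lambda_n)$ be a real-valued diagonal $(n\times n)$-matrix and $f=(f_{ij})$ an $(n\times n)$-matrix whose entries belong to $\mathcal G_{L^0}(\Omega,\mathbb R^2)$, and let $g=(g_1,\dots,g_n)$ have entries in $\mathcal G_{L^0}(\Omega,\mathbb R^2)$. Assume that $\lambda$ is uniformly bounded on strips and that $\partial_x\lambda$ and $f$ are of almost certain local logarithmic type. Let $u_0=(u_{01},\dots,u_{0n})$ have entries in $\mathcal G_{L^0}(\Omega,\mathbb R)$. Then the Cauchy problem $$(\partial_t+\lambda(x,t)\partial_x)u=f(x,t)u+g(x,t),\qquad u(x,0)=u_0(x)$$ has a unique global solution $u=(u_1,\dots,u_n)$ with entries in $\mathcal G_{L^0}(\Omega,\mathbb R^2)$. (The differential equation is understood as an equality in $\mathcal G_{L^0}(\Omega,\mathbb R^2)$ and the initial condition as an equality in $\mathcal G_{L^0}(\Omega,\mathbb R)$, componentwise.)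
   Context: $(\Omega,\Sigma,P)$ is a probability space (assumed complete whenever needed). A random field on $\mathbb R^d$ is a map $\mathbb R^d\times\Omega\to\mathbb R$, $(x,\omega)\mapsto A(x,\omega)$, such that $\omega\mapsto A(x,\omega)$ is measurable for every $x$. A family $(r_\varepsilon)_{\varepsilon\in(0,1]}$ of numbers is moderate if $\exists a\ge 0:\ |r_\varepsilon|=O(\varepsilon^{-a})$ as $\varepsilon\to0$, and negligible if $\forall b\ge0:\ |r_\varepsilon|=O(\varepsilon^{b})$ as $\varepsilon\to 0$. A family $(u_\varepsilon)_{\varepsilon\in(0,1]}$ of functions in $\mathcal C^\infty(\mathbb R^d)$ is moderate, written $(u_\varepsilon)\in\mathcal E_M(\mathbb R^d)$ (respectively negligible, written $(u_\varepsilon)\in\mathcal N(\mathbb R^d)$), if for all compact $K\subset\mathbb R^d$ and all $\alpha\in\mathbb N_0^d$ the family $(\sup_{x\in K}|\partial^\alpha u_\varepsilon(x)|)_{\varepsilon}$ is moderate (respectively negligible). $\mathcal E_{M,L^0}(\Omega,\mathbb R^d)$ is the set of families $(u_\varepsilon)_{\varepsilon\in(0,1]}$ of random fields on $\mathbb R^d$ such that: for almost all $\omega$ and all $\varepsilon\in(0,1]$, $x\mapsto u_\varepsilon(x,\omega)$ is in $\mathcal C^\infty(\mathbb R^d)$; for all $x,\varepsilon$, $\omega\mapsto u_\varepsilon(x,\omega)$ is measurable; and for almost all $\omega$, $(u_\varepsilon(\cdot,\omega))_\varepsilon\in\mathcal E_M(\mathbb R^d)$. $\mathcal N_{L^0}(\Omega,\mathbb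 R^d)$ is defined in the same way with $\mathcal N(\mathbb R^d)$ in place of $\mathcal E_M(\mathbb R^d)$. $\mathcal G_{L^0}(\Omega,\mathbb R^d)=\mathcal E_{M,L^0}(\Omega,\mathbb R^d)/\mathcal N_{L^0}(\Omega,\mathbb R^d)$; it is a differential algebra with operations defined on representatives. The restriction of $u\in\mathcal G_{L^0}(\Omega,\mathbb R^2)$ to $t=0$ is the class of $(u_\varepsilon(\cdot,0,\cdot))_\varepsilon$ in $\mathcal G_{L^0}(\Omega,\mathbb R)$. For vectors $|g|=\max_j|g_j|$, and for matrices $|f|=\max_i\sum_j|f_{ij}|$. A (scalar-, vector- or matrix-valued) process $v$ in $\mathcal G_{L^0}(\Omega,\mathbb R^2)$ is: - uniformly bounded on strips, if it has a representative such that for every compact time interval $I$ there is a constant $c>0$ such that, for almost all $\omega$ and all $\varepsilon\in(0,1]$, $\sup_{x\in\mathbb R,\,t\in I}|v_\varepsilon(x,t,\omega)|\le c$; - of almost certain local logarithmic type, if it has a representative such that for every compact $K\subset\mathbb R^2$ and almost all $\omega$ there is $c(\omega)>0$ such that, for all $\varepsilon\in(0,1]$, $\sup_{(x,t)\in K}|v_\varepsilon(x,t,\omega)|\le c(\omega)|\log\varepsilon|$. *)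

theory Defs
  imports
    "HOL-Probability.Probability"
    "HOL-Algebra.QuotRing"
    "HOL-Library.Landau_Symbols"
begin

subsection \<open>Smooth functions and asymptotics\<close>

definition partial_deriv :: "'a::real_normed_vector \<Rightarrow> ('a \<Rightarrow> real) \<Rightarrow> 'a \<Rightarrow> real"
  where "partial_deriv b f x = deriv (\<lambda>h. f (x + h *\<^sub>R b)) 0"

text \<open>A derivative of multi-index \<open>\<alpha>\<close> is written as a list of coordinate directions in which the
  direction \<open>b\<close> occurs \<open>\<alpha>\<^sub>b\<close> times; for smooth functions the order of the list is immaterial.\<close>

definition partial_derivs :: "'a::real_normed_vector list \<Rightarrow> ('a \<Rightarrow> real) \<Rightarrow> 'a \<Rightarrow> real"
  where "partial_derivs bs f = foldr partial_deriv bs f"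

definition smooth :: "('a::euclidean_space \<Rightarrow> real) \<Rightarrow> bool"
  where "smooth f \<longleftrightarrow> (\<forall>bs \<in> lists Basis.
    continuous_on UNIV (partial_derivs bs f) \<and>
    (\<forall>b\<in>Basis. \<forall>x. (\<lambda>h. partial_derivs bs f (x + h *\<^sub>R b)) differentiable (at 0)))"

definition moderate :: "(real \<Rightarrow> real) \<Rightarrow> bool"
  where "moderate r \<longleftrightarrow> (\<exists>a\<ge>0. r \<in> O[at_right 0](\<lambda>\<epsilon>. \<epsilon> powr (- a)))"

definition negligible_family :: "(real \<Rightarrow> real) \<Rightarrow> bool"
  where "negligible_family r \<longleftrightarrow> (\<forall>b\<ge>0. r \<in> O[at_right 0](\<lambda>\<epsilon>. \<epsilon> powr b))"

text \<open>The empty compact set is left out because \<open>Sup {}\<close> is unspecified on the reals.\<close>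

definition EM :: "(real \<Rightarrow> 'a::euclidean_space \<Rightarrow> real) set"
  where "EM = {u. (\<forall>\<epsilon>\<in>{0<..1}. smooth (u \<epsilon>)) \<and>
    (\<forall>K bs. compact K \<and> K \<noteq> {} \<and> bs \<in> lists Basis \<longrightarrow>
      moderate (\<lambda>\<epsilon>. SUP x\<in>K. \<bar>partial_derivs bs (u \<epsilon>) x\<bar>))}"

definition NEG :: "(real \<Rightarrow> 'a::euclidean_space \<Rightarrow> real) set"
  where "NEG = {u. (\<forall>\<epsilon>\<in>{0<..1}. smooth (u \<epsilon>)) \<and>
    (\<forall>K bs. compact K \<and> K \<noteq> {} \<and> bs \<in> lists Basis \<longrightarrow>
      negligible_family (\<lambda>\<epsilon>. SUP x\<in>K. \<bar>partial_derivs bs (u \<epsilon>) x\<bar>))}"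

subsection \<open>The algebra of generalized random fields\<close>

text \<open>A family is a total function \<open>u \<epsilon> x \<omega>\<close>. Only \<open>0 < \<epsilon> \<le> 1\<close> and \<open>\<omega> \<in> space M\<close> are constrained;
  the values elsewhere disappear in the quotient.\<close>

type_synonym ('a, 'w) family = "real \<Rightarrow> 'a \<Rightarrow> 'w \<Rightarrow> real"

definition EML0 :: "'w measure \<Rightarrow> ('a::euclidean_space, 'w) family set"
  where "EML0 M = {u.
    (AE \<omega> in M. \<forall>\<epsilon>\<in>{0<..1}. smooth (\<lambda>x. u \<epsilon> x \<omega>)) \<and>
    (\<forall>\<epsilon>\<in>{0<..1}. \<forall>x. u \<epsilon> x \<in> borel_measurable M) \<and>
    (AE \<omega> in M. (\<lambda>\<epsilon> x. u \<epsilon> x \<omega>) \<in> EM)}"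

definition NL0 :: "'w measure \<Rightarrow> ('a::euclidean_space, 'w) family set"
  where "NL0 M = {u.
    (AE \<omega> in M. \<forall>\<epsilon>\<in>{0<..1}. smooth (\<lambda>x. u \<epsilon> x \<omega>)) \<and>
    (\<forall>\<epsilon>\<in>{0<..1}. \<forall>x. u \<epsilon> x \<in> borel_measurable M) \<and>
    (AE \<omega> in M. (\<lambda>\<epsilon> x. u \<epsilon> x \<omega>) \<in> NEG)}"

definition EML0_ring :: "'w measure \<Rightarrow> ('a::euclidean_space, 'w) family ring"
  where "EML0_ring M = \<lparr>
    carrier = EML0 M,
    monoid.mult = (\<lambda>u v \<epsilon> x \<omega>. u \<epsilon> x \<omega> * v \<epsilon> x \<omega>),
    one = (\<lambda>\<epsilon> x \<omega>. 1),
    zero = (\<lambda>\<epsilon> x \<omega>. 0),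
    add = (\<lambda>u v \<epsilon> x \<omega>. u \<epsilon> x \<omega> + v \<epsilon> x \<omega>)\<rparr>"

definition GL0 :: "'w measure \<Rightarrow> ('a::euclidean_space, 'w) family set ring"
  where "GL0 M = EML0_ring M Quot NL0 M"

definition GL0_class :: "'w measure \<Rightarrow> ('a::euclidean_space, 'w) family \<Rightarrow> ('a, 'w) family set"
  where "GL0_class M u = NL0 M +>\<^bsub>EML0_ring M\<^esub> u"

text \<open>The next two operations act on representatives; as in the library's quotient ring, the
  union runs over equal classes.\<close>

definition GL0_deriv :: "'w measure \<Rightarrow> 'a::euclidean_space \<Rightarrow> ('a, 'w) family set \<Rightarrow> ('a, 'w) family set"
  where "GL0_deriv M b U =
    (\<Union>u\<in>U. GL0_class M (\<lambda>\<epsilon> x \<omega>. partial_deriv b (\<lambda>y. u \<epsilon> y \<omega>) x))"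

text \<open>Points of the plane are pairs \<open>(x, t)\<close>.\<close>

definition GL0_at_time0 :: "'w measure \<Rightarrow> (real \<times> real, 'w) family set \<Rightarrow> (real, 'w) family set"
  where "GL0_at_time0 M U = (\<Union>u\<in>U. GL0_class M (\<lambda>\<epsilon> x \<omega>. u \<epsilon> (x, 0) \<omega>))"

abbreviation GL0_dx :: "'w measure \<Rightarrow> (real \<times> real, 'w) family set \<Rightarrow> (real \<times> real, 'w) family set"
  where "GL0_dx M \<equiv> GL0_deriv M (1, 0)"

abbreviation GL0_dt :: "'w measure \<Rightarrow> (real \<times> real, 'w) family set \<Rightarrow> (real \<times> real, 'w) family set"
  where "GL0_dt M \<equiv> GL0_deriv M (0, 1)"

subsection \<open>Matrix-valued processes\<close>

definition matrix_norm :: "('m::finite \<Rightarrow> 'n::finite \<Rightarrow> real) \<Rightarrow> real"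
  where "matrix_norm A = (MAX i. \<Sum>j\<in>UNIV. \<bar>A i j\<bar>)"

definition diag :: "'w measure \<Rightarrow> ('n \<Rightarrow> ('a::euclidean_space, 'w) family set)
    \<Rightarrow> 'n \<Rightarrow> 'n \<Rightarrow> ('a, 'w) family set"
  where "diag M v i j = (if i = j then v i else \<zero>\<^bsub>GL0 M\<^esub>)"

text \<open>A representative of a matrix of classes is a matrix of representatives of the entries.
  The suprema are spelled out pointwise, since \<open>Sup\<close> is unspecified on unbounded sets of reals.\<close>

definition uniformly_bounded_on_strips ::
    "'w measure \<Rightarrow> ('m::finite \<Rightarrow> 'n::finite \<Rightarrow> (real \<times> real, 'w) family set) \<Rightarrow> bool"
  where "uniformly_bounded_on_strips M V \<longleftrightarrow>
    (\<exists>v. (\<forall>i j. v i j \<in> V i j) \<and>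
      (\<forall>a b. \<exists>c>0. AE \<omega> in M. \<forall>\<epsilon>\<in>{0<..1}. \<forall>x. \<forall>t\<in>{a..b}.
        matrix_norm (\<lambda>i j. v i j \<epsilon> (x, t) \<omega>) \<le> c))"

definition ac_local_log_type ::
    "'w measure \<Rightarrow> ('m::finite \<Rightarrow> 'n::finite \<Rightarrow> (real \<times> real, 'w) family set) \<Rightarrow> bool"
  where "ac_local_log_type M V \<longleftrightarrow>
    (\<exists>v. (\<forall>i j. v i j \<in> V i j) \<and>
      (\<forall>K. compact K \<longrightarrow> (AE \<omega> in M. \<exists>c>0. \<forall>\<epsilon>\<in>{0<..1}. \<forall>p\<in>K.
        matrix_norm (\<lambda>i j. v i j \<epsilon> p \<omega>) \<le> c * \<bar>ln \<epsilon>\<bar>)))"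

end

theory Submission imports Defs "HOL-Library.Sublist" begin

text \<open>For fixed \<open>\<omega>\<close> and \<open>\<epsilon>\<close> the problem is a classical linear hyperbolic system with smooth coefficients
  and bounded speeds. Each speed \<open>\<lambda>\<^sub>i\<close> has a global flow, obtained by Picard iteration; integrating along its
  characteristics turns the system into a Volterra equation, again solved by Picard iteration.
  The derivatives \<open>\<partial>\<^sub>x u\<^sub>i\<close>, suitably rescaled, solve a system of the same form together with the \<open>u\<^sub>i\<close>, and
  this makes the solution smooth. All constructions are limits of iterates, so measurability in \<open>\<omega>\<close> is
  inherited.

  On a trapezoid of determinacy, whose size does not depend on \<open>\<epsilon>\<close> because \<open>\<lambda>\<close> is uniformly bounded
  on strips, the solution is bounded by the data times \<open>exp (C T \<bar>log \<epsilon>\<bar>)\<close>, a power of \<open>\<epsilon>\<close>. Differentiating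
  the equation in \<open>x\<close> gives a system with coefficients \<open>f - \<partial>\<^sub>x \<lambda>\<close>, still of logarithmic type, so all
  \<open>x\<close>-derivatives satisfy the same kind of bound; the equation then controls the \<open>t\<close>-derivatives. Applied with
  moderate data this shows that the solution is moderate, and applied with negligible data to the difference of
  two solutions it shows uniqueness.\<close>

subsection \<open>Calculus of smooth functions\<close>

text \<open>Formulas for higher derivatives are avoided throughout: a set of continuous functions
  that contains its own first partial derivatives consists of smooth functions, and the work lies in
  finding such sets. For solutions, the set has to be generated by the solutions of all smooth
  systems at once, because each differentiation leads to a larger system. In the growth estimates
  only the coefficients acting on the highest x-derivatives enter the exponent. Derivatives of f
  multiply lower-order terms, which are already estimated, and join the inhomogeneity; moderateness
  is enough for them, and repeated differentiation does not change the kind of hypothesis. The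
  assumptions hold for almost every \<omega> only, with null sets that depend on compact sets and
  time intervals. Countable exhaustions collect them in a single null set. On it the data are
  replaced by 0, so that the classical construction is available for every \<omega> and its
  measurability is proved without exceptional sets.\<close>

lemma partial_derivs_Nil [simp]: "partial_derivs [] f = f"
  by (simp add: partial_derivs_def)

lemma partial_derivs_Cons [simp]: "partial_derivs (b # bs) f = partial_deriv b (partial_derivs bs f)"
  by (simp add: partial_derivs_def)

lemma partial_derivs_append: "partial_derivs (bs @ cs) f = partial_derivs bs (partial_derivs cs f)"
  by (simp add: partial_derivs_def)

lemma partial_deriv_eqI:
  "((\<lambda>h. f (x + h *\<^sub>R b)) has_real_derivative D) (at 0) \<Longrightarrow> partial_deriv b f x = D"
  by (simp add: partial_deriv_def DERIV_imp_deriv)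

lemma smooth_imp_continuous: "smooth f \<Longrightarrow> continuous_on UNIV f"
  unfolding smooth_def by (metis lists.Nil partial_derivs_Nil)

lemma smooth_has_partial:
  assumes "smooth f" "b \<in> Basis"
  shows "((\<lambda>h. f (x + h *\<^sub>R b)) has_real_derivative partial_deriv b f x) (at 0)"
proof -
  have "(\<lambda>h. partial_derivs [] f (x + h *\<^sub>R b)) differentiable (at 0)"
    using assms unfolding smooth_def by blast
  then show ?thesis
    by (simp add: partial_deriv_def DERIV_deriv_iff_real_differentiable)
qed

lemma smooth_partial_derivs:
  assumes "smooth f" "cs \<in> lists Basis"
  shows "smooth (partial_derivs cs f)"
  unfolding smooth_def
proof
  fix bs :: "'a list" assume "bs \<in> lists Basis"
  with assms have "bs @ cs \<in> lists Basis" by auto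
  then show "continuous_on UNIV (partial_derivs bs (partial_derivs cs f)) \<and>
    (\<forall>b\<in>Basis. \<forall>x. (\<lambda>h. partial_derivs bs (partial_derivs cs f) (x + h *\<^sub>R b)) differentiable at 0)"
    using assms(1) unfolding smooth_def partial_derivs_append[symmetric] by blast
qed

lemma smooth_partial_deriv: "smooth f \<Longrightarrow> b \<in> Basis \<Longrightarrow> smooth (partial_deriv b f)"
  using smooth_partial_derivs[of f "[b]"] by simp

text \<open>The derivative along a direction is unique, so the witness in \<open>step\<close> must
  be \<open>partial_deriv b f\<close>; hence every iterated partial derivative stays in
  \<open>A\<close>. Smoothness is thereby reduced to finding a set that contains its first partial
  derivatives.\<close>

lemma smooth_coinduct:
  assumes "f \<in> A"
    and cont: "\<And>f. f \<in> A \<Longrightarrow> continuous_on UNIV f"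
    and step: "\<And>f b. f \<in> A \<Longrightarrow> b \<in> Basis \<Longrightarrow>
      \<exists>f'\<in>A. \<forall>x. ((\<lambda>h. f (x + h *\<^sub>R b)) has_real_derivative f' x) (at 0)"
  shows "smooth f"
proof -
  have step': "partial_deriv b g \<in> A \<and> (\<forall>x. ((\<lambda>h. g (x + h *\<^sub>R b)) has_real_derivative partial_deriv b g x) (at 0))"
    if "g \<in> A" "b \<in> Basis" for g b
  proof -
    obtain f' where f': "f' \<in> A" "\<And>x. ((\<lambda>h. g (x + h *\<^sub>R b)) has_real_derivative f' x) (at 0)"
      using step[OF \<open>g \<in> A\<close> \<open>b \<in> Basis\<close>] by blast
    then have "partial_deriv b g = f'" by (intro ext partial_deriv_eqI)
    then show ?thesis using f' by simp
  qed
  have "partial_derivs bs f \<in> A" if "bs \<in> lists Basis" for bs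
    using that by (induction bs) (use assms(1) step' in auto)
  then show ?thesis
    unfolding smooth_def
    using cont step' by (meson real_differentiable_def)
qed

section \<open>Algebras of smooth functions\<close>

inductive_set ring_closure :: "('a \<Rightarrow> real) set \<Rightarrow> ('a \<Rightarrow> real) set" for G where
  gen: "g \<in> G \<Longrightarrow> g \<in> ring_closure G"
| add: "f \<in> ring_closure G \<Longrightarrow> g \<in> ring_closure G \<Longrightarrow> (\<lambda>x. f x + g x) \<in> ring_closure G"
| mult: "f \<in> ring_closure G \<Longrightarrow> g \<in> ring_closure G \<Longrightarrow> (\<lambda>x. f x * g x) \<in> ring_closure G"

text \<open>By the product rule the derivative of a polynomial in the generators is a polynomial in
  the generators and their derivatives, so the closure is a coinduction set as soon as it contains
  the derivatives of the generators.\<close>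

lemma smooth_ring_closure:
  fixes G :: "('a::euclidean_space \<Rightarrow> real) set"
  assumes "f \<in> ring_closure G"
    and cont: "\<And>g. g \<in> G \<Longrightarrow> continuous_on UNIV g"
    and step: "\<And>g b. g \<in> G \<Longrightarrow> b \<in> Basis \<Longrightarrow>
      \<exists>g'\<in>ring_closure G. \<forall>x. ((\<lambda>h. g (x + h *\<^sub>R b)) has_real_derivative g' x) (at 0)"
  shows "smooth f"
proof (rule smooth_coinduct[OF assms(1)])
  fix f :: "'a \<Rightarrow> real" assume "f \<in> ring_closure G"
  then show "continuous_on UNIV f"
    by induction (auto intro: cont continuous_intros)
next
  fix f b assume "f \<in> ring_closure G" and b: "b \<in> (Basis :: 'a set)"
  then show "\<exists>f'\<in>ring_closure G. \<forall>x. ((\<lambda>h. f (x + h *\<^sub>R b)) has_real_derivative f' x) (at 0)"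
  proof induction
    case (gen g)
    then show ?case using step b by blast
  next
    case (add f g)
    then obtain f' g' where
      "f' \<in> ring_closure G" "g' \<in> ring_closure G"
      "\<And>x. ((\<lambda>h. f (x + h *\<^sub>R b)) has_real_derivative f' x) (at 0)"
      "\<And>x. ((\<lambda>h. g (x + h *\<^sub>R b)) has_real_derivative g' x) (at 0)"
      by blast
    then show ?case
      by (intro bexI[of _ "\<lambda>x. f' x + g' x"] allI DERIV_add ring_closure.add)
  next
    case (mult f g)
    then obtain f' g' where *:
      "f' \<in> ring_closure G" "g' \<in> ring_closure G"
      "\<And>x. ((\<lambda>h. f (x + h *\<^sub>R b)) has_real_derivative f' x) (at 0)"
      "\<And>x. ((\<lambda>h. g (x + h *\<^sub>R b)) has_real_derivative g' x) (at 0)"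
      by blast
    have "((\<lambda>h. f (x + h *\<^sub>R b) * g (x + h *\<^sub>R b)) has_real_derivative f' x * g x + f x * g' x) (at 0)" for x
      using DERIV_mult[OF *(3)[of x] *(4)[of x]] by (simp add: algebra_simps)
    then show ?case
      using * mult by (intro bexI[of _ "\<lambda>x. f' x * g x + f x * g' x"] allI ring_closure.add ring_closure.mult)
  qed
qed

lemma smooth_const [simp]: "smooth (\<lambda>x. c)"
proof (rule smooth_coinduct[of _ "range (\<lambda>c x. c)"])
  fix f b assume "f \<in> range (\<lambda>(c::real) (x::'a). c)"
  then show "\<exists>f'\<in>range (\<lambda>c x. c). \<forall>x. ((\<lambda>h. f (x + h *\<^sub>R b)) has_real_derivative f' x) (at 0)"
    by (intro bexI[of _ "\<lambda>x. 0"]) auto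
qed auto

text \<open>Taking all smooth functions as generators gives closure of smoothness under sums and
  products without a Leibniz formula of higher order.\<close>

lemma smooth_closure_smooth:
  fixes f :: "'a::euclidean_space \<Rightarrow> real"
  assumes "f \<in> ring_closure (Collect smooth)" shows "smooth f"
proof (rule smooth_ring_closure[OF assms])
  fix g :: "'a \<Rightarrow> real" and b :: 'a assume g: "g \<in> Collect smooth" and b: "b \<in> Basis"
  then show "\<exists>g'\<in>ring_closure (Collect smooth). \<forall>x. ((\<lambda>h. g (x + h *\<^sub>R b)) has_real_derivative g' x) (at 0)"
    by (intro bexI[of _ "partial_deriv b g"] allI smooth_has_partial ring_closure.gen)
      (auto intro: smooth_partial_deriv)
qed (simp add: smooth_imp_continuous)

lemma smooth_add: "smooth f \<Longrightarrow> smooth g \<Longrightarrow> smooth (\<lambda>x. f x + g x)"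
  and smooth_mult: "smooth f \<Longrightarrow> smooth g \<Longrightarrow> smooth (\<lambda>x. f x * g x)"
  by (rule smooth_closure_smooth, rule ring_closure.add ring_closure.mult, auto intro: ring_closure.gen)+

lemma smooth_uminus: "smooth f \<Longrightarrow> smooth (\<lambda>x. - f x)"
  using smooth_mult[of "\<lambda>x. -1" f] by simp

lemma smooth_diff: "smooth f \<Longrightarrow> smooth g \<Longrightarrow> smooth (\<lambda>x. f x - g x)"
  using smooth_add[OF _ smooth_uminus, of f g] by simp

lemma smooth_sum: "(\<And>i. i \<in> I \<Longrightarrow> smooth (f i)) \<Longrightarrow> smooth (\<lambda>x. \<Sum>i\<in>I. f i x)"
  by (induction I rule: infinite_finite_induct) (auto intro: smooth_add)

lemma partial_deriv_add:
  assumes "smooth f" "smooth g" "b \<in> Basis"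
  shows "partial_deriv b (\<lambda>x. f x + g x) = (\<lambda>x. partial_deriv b f x + partial_deriv b g x)"
  using assms by (intro ext partial_deriv_eqI DERIV_add smooth_has_partial)

lemma partial_deriv_mult:
  assumes "smooth f" "smooth g" "b \<in> Basis"
  shows "partial_deriv b (\<lambda>x. f x * g x) = (\<lambda>x. partial_deriv b f x * g x + f x * partial_deriv b g x)"
proof (intro ext partial_deriv_eqI)
  fix x
  show "((\<lambda>h. f (x + h *\<^sub>R b) * g (x + h *\<^sub>R b)) has_real_derivative
      partial_deriv b f x * g x + f x * partial_deriv b g x) (at 0)"
    using DERIV_mult[OF smooth_has_partial[OF assms(1,3), of x] smooth_has_partial[OF assms(2,3), of x]]
    by (simp add: algebra_simps)
qed

lemma partial_deriv_const [simp]: "partial_deriv b (\<lambda>x. c) = (\<lambda>x. 0)"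
  by (intro ext partial_deriv_eqI) simp

lemma partial_deriv_uminus:
  assumes "smooth f" "b \<in> Basis"
  shows "partial_deriv b (\<lambda>x. - f x) = (\<lambda>x. - partial_deriv b f x)"
  using assms by (intro ext partial_deriv_eqI DERIV_minus smooth_has_partial)

lemma partial_deriv_sum:
  assumes "\<And>i. i \<in> I \<Longrightarrow> smooth (f i)" "b \<in> Basis"
  shows "partial_deriv b (\<lambda>x. \<Sum>i\<in>I. f i x) = (\<lambda>x. \<Sum>i\<in>I. partial_deriv b (f i) x)"
  using assms(1)
  by (induction I rule: infinite_finite_induct)
    (simp_all add: partial_deriv_add smooth_sum assms(2))

lemma partial_derivs_add:
  assumes "smooth f" "smooth g" "bs \<in> lists Basis"
  shows "partial_derivs bs (\<lambda>x. f x + g x) = (\<lambda>x. partial_derivs bs f x + partial_derivs bs g x)"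
  using assms(3) by (induction bs) (simp_all add: partial_deriv_add assms smooth_partial_derivs)

lemma partial_derivs_uminus:
  assumes "smooth f" "bs \<in> lists Basis"
  shows "partial_derivs bs (\<lambda>x. - f x) = (\<lambda>x. - partial_derivs bs f x)"
  using assms(2) by (induction bs) (simp_all add: partial_deriv_uminus assms smooth_partial_derivs)

subsection \<open>Functions of position and time\<close>

lemma Basis_plane: "(Basis :: (real \<times> real) set) = {(1, 0), (0, 1)}"
  by (auto simp: Basis_prod_def)

abbreviation px :: "(real \<times> real \<Rightarrow> real) \<Rightarrow> real \<times> real \<Rightarrow> real"
  where "px \<equiv> partial_deriv (1, 0)"

abbreviation pt :: "(real \<times> real \<Rightarrow> real) \<Rightarrow> real \<times> real \<Rightarrow> real"
  where "pt \<equiv> partial_deriv (0, 1)"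

text \<open>Continuous differentiability with its partial derivatives named. The total derivative is
  recorded because the chain rule along \<open>(\<theta> p, snd p)\<close> moves both coordinates at
  once.\<close>

definition has_grad :: "(real \<times> real \<Rightarrow> real) \<Rightarrow> (real \<times> real \<Rightarrow> real) \<Rightarrow> (real \<times> real \<Rightarrow> real) \<Rightarrow> bool"
  where "has_grad f fx ft \<longleftrightarrow> continuous_on UNIV fx \<and> continuous_on UNIV ft \<and>
    (\<forall>p. (f has_derivative (\<lambda>h. fst h * fx p + snd h * ft p)) (at p))"

lemma has_gradD:
  assumes "has_grad f fx ft"
  shows "continuous_on UNIV fx" "continuous_on UNIV ft" "continuous_on UNIV f"
    "(f has_derivative (\<lambda>h. fst h * fx p + snd h * ft p)) (at p)"
    "((\<lambda>x. f (x, t)) has_real_derivative fx (x, t)) (at x)"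
    "((\<lambda>t. f (x, t)) has_real_derivative ft (x, t)) (at t)"
proof -
  have *: "(f has_derivative (\<lambda>h. fst h * fx p + snd h * ft p)) (at p)" for p
    using assms unfolding has_grad_def by blast
  show "continuous_on UNIV fx" "continuous_on UNIV ft" using assms by (auto simp: has_grad_def)
  show "(f has_derivative (\<lambda>h. fst h * fx p + snd h * ft p)) (at p)" by (rule *)
  show "continuous_on UNIV f"
    using * by (meson continuous_at_imp_continuous_on has_derivative_continuous)
  have "((\<lambda>x. f (x, t)) has_derivative (\<lambda>h. fst (h, 0::real) * fx (x, t) + snd (h, 0::real) * ft (x, t))) (at x)"
    by (rule has_derivative_compose[of "\<lambda>x. (x, t)" "\<lambda>h. (h, 0)", OF _ *]) (auto intro!: derivative_eq_intros)
  then show "((\<lambda>x. f (x, t)) has_real_derivative fx (x, t)) (at x)"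
    by (simp add: has_field_derivative_def mult_commute_abs)
  have "((\<lambda>t. f (x, t)) has_derivative (\<lambda>h. fst (0::real, h) * fx (x, t) + snd (0::real, h) * ft (x, t))) (at t)"
    by (rule has_derivative_compose[of "\<lambda>t. (x, t)" "\<lambda>h. (0, h)", OF _ *]) (auto intro!: derivative_eq_intros)
  then show "((\<lambda>t. f (x, t)) has_real_derivative ft (x, t)) (at t)"
    by (simp add: has_field_derivative_def mult_commute_abs)
qed

lemma continuous_on_plane_compose:
  fixes f :: "real \<times> real \<Rightarrow> real"
  assumes "continuous_on UNIV f" "continuous_on S u" "continuous_on S v"
  shows "continuous_on S (\<lambda>z. f (u z, v z))"
  using continuous_on_compose2[OF assms(1) continuous_on_Pair[OF assms(2,3)]] by simp

lemma has_gradI: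
  assumes dx: "\<And>x t. ((\<lambda>x. f (x, t)) has_real_derivative fx (x, t)) (at x)"
    and dt: "\<And>x t. ((\<lambda>t. f (x, t)) has_real_derivative ft (x, t)) (at t)"
    and cont: "continuous_on UNIV fx" "continuous_on UNIV ft"
  shows "has_grad f fx ft"
  unfolding has_grad_def
proof (intro conjI allI cont)
  fix p :: "real \<times> real"
  obtain x t where p: "p = (x, t)" by fastforce
  have "((\<lambda>(x, y). f (x, y)) has_derivative (\<lambda>(tx, ty). (\<lambda>h. h * fx (x, t)) tx + blinfun_mult_left (ft (x, t)) ty))
    (at (x, t) within UNIV \<times> UNIV)"
  proof (rule has_derivative_partialsI[where fy = "\<lambda>x y. blinfun_mult_left (ft (x, y))"])
    show "((\<lambda>x. f (x, t)) has_derivative (\<lambda>h. h * fx (x, t))) (at x within UNIV)"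
      using dx[of t x] by (simp add: has_field_derivative_def mult_commute_abs)
    show "((\<lambda>y. f (x, y)) has_derivative blinfun_apply (blinfun_mult_left (ft (x, y)))) (at y within UNIV)" for x y
      using dt[of x y] by (simp add: has_field_derivative_def mult_commute_abs)
    have "continuous_on UNIV (\<lambda>p. blinfun_mult_left (ft p))"
      by (intro bounded_linear.continuous_on[OF bounded_linear_blinfun_mult_left] cont)
    then show "continuous (at (x, t) within UNIV \<times> UNIV) (\<lambda>(x, y). blinfun_mult_left (ft (x, y)))"
      by (simp add: continuous_on_eq_continuous_within case_prod_unfold)
  qed auto
  then show "(f has_derivative (\<lambda>h. fst h * fx p + snd h * ft p)) (at p)"
    by (simp add: p case_prod_unfold)
qed



lemma smooth_has_grad:
  assumes "smooth f" shows "has_grad f (px f) (pt f)"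
proof (rule has_gradI)
  show "continuous_on UNIV (px f)" "continuous_on UNIV (pt f)"
    using assms by (auto intro!: smooth_imp_continuous smooth_partial_deriv simp: Basis_plane)
  show "((\<lambda>x. f (x, t)) has_real_derivative px f (x, t)) (at x)" for x t
    using smooth_has_partial[OF assms, of "(1, 0)" "(x, t)"] DERIV_shift[of "\<lambda>x. f (x, t)" "px f (x, t)" 0 x]
    by (simp add: Basis_plane add.commute)
  show "((\<lambda>t. f (x, t)) has_real_derivative pt f (x, t)) (at t)" for x t
    using smooth_has_partial[OF assms, of "(0, 1)" "(x, t)"] DERIV_shift[of "\<lambda>t. f (x, t)" "pt f (x, t)" 0 t]
    by (simp add: Basis_plane add.commute)
qed

lemma smooth_px: "smooth f \<Longrightarrow> smooth (px f)" and smooth_pt: "smooth f \<Longrightarrow> smooth (pt f)"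
  by (auto intro: smooth_partial_deriv simp: Basis_plane)

lemma has_grad_imp_partial:
  assumes g: "has_grad f fx ft" and "b \<in> Basis"
  shows "((\<lambda>h. f (x + h *\<^sub>R b)) has_real_derivative (if b = (1, 0) then fx x else ft x)) (at 0)"
proof -
  have "((\<lambda>h. f (x + h *\<^sub>R b)) has_derivative
      (\<lambda>h. fst (h *\<^sub>R b) * fx x + snd (h *\<^sub>R b) * ft x)) (at 0)"
  proof (rule has_derivative_compose[of "\<lambda>h. x + h *\<^sub>R b" "\<lambda>h. h *\<^sub>R b" 0 UNIV f])
    show "((\<lambda>h. x + h *\<^sub>R b) has_derivative (\<lambda>h. h *\<^sub>R b)) (at 0)"
      by (auto intro!: derivative_eq_intros)
  qed (use has_gradD(4)[OF g, of x] in simp)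
  note d = this
  from \<open>b \<in> Basis\<close> consider "b = (1, 0)" | "b = (0, 1)" by (auto simp: Basis_plane)
  then show ?thesis
    by cases (use d in \<open>simp_all add: has_field_derivative_def mult_commute_abs\<close>)
qed

lemma has_grad_px: "has_grad f fx ft \<Longrightarrow> px f = fx"
  and has_grad_pt: "has_grad f fx ft \<Longrightarrow> pt f = ft"
  using partial_deriv_eqI[OF has_grad_imp_partial[of f fx ft "(1, 0)"]]
    partial_deriv_eqI[OF has_grad_imp_partial[of f fx ft "(0, 1)"]]
  by (simp_all add: Basis_plane fun_eq_iff)

lemma smooth_coinduct_plane:
  assumes "f \<in> A"
    and step: "\<And>f. f \<in> A \<Longrightarrow> \<exists>fx\<in>A. \<exists>ft\<in>A. has_grad f fx ft"
  shows "smooth f"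
proof (rule smooth_coinduct[OF assms(1)])
  fix f assume "f \<in> A"
  then obtain fx ft where *: "fx \<in> A" "ft \<in> A" "has_grad f fx ft" using step by blast
  then show "continuous_on UNIV f" by (meson has_gradD)
  fix b :: "real \<times> real" assume "b \<in> Basis"
  note d = has_grad_imp_partial[OF *(3) this]
  show "\<exists>f'\<in>A. \<forall>x. ((\<lambda>h. f (x + h *\<^sub>R b)) has_real_derivative f' x) (at 0)"
  proof (cases "b = (1, 0)")
    case True
    show ?thesis by (rule bexI[OF _ *(1)]) (use d True in \<open>simp only: if_True simp_thms\<close>)
  next
    case False
    show ?thesis by (rule bexI[OF _ *(2)]) (use d False in \<open>simp only: if_False simp_thms\<close>)
  qed
qed

lemma has_grad_add:
  assumes "has_grad f fx ft" "has_grad g gx gt"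
  shows "has_grad (\<lambda>p. f p + g p) (\<lambda>p. fx p + gx p) (\<lambda>p. ft p + gt p)"
proof (rule has_gradI)
  note f = has_gradD[OF assms(1)] and g = has_gradD[OF assms(2)]
  show "continuous_on UNIV (\<lambda>p. fx p + gx p)" "continuous_on UNIV (\<lambda>p. ft p + gt p)"
    by (intro continuous_intros f g)+
qed (intro DERIV_add has_gradD[OF assms(1)] has_gradD[OF assms(2)])+

lemma has_grad_mult:
  assumes "has_grad f fx ft" "has_grad g gx gt"
  shows "has_grad (\<lambda>p. f p * g p) (\<lambda>p. fx p * g p + f p * gx p) (\<lambda>p. ft p * g p + f p * gt p)"
proof (rule has_gradI)
  note f = has_gradD[OF assms(1)] and g = has_gradD[OF assms(2)]
  show "continuous_on UNIV (\<lambda>p. fx p * g p + f p * gx p)" "continuous_on UNIV (\<lambda>p. ft p * g p + f p * gt p)"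
    by (intro continuous_intros f(1-3) g(1-3))+
  show "((\<lambda>x. f (x, t) * g (x, t)) has_real_derivative fx (x, t) * g (x, t) + f (x, t) * gx (x, t)) (at x)" for x t
    using DERIV_mult[OF f(5)[of t x] g(5)[of t x]] by (simp add: algebra_simps)
  show "((\<lambda>t. f (x, t) * g (x, t)) has_real_derivative ft (x, t) * g (x, t) + f (x, t) * gt (x, t)) (at t)" for x t
    using DERIV_mult[OF f(6)[of x t] g(6)[of x t]] by (simp add: algebra_simps)
qed

text \<open>The substitution keeps the time and moves the position, as the flow map and its inverse
  both do; the term with \<open>ft\<close> comes from the explicit dependence on time.\<close>

lemma has_grad_shear:
  assumes f: "has_grad f fx ft" and th: "has_grad \<theta> \<theta>x \<theta>t"
  shows "has_grad (\<lambda>p. f (\<theta> p, snd p)) (\<lambda>p. fx (\<theta> p, snd p) * \<theta>x p)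
    (\<lambda>p. fx (\<theta> p, snd p) * \<theta>t p + ft (\<theta> p, snd p))"
  unfolding has_grad_def
proof (intro conjI allI)
  note c = has_gradD(1-3)[OF f] has_gradD(1-3)[OF th]
  show "continuous_on UNIV (\<lambda>p. fx (\<theta> p, snd p) * \<theta>x p)"
    "continuous_on UNIV (\<lambda>p. fx (\<theta> p, snd p) * \<theta>t p + ft (\<theta> p, snd p))"
    by (intro continuous_intros continuous_on_plane_compose[OF c(1)] continuous_on_plane_compose[OF c(2)] c)+
  fix p
  have "((\<lambda>p. (\<theta> p, snd p)) has_derivative (\<lambda>h. (fst h * \<theta>x p + snd h * \<theta>t p, snd h))) (at p)"
    using has_gradD(4)[OF th, of p] by (auto intro!: derivative_eq_intros)
  from has_derivative_compose[OF this has_gradD(4)[OF f]]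
  show "((\<lambda>p. f (\<theta> p, snd p)) has_derivative
     (\<lambda>h. fst h * (fx (\<theta> p, snd p) * \<theta>x p) + snd h * (fx (\<theta> p, snd p) * \<theta>t p + ft (\<theta> p, snd p)))) (at p)"
    by (simp add: algebra_simps)
qed

lemma has_grad_compose_real:
  assumes h: "\<And>p. (h has_real_derivative h' (\<theta> p)) (at (\<theta> p))" "continuous_on UNIV (\<lambda>p. h' (\<theta> p))"
    and th: "has_grad \<theta> \<theta>x \<theta>t"
  shows "has_grad (\<lambda>p. h (\<theta> p)) (\<lambda>p. h' (\<theta> p) * \<theta>x p) (\<lambda>p. h' (\<theta> p) * \<theta>t p)"
  unfolding has_grad_def
proof (intro conjI allI)
  show "continuous_on UNIV (\<lambda>p. h' (\<theta> p) * \<theta>x p)" "continuous_on UNIV (\<lambda>p. h' (\<theta> p) * \<theta>t p)"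
    by (intro continuous_intros h has_gradD(1-3)[OF th])+
  fix p
  show "((\<lambda>p. h (\<theta> p)) has_derivative
     (\<lambda>k. fst k * (h' (\<theta> p) * \<theta>x p) + snd k * (h' (\<theta> p) * \<theta>t p))) (at p)"
    using has_derivative_compose[OF has_gradD(4)[OF th] h(1)[unfolded has_field_derivative_def], of p]
    by (simp add: algebra_simps)
qed

subsection \<open>Integration in time\<close>

text \<open>The integral of \<open>a (x, s)\<close> over s from 0 to t, rescaled to the unit
  interval. The fixed interval covers negative t without a case distinction and turns the dependence
  on t into dependence on a parameter.\<close>

definition tint :: "(real \<times> real \<Rightarrow> real) \<Rightarrow> real \<times> real \<Rightarrow> real"
  where "tint a p = integral {0..1} (\<lambda>s. snd p * a (fst p, snd p * s))"

text \<open>Asking for an antiderivative only where |s| \<le> |t| permits one that is constructed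
  merely near the time interval, as in \<open>DERIV_tint_time\<close>.\<close>

lemma tint_eqI:
  assumes "\<And>s. \<bar>s\<bar> \<le> \<bar>t\<bar> \<Longrightarrow> (G has_real_derivative a (x, s)) (at s)"
  shows "tint a (x, t) = G t - G 0"
proof -
  have "((\<lambda>s. t * a (x, t * s)) has_integral (G (t * 1) - G (t * 0))) {0..1}"
  proof (rule fundamental_theorem_of_calculus)
    fix s :: real assume s: "s \<in> {0..1}"
    then have "\<bar>t * s\<bar> \<le> \<bar>t\<bar>" by (simp add: abs_mult mult_left_le)
    note G = assms[OF this]
    have "((\<lambda>s. t * s) has_real_derivative t) (at s within {0..1})"
      using DERIV_cmult_Id has_field_derivative_at_within by blast
    from DERIV_chain2[of G "a (x, t * s)" "\<lambda>s. t * s" s, OF G this]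
    show "((\<lambda>s. G (t * s)) has_vector_derivative t * a (x, t * s)) (at s within {0..1})"
      by (simp only: has_real_derivative_iff_has_vector_derivative mult.commute[of t "a _"])
  qed simp
  from integral_unique[OF this] show ?thesis
    by (simp only: tint_def fst_conv snd_conv mult_1_right mult_zero_right)
qed

lemma tint_0 [simp]: "tint a (x, 0) = 0"
  by (simp add: tint_def)

lemma continuous_tint:
  assumes a: "continuous_on UNIV a" shows "continuous_on UNIV (tint a)"
proof -
  have "continuous_on (UNIV \<times> cbox 0 1) (\<lambda>(p :: real \<times> real, s). snd p * a (fst p, snd p * s))"
    unfolding case_prod_unfold by (intro continuous_intros continuous_on_plane_compose[OF a])
  from integral_continuous_on_param[OF this] show ?thesis
    by (simp add: tint_def[abs_def])
qed

lemma DERIV_tint_time: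
  assumes a: "continuous_on UNIV a"
  shows "((\<lambda>t. tint a (x, t)) has_real_derivative a (x, t)) (at t)"
proof -
  \<comment> \<open>The antiderivative \<open>G\<close> starts at \<open>-N\<close>, to the left of
    both 0 and t, so that t may have either sign.\<close>
  define N where "N = \<bar>t\<bar> + 1"
  define G where "G u = integral {-N..u} (\<lambda>s. a (x, s))" for u
  have G: "(G has_real_derivative a (x, s)) (at s)" if "\<bar>s\<bar> < N" for s
  proof -
    have "(G has_real_derivative a (x, s)) (at s within {-N..N})"
      unfolding G_def[abs_def]
    proof (rule integral_has_real_derivative)
      show "continuous_on {-N..N} (\<lambda>s. a (x, s))"
        by (intro continuous_on_plane_compose[OF a] continuous_on_const continuous_on_id)
      show "s \<in> {-N..N}" using that by auto
    qed
    then show ?thesis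
      using that at_within_Icc_at[of "-N" s N] by simp
  qed
  have eq: "tint a (x, u) = G u - G 0" if "\<bar>u\<bar> < N" for u
    using that by (intro tint_eqI G) auto
  have "((\<lambda>u. G u - G 0) has_real_derivative a (x, t)) (at t)"
    using G[of t] by (auto simp: N_def intro!: derivative_eq_intros)
  then show ?thesis
  proof (rule has_field_derivative_transform_within_open)
    show "open {-N<..<N}" "t \<in> {-N<..<N}" by (auto simp: N_def)
  qed (auto simp: eq)
qed

lemma has_grad_tint:
  assumes a: "continuous_on UNIV a" and ax: "continuous_on UNIV ax"
    and d: "\<And>x t. ((\<lambda>x. a (x, t)) has_real_derivative ax (x, t)) (at x)"
  shows "has_grad (tint a) (tint ax) a"
proof (rule has_gradI)
  fix x t
  have "((\<lambda>x. integral (cbox 0 1) (\<lambda>s. t * a (x, t * s))) has_real_derivative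
    integral (cbox 0 1) (\<lambda>s. t * ax (x, t * s))) (at x within UNIV)"
  proof (rule leibniz_rule_field_derivative)
    show "((\<lambda>x. t * a (x, t * s)) has_real_derivative t * ax (x, t * s)) (at x within UNIV)" for x s
      using d by (auto intro!: derivative_eq_intros)
    show "(\<lambda>s. t * a (x, t * s)) integrable_on cbox 0 1" for x
      by (intro integrable_continuous continuous_intros continuous_on_plane_compose[OF a])
    show "continuous_on (UNIV \<times> cbox 0 1) (\<lambda>(x, s). t * ax (x, t * s))"
      unfolding case_prod_unfold by (intro continuous_intros continuous_on_plane_compose[OF ax])
  qed auto
  then show "((\<lambda>x. tint a (x, t)) has_real_derivative tint ax (x, t)) (at x)"
    by (simp add: tint_def)
qed (intro continuous_tint DERIV_tint_time assms)+

text \<open>Together with |s| \<le> |t|, the condition \<open>s * t \<ge> 0\<close> confines s to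
  the times between 0 and t. The gain is the factor 1/\<mu> in front of the exponential: with \<mu>
  equal to twice a Lipschitz constant or row-sum bound, integration becomes a contraction by
  1/2.\<close>

lemma tint_abs_exp_bound:
  assumes a: "continuous_on UNIV (\<lambda>s. a (x, s))" and mu: "\<mu> > 0"
    and bound: "\<And>s. \<bar>s\<bar> \<le> \<bar>t\<bar> \<Longrightarrow> s * t \<ge> 0 \<Longrightarrow> \<bar>a (x, s)\<bar> \<le> N * exp (\<mu> * \<bar>s\<bar>) + H"
  shows "\<bar>tint a (x, t)\<bar> \<le> N * (exp (\<mu> * \<bar>t\<bar>) - 1) / \<mu> + \<bar>t\<bar> * H"
proof -
  \<comment> \<open>An antiderivative of the majorant in the rescaled time variable.\<close>
  define E where "E s = N / \<mu> * exp (\<mu> * \<bar>t\<bar> * s) + \<bar>t\<bar> * H * s" for s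
  have I: "((\<lambda>s. \<bar>t\<bar> * (N * exp (\<mu> * \<bar>t\<bar> * s) + H)) has_integral E 1 - E 0) {0..1}"
  proof (rule fundamental_theorem_of_calculus)
    fix s :: real
    have "(E has_real_derivative N / \<mu> * (exp (\<mu> * \<bar>t\<bar> * s) * (\<mu> * \<bar>t\<bar>)) + \<bar>t\<bar> * H) (at s within {0..1})"
      unfolding E_def by (auto intro!: derivative_eq_intros)
    moreover have "N / \<mu> * (exp (\<mu> * \<bar>t\<bar> * s) * (\<mu> * \<bar>t\<bar>)) + \<bar>t\<bar> * H
        = \<bar>t\<bar> * (N * exp (\<mu> * \<bar>t\<bar> * s) + H)"
    proof -
      have "N / \<mu> * (exp (\<mu> * \<bar>t\<bar> * s) * (\<mu> * \<bar>t\<bar>)) = \<bar>t\<bar> * (N * exp (\<mu> * \<bar>t\<bar> * s))"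
        using mu by simp
      then show ?thesis by (simp only: distrib_left)
    qed
    ultimately show "(E has_vector_derivative \<bar>t\<bar> * (N * exp (\<mu> * \<bar>t\<bar> * s) + H)) (at s within {0..1})"
      by (simp add: has_real_derivative_iff_has_vector_derivative)
  qed simp
  have "continuous_on {0..1} (\<lambda>s. a (x, t * s))"
    by (rule continuous_on_compose2[OF a]) (auto intro!: continuous_intros)
  then have i: "(\<lambda>s. t * a (x, t * s)) integrable_on {0..1}"
    by (intro integrable_continuous_interval continuous_intros)
  have "norm (tint a (x, t)) \<le> integral {0..1} (\<lambda>s. \<bar>t\<bar> * (N * exp (\<mu> * \<bar>t\<bar> * s) + H))"
    unfolding tint_def fst_conv snd_conv
  proof (rule integral_norm_bound_integral)
    fix s :: real assume s: "s \<in> {0..1}"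
    have "\<bar>a (x, t * s)\<bar> \<le> N * exp (\<mu> * \<bar>t * s\<bar>) + H"
    proof (rule bound)
      show "\<bar>t * s\<bar> \<le> \<bar>t\<bar>" using s by (simp add: abs_mult mult_left_le)
      have "0 \<le> s * (t * t)" using s by simp
      then show "0 \<le> t * s * t" by (simp only: ac_simps)
    qed
    then have "\<bar>t\<bar> * \<bar>a (x, t * s)\<bar> \<le> \<bar>t\<bar> * (N * exp (\<mu> * \<bar>t * s\<bar>) + H)"
      by (rule mult_left_mono) simp
    also have "\<mu> * \<bar>t * s\<bar> = \<mu> * \<bar>t\<bar> * s" using s by (simp add: abs_mult)
    finally show "norm (t * a (x, t * s)) \<le> \<bar>t\<bar> * (N * exp (\<mu> * \<bar>t\<bar> * s) + H)"
      by (simp add: abs_mult)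
  qed (use i I in \<open>auto simp: has_integral_iff\<close>)
  also have "\<dots> = E 1 - E 0" using I by (rule integral_unique)
  also have "\<dots> = N * (exp (\<mu> * \<bar>t\<bar>) - 1) / \<mu> + \<bar>t\<bar> * H"
    by (simp add: E_def diff_divide_distrib right_diff_distrib)
  finally show ?thesis by simp
qed

text \<open>Closure of a set of generators under the ring operations and integration in time: if the
  partial derivatives of the generators stay in the closure, all its elements are smooth. This
  replaces every induction over the order of differentiability.\<close>

inductive_set tint_closure :: "(real \<times> real \<Rightarrow> real) set \<Rightarrow> (real \<times> real \<Rightarrow> real) set" for G where
  gen: "g \<in> G \<Longrightarrow> g \<in> tint_closure G"
| add: "f \<in> tint_closure G \<Longrightarrow> g \<in> tint_closure G \<Longrightarrow> (\<lambda>p. f p + g p) \<in> tint_closure G"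
| mult: "f \<in> tint_closure G \<Longrightarrow> g \<in> tint_closure G \<Longrightarrow> (\<lambda>p. f p * g p) \<in> tint_closure G"
| tint: "f \<in> tint_closure G \<Longrightarrow> tint f \<in> tint_closure G"

lemma closure_stepI:
  "has_grad g gx gt \<Longrightarrow> gx \<in> C \<Longrightarrow> gt \<in> C \<Longrightarrow> \<exists>gx\<in>C. \<exists>gt\<in>C. has_grad g gx gt"
  by blast

text \<open>The only operation beyond sums and products is \<open>tint\<close>: its time derivative
  is the integrand and its space derivative is the \<open>tint\<close> of the space derivative, so
  both remain in the closure.\<close>

lemma smooth_tint_closure:
  assumes "f \<in> tint_closure G"
    and step: "\<And>g. g \<in> G \<Longrightarrow> \<exists>gx\<in>tint_closure G. \<exists>gt\<in>tint_closure G. has_grad g gx gt"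
  shows "smooth f"
proof (rule smooth_coinduct_plane[OF assms(1)])
  fix f assume "f \<in> tint_closure G"
  then show "\<exists>fx\<in>tint_closure G. \<exists>ft\<in>tint_closure G. has_grad f fx ft"
  proof induction
    case (gen g)
    then show ?case by (rule step)
  next
    case (add f g)
    then obtain fx ft gx gt where
      "fx \<in> tint_closure G" "ft \<in> tint_closure G" "gx \<in> tint_closure G" "gt \<in> tint_closure G"
      "has_grad f fx ft" "has_grad g gx gt" by blast
    then show ?case
      by (intro closure_stepI[OF has_grad_add] tint_closure.add)
  next
    case (mult f g)
    then obtain fx ft gx gt where
      "fx \<in> tint_closure G" "ft \<in> tint_closure G" "gx \<in> tint_closure G" "gt \<in> tint_closure G"
      "has_grad f fx ft" "has_grad g gx gt" by blast
    with mult.hyps show ?case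
      by (intro closure_stepI[OF has_grad_mult] tint_closure.add tint_closure.mult)
  next
    case (tint f)
    then obtain fx ft where "fx \<in> tint_closure G" "has_grad f fx ft" by blast
    with tint.hyps show ?case
      by (intro bexI[of _ "tint fx"] bexI[of _ f] has_grad_tint has_gradD tint_closure.tint)
  qed
qed

lemma smooth_closure_step:
  assumes "smooth g" "Collect smooth \<subseteq> G"
  shows "\<exists>gx\<in>tint_closure G. \<exists>gt\<in>tint_closure G. has_grad g gx gt"
  using smooth_has_grad[OF assms(1)] smooth_px[OF assms(1)] smooth_pt[OF assms(1)] assms(2)
    tint_closure.gen[of _ G] by blast

lemma smooth_tint: "smooth f \<Longrightarrow> smooth (tint f)"
  by (rule smooth_tint_closure[of _ "Collect smooth"])
    (auto intro: tint_closure.tint tint_closure.gen intro!: smooth_closure_step)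

text \<open>The generators contain the compositions of all smooth outer functions with the shear,
  since differentiation replaces f by \<open>px f\<close> or \<open>pt f\<close>, which a closure
  built around f alone need not contain.\<close>

lemma smooth_shear:
  assumes f: "smooth f" and th: "smooth (\<theta> :: real \<times> real \<Rightarrow> real)"
  shows "smooth (\<lambda>p. f (\<theta> p, snd p))"
proof -
  let ?G = "Collect smooth \<union> {(\<lambda>p. f (\<theta> p, snd p)) | f. smooth f}"
  show ?thesis
  proof (rule smooth_tint_closure[of _ ?G])
    show "(\<lambda>p. f (\<theta> p, snd p)) \<in> tint_closure ?G" using f by (intro tint_closure.gen) auto
    have sm: "h \<in> tint_closure ?G" if "smooth h" for h using that by (auto intro: tint_closure.gen)
    have sh: "(\<lambda>p. h (\<theta> p, snd p)) \<in> tint_closure ?G" if "smooth h" for h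
      using that by (auto intro: tint_closure.gen)
    fix g assume "g \<in> ?G"
    then consider "smooth g" | h where "smooth h" "g = (\<lambda>p. h (\<theta> p, snd p))" by auto
    then show "\<exists>gx\<in>tint_closure ?G. \<exists>gt\<in>tint_closure ?G. has_grad g gx gt"
    proof cases
      case 1
      then show ?thesis by (rule smooth_closure_step) auto
    next
      case 2
      from has_grad_shear[OF smooth_has_grad[OF 2(1)] smooth_has_grad[OF th]]
      show ?thesis unfolding 2(2)
        using tint_closure.mult[OF sh[OF smooth_px[OF 2(1)]] sm[OF smooth_px[OF th]]]
          tint_closure.add[OF tint_closure.mult[OF sh[OF smooth_px[OF 2(1)]] sm[OF smooth_pt[OF th]]] sh[OF smooth_pt[OF 2(1)]]]
        by (rule closure_stepI)
    qed
  qed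
qed

lemma smooth_real_deriv:
  assumes "smooth (h :: real \<Rightarrow> real)"
  shows "(h has_real_derivative partial_deriv 1 h x) (at x)"
  using smooth_has_partial[OF assms, of 1 x] DERIV_shift[of h "partial_deriv 1 h x" 0 x]
  by (simp add: add.commute)

lemma smooth_compose_real:
  assumes "smooth (h :: real \<Rightarrow> real)" and th: "smooth \<theta>"
  shows "smooth (\<lambda>p :: real \<times> real. h (\<theta> p))"
proof -
  let ?G = "Collect smooth \<union> {(\<lambda>p. h (\<theta> p)) | h. smooth h}"
  show ?thesis
  proof (rule smooth_tint_closure[of _ ?G])
    show "(\<lambda>p. h (\<theta> p)) \<in> tint_closure ?G" using assms by (intro tint_closure.gen) auto
    fix g assume "g \<in> ?G"
    then consider "smooth g" | h where "smooth h" "g = (\<lambda>p. h (\<theta> p))" by auto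
    then show "\<exists>gx\<in>tint_closure ?G. \<exists>gt\<in>tint_closure ?G. has_grad g gx gt"
    proof cases
      case 1
      then show ?thesis by (rule smooth_closure_step) auto
    next
      case 2
      have s: "smooth (partial_deriv 1 h)" by (intro smooth_partial_deriv 2) simp
      have m: "(\<lambda>p. partial_deriv 1 h (\<theta> p) * v p) \<in> tint_closure ?G" if "smooth v" for v
        using s that by (intro tint_closure.mult tint_closure.gen) auto
      have "continuous_on UNIV (\<lambda>p. partial_deriv 1 h (\<theta> p))"
        using continuous_on_compose2[OF smooth_imp_continuous[OF s] smooth_imp_continuous[OF th]] by simp
      from has_grad_compose_real[OF smooth_real_deriv[OF 2(1)] this smooth_has_grad[OF th]]
      show ?thesis unfolding 2(2)
        by (rule closure_stepI) (intro m smooth_px smooth_pt th)+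
    qed
  qed
qed

text \<open>One new generator suffices: up to sign, a derivative of 1/\<theta> is the product of a
  derivative of \<theta> with the square of 1/\<theta>.\<close>

lemma smooth_inverse:
  assumes th: "smooth \<theta>" and nz: "\<And>p. \<theta> p \<noteq> 0"
  shows "smooth (\<lambda>p :: real \<times> real. inverse (\<theta> p))"
proof -
  let ?G = "Collect smooth \<union> {\<lambda>p. inverse (\<theta> p)}"
  show ?thesis
  proof (rule smooth_tint_closure[of _ ?G])
    have sm: "h \<in> tint_closure ?G" if "smooth h" for h using that by (auto intro: tint_closure.gen)
    show i: "(\<lambda>p. inverse (\<theta> p)) \<in> tint_closure ?G" by (intro tint_closure.gen) auto
    fix g assume "g \<in> ?G"
    then consider "smooth g" | "g = (\<lambda>p. inverse (\<theta> p))" by auto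
    then show "\<exists>gx\<in>tint_closure ?G. \<exists>gt\<in>tint_closure ?G. has_grad g gx gt"
    proof cases
      case 1
      then show ?thesis by (rule smooth_closure_step) auto
    next
      case 2
      note g = smooth_has_grad[OF th]
      let ?h' = "\<lambda>x :: real. (- 1) * (inverse x * inverse x)"
      have "has_grad g (\<lambda>p. ?h' (\<theta> p) * px \<theta> p) (\<lambda>p. ?h' (\<theta> p) * pt \<theta> p)"
        unfolding 2
      proof (rule has_grad_compose_real[OF _ _ g])
        show "(inverse has_real_derivative ?h' (\<theta> p)) (at (\<theta> p))" for p
          using DERIV_inverse[OF nz[of p]] by (simp add: power2_eq_square)
        show "continuous_on UNIV (\<lambda>p. ?h' (\<theta> p))"
          using nz by (intro continuous_intros has_gradD(3)[OF g]) auto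
      qed
      then show ?thesis
        by (rule closure_stepI)
          (intro tint_closure.mult i sm smooth_px smooth_pt th smooth_const)+
    qed
  qed
qed

text \<open>Symmetry of second derivatives by integration: f (x, t) is f (x, 0) plus the time
  integral of \<open>pt f\<close>. Differentiating under the integral in x, and then in t, leaves
  \<open>px (pt f)\<close>.\<close>

lemma px_pt_commute:
  assumes f: "smooth f" shows "px (pt f) = pt (px f)"
proof
  fix p :: "real \<times> real"
  obtain x t where p: "p = (x, t)" by fastforce
  note g = smooth_has_grad[OF f] and gt = smooth_has_grad[OF smooth_pt[OF f]]
    and gx = smooth_has_grad[OF smooth_px[OF f]]
  have f_eq: "f (x, t) = f (x, 0) + tint (pt f) (x, t)" for x t
    using tint_eqI[of t "\<lambda>s. f (x, s)" "pt f" x] has_gradD(6)[OF g] by simp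
  have T: "has_grad (tint (pt f)) (tint (px (pt f))) (pt f)"
    by (intro has_grad_tint has_gradD(5)[OF gt] has_gradD(1,3)[OF gt])
  have fx: "px f (x, t) = px f (x, 0) + tint (px (pt f)) (x, t)" for t
  proof -
    have "((\<lambda>x. f (x, 0) + tint (pt f) (x, t)) has_real_derivative px f (x, 0) + tint (px (pt f)) (x, t)) (at x)"
      by (intro DERIV_add has_gradD(5)[OF g] has_gradD(5)[OF T])
    then show ?thesis
      using has_gradD(5)[OF g, of t x] by (simp add: f_eq[symmetric] DERIV_unique)
  qed
  have "((\<lambda>t. px f (x, 0) + tint (px (pt f)) (x, t)) has_real_derivative 0 + px (pt f) (x, t)) (at t)"
    by (intro DERIV_add DERIV_const DERIV_tint_time has_gradD(1)[OF gt])
  then show "px (pt f) p = pt (px f) p"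
    using has_gradD(6)[OF gx, of x t] by (simp add: fx[symmetric] DERIV_unique p)
qed

subsection \<open>Characteristics\<close>

text \<open>A bound uniform over all positions keeps characteristics from escaping to infinity in
  finite time, which is what makes the flow global.\<close>

definition strip_bounded :: "(real \<times> real \<Rightarrow> real) \<Rightarrow> bool"
  where "strip_bounded l \<longleftrightarrow> (\<forall>T. \<exists>c>0. \<forall>x t. \<bar>t\<bar> \<le> T \<longrightarrow> \<bar>l (x, t)\<bar> \<le> c)"

text \<open>Locally uniform convergence at an explicit rate. The rate passes through Lipschitz maps,
  finite sums and integrals, which is how the limits are shown to solve the integral
  equations.\<close>

definition geometric_limit :: "(nat \<Rightarrow> real \<times> real \<Rightarrow> real) \<Rightarrow> (real \<times> real \<Rightarrow> real) \<Rightarrow> bool"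
  where "geometric_limit F g \<longleftrightarrow>
    (\<forall>R T. \<exists>C. \<forall>m x t. \<bar>x\<bar> \<le> R \<longrightarrow> \<bar>t\<bar> \<le> T \<longrightarrow> \<bar>F m (x, t) - g (x, t)\<bar> \<le> C * (1/2) ^ m)"

lemma lim_geometric:
  fixes f :: "nat \<Rightarrow> real"
  assumes "\<And>m. \<bar>f (Suc m) - f m\<bar> \<le> C * (1/2) ^ m"
  shows "f \<longlonglongrightarrow> lim f" "\<bar>f m - lim f\<bar> \<le> 2 * C * (1/2) ^ m"
proof -
  \<comment> \<open>The geometric sum is kept with its subtracted tail so that the induction on k
    closes.\<close>
  have step: "\<bar>f (m + k) - f m\<bar> \<le> 2 * C * (1/2) ^ m - 2 * C * (1/2) ^ (m + k)" for m k
  proof (induction k)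
    case (Suc k)
    have "\<bar>f (Suc (m + k)) - f m\<bar> \<le> \<bar>f (Suc (m + k)) - f (m + k)\<bar> + \<bar>f (m + k) - f m\<bar>"
      by simp
    with Suc assms[of "m + k"] show ?case by simp
  qed simp
  have C: "C \<ge> 0" using assms[of 0] by simp
  have step': "\<bar>f n - f m\<bar> \<le> 2 * C * (1/2) ^ m" if "m \<le> n" for m n
  proof -
    have "\<bar>f n - f m\<bar> \<le> 2 * C * (1/2) ^ m - 2 * C * (1/2) ^ n"
      using step[of m "n - m"] that by simp
    moreover have "0 \<le> 2 * C * (1/2) ^ n" using C by simp
    ultimately show ?thesis by linarith
  qed
  have lim0: "(\<lambda>m. 2 * C * (1/2) ^ m) \<longlonglongrightarrow> 0"
    by (intro tendsto_mult_right_zero LIMSEQ_power_zero) simp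
  have "Cauchy f"
  proof (rule metric_CauchyI)
    fix e :: real assume "e > 0"
    then obtain M where M: "2 * C * (1/2) ^ M < e / 2"
      using order_tendstoD(2)[OF lim0, of "e/2"] by (auto simp: eventually_sequentially)
    have "dist (f m) (f n) < e" if "m \<ge> M" "n \<ge> M" for m n
      using step'[OF that(1)] step'[OF that(2)] M by (simp add: dist_real_def)
    then show "\<exists>M. \<forall>m\<ge>M. \<forall>n\<ge>M. dist (f m) (f n) < e" by blast
  qed
  then show L: "f \<longlonglongrightarrow> lim f"
    using Cauchy_convergent_iff convergent_LIMSEQ_iff by blast
  have "(\<lambda>n. \<bar>f n - f m\<bar>) \<longlonglongrightarrow> \<bar>lim f - f m\<bar>"
    by (intro tendsto_intros L)
  then have "\<bar>lim f - f m\<bar> \<le> 2 * C * (1/2) ^ m"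
    by (rule Lim_bounded[of _ _ m]) (use step' in auto)
  then show "\<bar>f m - lim f\<bar> \<le> 2 * C * (1/2) ^ m" by simp
qed

lemma geometric_limit_lim:
  assumes "\<And>R T. \<exists>C. \<forall>m x t. \<bar>x\<bar> \<le> R \<longrightarrow> \<bar>t\<bar> \<le> T \<longrightarrow> \<bar>F (Suc m) (x, t) - F m (x, t)\<bar> \<le> C * (1/2) ^ m"
  shows "geometric_limit F (\<lambda>p. lim (\<lambda>m. F m p))"
  unfolding geometric_limit_def
proof (intro allI)
  fix R T
  obtain C where C: "\<And>m x t. \<bar>x\<bar> \<le> R \<Longrightarrow> \<bar>t\<bar> \<le> T \<Longrightarrow> \<bar>F (Suc m) (x, t) - F m (x, t)\<bar> \<le> C * (1/2) ^ m"
    using assms by meson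
  show "\<exists>C. \<forall>m x t. \<bar>x\<bar> \<le> R \<longrightarrow> \<bar>t\<bar> \<le> T \<longrightarrow> \<bar>F m (x, t) - lim (\<lambda>m. F m (x, t))\<bar> \<le> C * (1/2) ^ m"
    using lim_geometric(2)[of "\<lambda>m. F m (_, _)", OF C] by (intro exI[of _ "2 * C"]) blast
qed

lemma geometric_limit_tendsto:
  assumes "geometric_limit F g" shows "(\<lambda>m. F m p) \<longlonglongrightarrow> g p"
proof -
  obtain x t where p: "p = (x, t)" by fastforce
  obtain C where C: "\<And>m. \<bar>F m (x, t) - g (x, t)\<bar> \<le> C * (1/2) ^ m"
    using assms[unfolded geometric_limit_def, rule_format, of "\<bar>x\<bar>" "\<bar>t\<bar>"] by auto
  have "(\<lambda>m. C * (1/2) ^ m) \<longlonglongrightarrow> 0"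
    by (intro tendsto_mult_right_zero LIMSEQ_power_zero) simp
  from Lim_null_comparison[OF _ this, of "\<lambda>m. F m p - g p"] C
  show ?thesis by (simp add: p LIM_zero_iff)
qed

lemma continuous_on_boxesI:
  fixes g :: "real \<times> real \<Rightarrow> real"
  assumes "\<And>R T. continuous_on ({-R..R} \<times> {-T..T}) g"
  shows "continuous_on UNIV g"
  unfolding continuous_on_eq_continuous_at[OF open_UNIV]
proof
  fix p :: "real \<times> real"
  obtain x t where p: "p = (x, t)" by fastforce
  have "p \<in> {-(\<bar>x\<bar>+1)<..<\<bar>x\<bar>+1} \<times> {-(\<bar>t\<bar>+1)<..<\<bar>t\<bar>+1}" by (auto simp: p)
  moreover have "open ({-(\<bar>x\<bar>+1)<..<\<bar>x\<bar>+1} \<times> {-(\<bar>t\<bar>+1)<..<\<bar>t\<bar>+1})"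
    by (intro open_Times open_greaterThanLessThan)
  moreover have "continuous_on ({-(\<bar>x\<bar>+1)<..<\<bar>x\<bar>+1} \<times> {-(\<bar>t\<bar>+1)<..<\<bar>t\<bar>+1}) g"
    by (rule continuous_on_subset[OF assms[of "\<bar>x\<bar>+1" "\<bar>t\<bar>+1"]]) auto
  ultimately show "isCont g p" using continuous_on_eq_continuous_at by blast
qed

lemma continuous_on_UNIV_isCont: "continuous_on UNIV f \<Longrightarrow> isCont f x"
  by (simp add: continuous_on_interior)

lemma geometric_limit_continuous:
  assumes F: "\<And>m. continuous_on UNIV (F m)" and lim: "geometric_limit F g"
  shows "continuous_on UNIV g"
proof (rule continuous_on_boxesI)
  fix R T
  obtain C where C: "\<And>m x t. \<bar>x\<bar> \<le> R \<Longrightarrow> \<bar>t\<bar> \<le> T \<Longrightarrow> \<bar>F m (x, t) - g (x, t)\<bar> \<le> C * (1/2) ^ m"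
    using lim unfolding geometric_limit_def by meson
  have lim0: "(\<lambda>m. C * (1/2) ^ m) \<longlonglongrightarrow> 0"
    by (intro tendsto_mult_right_zero LIMSEQ_power_zero) simp
  have "uniform_limit ({-R..R} \<times> {-T..T}) F g sequentially"
  proof (rule uniform_limitI)
    fix e :: real assume "e > 0"
    then have "\<forall>\<^sub>F m in sequentially. C * (1/2) ^ m < e"
      using order_tendstoD(2)[OF lim0] by blast
    then show "\<forall>\<^sub>F m in sequentially. \<forall>p\<in>{-R..R} \<times> {-T..T}. dist (F m p) (g p) < e"
    proof eventually_elim
      case (elim m)
      show ?case
      proof
        fix p assume "p \<in> {-R..R} \<times> {-T..T}"
        then show "dist (F m p) (g p) < e"
          using C[of "fst p" "snd p" m] elim by (auto simp: dist_real_def abs_le_iff)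
      qed
    qed
  qed
  then show "continuous_on ({-R..R} \<times> {-T..T}) g"
    by (rule uniform_limit_theorem[rotated])
      (use F continuous_on_subset[OF _ subset_UNIV] in \<open>auto intro!: always_eventually\<close>)
qed

lemma tint_diff:
  assumes "continuous_on UNIV a" "continuous_on UNIV b"
  shows "tint (\<lambda>p. a p - b p) (x, t) = tint a (x, t) - tint b (x, t)"
  using tint_eqI[of t "\<lambda>t. tint a (x, t) - tint b (x, t)" "\<lambda>p. a p - b p" x]
    DERIV_diff[OF DERIV_tint_time[OF assms(1)] DERIV_tint_time[OF assms(2)]] by simp

lemma tint_abs_bound:
  assumes "continuous_on UNIV a" and "\<And>s. \<bar>s\<bar> \<le> \<bar>t\<bar> \<Longrightarrow> s * t \<ge> 0 \<Longrightarrow> \<bar>a (x, s)\<bar> \<le> H"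
  shows "\<bar>tint a (x, t)\<bar> \<le> \<bar>t\<bar> * H"
  using tint_abs_exp_bound[of a x 1 t 0 H] assms continuous_on_plane_compose[OF assms(1), of UNIV "\<lambda>s. x" "\<lambda>s. s"]
  by simp

lemma compact_bounded_plane:
  assumes "continuous_on UNIV f" "compact (K :: (real \<times> real) set)"
  obtains L :: real where "L > 0" "\<And>p. p \<in> K \<Longrightarrow> \<bar>f p\<bar> \<le> L"
proof -
  have "compact (f ` K)"
    using assms continuous_on_subset by (intro compact_continuous_image) auto
  then obtain L where "L > 0" "\<forall>y\<in>f ` K. norm y \<le> L"
    using compact_imp_bounded bounded_pos by blast
  then show ?thesis using that by auto
qed

lemma compact_box: "compact ({-R..R} \<times> {-T..T :: real} :: (real \<times> real) set)"
  by (intro compact_Times compact_Icc)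

lemma smooth_fst: "smooth (fst :: real \<times> real \<Rightarrow> real)"
proof (rule smooth_coinduct_plane[of _ "insert fst (range (\<lambda>c p. c))"])
  fix f assume "f \<in> insert fst (range (\<lambda>(c::real) (p :: real \<times> real). c))"
  moreover have "has_grad fst (\<lambda>p. 1) (\<lambda>p. 0)"
    unfolding has_grad_def by (auto intro!: derivative_eq_intros)
  moreover have "has_grad (\<lambda>p. c) (\<lambda>p. 0) (\<lambda>p. 0)" for c
    unfolding has_grad_def by (auto intro!: derivative_eq_intros)
  ultimately show "\<exists>fx\<in>insert fst (range (\<lambda>c p. c)). \<exists>ft\<in>insert fst (range (\<lambda>c p. c)). has_grad f fx ft"
    by blast
qed simp

section \<open>The flow of a single speed\<close>

primrec flow_iter :: "(real \<times> real \<Rightarrow> real) \<Rightarrow> nat \<Rightarrow> real \<times> real \<Rightarrow> real" where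
  "flow_iter l 0 = fst"
| "flow_iter l (Suc m) = (\<lambda>p. fst p + tint (\<lambda>q. l (flow_iter l m q, snd q)) p)"

text \<open>\<open>flow l (y, t)\<close> is the position at time \<open>t\<close> of the characteristic through \<open>(y, 0)\<close>, and
  \<open>foot l (x, t)\<close> is the position at time \<open>0\<close> of the characteristic through \<open>(x, t)\<close>.\<close>

definition flow :: "(real \<times> real \<Rightarrow> real) \<Rightarrow> real \<times> real \<Rightarrow> real"
  where "flow l p = lim (\<lambda>m. flow_iter l m p)"

definition foot :: "(real \<times> real \<Rightarrow> real) \<Rightarrow> real \<times> real \<Rightarrow> real"
  where "foot l p = (THE y. flow l (y, snd p) = fst p)"

text \<open>Integration along characteristics: the solution of \<open>(\<partial>\<^sub>t + l \<partial>\<^sub>x) v = a\<close> with \<open>v(x, 0) = 0\<close>.\<close>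

definition char_int :: "(real \<times> real \<Rightarrow> real) \<Rightarrow> (real \<times> real \<Rightarrow> real) \<Rightarrow> real \<times> real \<Rightarrow> real"
  where "char_int l a p = tint (\<lambda>q. a (flow l q, snd q)) (foot l p, snd p)"

text \<open>The x-derivative of the foot point (\<open>px_foot\<close>), that is, the reciprocal of
  the derivative of the flow at the foot. The exponential form makes it visibly positive, so it may
  serve as a divisor.\<close>

definition stretch :: "(real \<times> real \<Rightarrow> real) \<Rightarrow> real \<times> real \<Rightarrow> real"
  where "stretch l p = exp (- tint (\<lambda>q. px l (flow l q, snd q)) (foot l p, snd p))"

text \<open>A domain of determinacy for speeds at most c, symmetric in time: its half-width is R at
  |t| = T and grows at rate c towards t = 0.\<close>

definition trapezoid :: "real \<Rightarrow> real \<Rightarrow> real \<Rightarrow> (real \<times> real) set"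
  where "trapezoid c R T = {p. \<bar>snd p\<bar> \<le> T \<and> \<bar>fst p\<bar> \<le> R + c * (T - \<bar>snd p\<bar>)}"

locale speed =
  fixes l :: "real \<times> real \<Rightarrow> real"
  assumes smooth_l: "smooth l" and bounded_l: "strip_bounded l"
begin

lemma cont_l: "continuous_on UNIV l"
  by (rule smooth_imp_continuous[OF smooth_l])

lemma bounded_ex: "\<exists>c>0. \<forall>x t. \<bar>t\<bar> \<le> T \<longrightarrow> \<bar>l (x, t)\<bar> \<le> c"
  using bounded_l unfolding strip_bounded_def by blast

lemma cont_along: "continuous_on UNIV f \<Longrightarrow> continuous_on UNIV h \<Longrightarrow> continuous_on UNIV (\<lambda>q :: real \<times> real. h (f q, snd q) :: real)"
  for h :: "real \<times> real \<Rightarrow> real"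
  by (rule continuous_on_plane_compose[of h]) (auto intro: continuous_intros)

lemma cont_flow_iter: "continuous_on UNIV (flow_iter l m)"
proof (induction m)
  case (Suc m)
  show ?case unfolding flow_iter.simps
    by (intro continuous_intros continuous_tint cont_along[OF Suc cont_l])
qed (simp add: continuous_on_fst)

lemma flow_iter_bound:
  assumes "\<And>x t. \<bar>t\<bar> \<le> T \<Longrightarrow> \<bar>l (x, t)\<bar> \<le> c" "\<bar>t\<bar> \<le> T" "c > 0"
  shows "\<bar>flow_iter l m (y, t) - y\<bar> \<le> c * T"
proof (cases m)
  case (Suc k)
  have "\<bar>tint (\<lambda>q. l (flow_iter l k q, snd q)) (y, t)\<bar> \<le> \<bar>t\<bar> * c"
    using assms by (intro tint_abs_bound cont_along[OF cont_flow_iter cont_l]) auto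
  also have "\<dots> \<le> T * c" using assms by (intro mult_right_mono) auto
  finally show ?thesis by (simp add: Suc mult.commute)
qed (use assms in auto)

text \<open>\<open>px l\<close> may be unbounded on a strip, so only a Lipschitz constant on a box
  is available. It suffices because the iterates and the flow stay within c T of their starting
  point.\<close>

lemma lipschitz_l:
  assumes "\<And>p. p \<in> {-R..R} \<times> {-T..T} \<Longrightarrow> \<bar>px l p\<bar> \<le> L" "\<bar>a\<bar> \<le> R" "\<bar>b\<bar> \<le> R" "\<bar>s\<bar> \<le> T"
  shows "\<bar>l (a, s) - l (b, s)\<bar> \<le> L * \<bar>a - b\<bar>"
proof -
  have "norm (l (a, s) - l (b, s)) \<le> L * norm (a - b)"
  proof (rule field_differentiable_bound[of "{-R..R}"])
    show "((\<lambda>x. l (x, s)) has_field_derivative px l (z, s)) (at z within {-R..R})" for z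
      using has_gradD(5)[OF smooth_has_grad[OF smooth_l]] has_field_derivative_at_within by blast
    show "norm (px l (z, s)) \<le> L" if "z \<in> {-R..R}" for z
      using assms(1)[of "(z, s)"] assms(4) that by (auto simp: abs_le_iff)
  qed (use assms(2,3) in auto)
  then show ?thesis by simp
qed

text \<open>Measured against exp (2 L |t|), each iteration costs a factor L by the Lipschitz
  estimate and gains 1/(2 L) by integration, whence the ratio 1/2.\<close>

lemma flow_iter_step:
  "\<exists>C. \<forall>m y t. \<bar>y\<bar> \<le> R \<longrightarrow> \<bar>t\<bar> \<le> T \<longrightarrow> \<bar>flow_iter l (Suc m) (y, t) - flow_iter l m (y, t)\<bar> \<le> C * (1/2) ^ m"
proof -
  obtain c where c: "c > 0" "\<And>x t. \<bar>t\<bar> \<le> T \<Longrightarrow> \<bar>l (x, t)\<bar> \<le> c"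
    using bounded_ex[of T] by blast
  \<comment> \<open>Iterates that start in |y| \<le> R remain in this larger interval for |t| \<le>
    T.\<close>
  define R' where "R' = R + c * T"
  obtain L where L: "L > 0" "\<And>p. p \<in> {-R'..R'} \<times> {-T..T} \<Longrightarrow> \<bar>px l p\<bar> \<le> L"
    using compact_bounded_plane[OF smooth_imp_continuous[OF smooth_px[OF smooth_l]] compact_box] by blast
  have step: "\<bar>flow_iter l (Suc m) (y, t) - flow_iter l m (y, t)\<bar> \<le> c * T * (1/2) ^ m * exp (2 * L * \<bar>t\<bar>)"
    if "\<bar>y\<bar> \<le> R" "\<bar>t\<bar> \<le> T" for m y t
    using that
  proof (induction m arbitrary: t)
    case 0
    then have "0 \<le> c * T" using c by simp
    moreover have "\<bar>flow_iter l (Suc 0) (y, t) - flow_iter l 0 (y, t)\<bar> \<le> c * T"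
      using flow_iter_bound[OF c(2) 0(2) c(1), of "Suc 0" y] by simp
    moreover have "1 \<le> exp (2 * L * \<bar>t\<bar>)" using L by simp
    ultimately show ?case
      using mult_left_mono[of 1 "exp (2 * L * \<bar>t\<bar>)" "c * T"] by simp
  next
    case (Suc m)
    let ?a = "\<lambda>m q. l (flow_iter l m q, snd q)"
    have ca: "continuous_on UNIV (?a m)" for m by (rule cont_along[OF cont_flow_iter cont_l])
    have "\<bar>tint (\<lambda>q. ?a (Suc m) q - ?a m q) (y, t)\<bar>
        \<le> (L * c * T * (1/2) ^ m) * (exp (2 * L * \<bar>t\<bar>) - 1) / (2 * L) + \<bar>t\<bar> * 0"
    proof (rule tint_abs_exp_bound)
      show "continuous_on UNIV (\<lambda>s. ?a (Suc m) (y, s) - ?a m (y, s))"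
        by (intro continuous_on_diff continuous_on_plane_compose[OF ca] continuous_on_const continuous_on_id)
      fix s assume s: "\<bar>s\<bar> \<le> \<bar>t\<bar>"
      have b: "\<bar>flow_iter l m (y, s)\<bar> \<le> R'" for m
        using flow_iter_bound[where T = T and t = s and c = c and m = m and y = y, OF c(2) _ c(1)] s Suc.prems
        by (auto simp: R'_def)
      have "\<bar>?a (Suc m) (y, s) - ?a m (y, s)\<bar> \<le> L * \<bar>flow_iter l (Suc m) (y, s) - flow_iter l m (y, s)\<bar>"
        unfolding snd_conv using L b s Suc.prems by (intro lipschitz_l[of R' T]) (auto simp del: flow_iter.simps)
      also have "\<dots> \<le> L * (c * T * (1/2) ^ m * exp (2 * L * \<bar>s\<bar>))"
        using Suc.IH[of s] s Suc.prems L by (intro mult_left_mono) auto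
      finally show "\<bar>?a (Suc m) (y, s) - ?a m (y, s)\<bar> \<le> L * c * T * (1/2) ^ m * exp (2 * L * \<bar>s\<bar>) + 0"
        by (simp add: mult.assoc)
    qed (use L in auto)
    also have "tint (\<lambda>q. ?a (Suc m) q - ?a m q) (y, t) = flow_iter l (Suc (Suc m)) (y, t) - flow_iter l (Suc m) (y, t)"
      using tint_diff[OF ca ca, of "Suc m" m y t] by simp
    also have "(L * c * T * (1/2) ^ m) * (exp (2 * L * \<bar>t\<bar>) - 1) / (2 * L) + \<bar>t\<bar> * 0 = c * T * (1/2) ^ Suc m * (exp (2 * L * \<bar>t\<bar>) - 1)"
      using L(1) by simp
    also have "\<dots> \<le> c * T * (1/2) ^ Suc m * exp (2 * L * \<bar>t\<bar>)"
      using c Suc.prems by (intro mult_left_mono) auto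
    finally show ?case .
  qed
  show ?thesis
  proof (intro exI[of _ "c * T * exp (2 * L * T)"] allI impI)
    fix m y t assume t: "\<bar>y\<bar> \<le> R" "\<bar>t\<bar> \<le> T"
    have "c * T * (1/2) ^ m * exp (2 * L * \<bar>t\<bar>) \<le> c * T * (1/2) ^ m * exp (2 * L * T)"
      using c L t by (intro mult_left_mono) auto
    with step[OF t, of m] show "\<bar>flow_iter l (Suc m) (y, t) - flow_iter l m (y, t)\<bar> \<le> c * T * exp (2 * L * T) * (1/2) ^ m"
      by (simp add: mult_ac)
  qed
qed

lemma flow_iter_limit: "geometric_limit (flow_iter l) (flow l)"
  using geometric_limit_lim[OF flow_iter_step] by (simp add: flow_def[abs_def])

lemma cont_flow: "continuous_on UNIV (flow l)"
  by (rule geometric_limit_continuous[OF cont_flow_iter flow_iter_limit])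

lemma flow_bound:
  assumes "\<And>x t. \<bar>t\<bar> \<le> T \<Longrightarrow> \<bar>l (x, t)\<bar> \<le> c" "\<bar>t\<bar> \<le> T" "c > 0"
  shows "\<bar>flow l (y, t) - y\<bar> \<le> c * T"
proof (rule Lim_bounded)
  show "(\<lambda>m. \<bar>flow_iter l m (y, t) - y\<bar>) \<longlonglongrightarrow> \<bar>flow l (y, t) - y\<bar>"
    by (intro tendsto_intros geometric_limit_tendsto flow_iter_limit)
qed (use flow_iter_bound[OF assms] in auto)

lemma cont_along_flow: "continuous_on UNIV h \<Longrightarrow> continuous_on UNIV (\<lambda>q. h (flow l q, snd q) :: real)"
  by (rule cont_along[OF cont_flow, of h])

text \<open>The geometric rate survives the map l, which is Lipschitz on the relevant box, and the
  time integral; so the recursion passes to the limit.\<close>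

lemma flow_eq: "flow l (y, t) = y + tint (\<lambda>q. l (flow l q, snd q)) (y, t)"
proof -
  obtain c where c: "c > 0" "\<And>x s. \<bar>s\<bar> \<le> \<bar>t\<bar> \<Longrightarrow> \<bar>l (x, s)\<bar> \<le> c"
    using bounded_ex[of "\<bar>t\<bar>"] by blast
  define R' where "R' = \<bar>y\<bar> + c * \<bar>t\<bar>"
  obtain L where L: "L > 0" "\<And>p. p \<in> {-R'..R'} \<times> {-\<bar>t\<bar>..\<bar>t\<bar>} \<Longrightarrow> \<bar>px l p\<bar> \<le> L"
    using compact_bounded_plane[OF smooth_imp_continuous[OF smooth_px[OF smooth_l]] compact_box] by blast
  obtain C where C: "\<And>m s. \<bar>s\<bar> \<le> \<bar>t\<bar> \<Longrightarrow> \<bar>flow_iter l m (y, s) - flow l (y, s)\<bar> \<le> C * (1/2) ^ m"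
    using flow_iter_limit unfolding geometric_limit_def by (meson order_refl)
  let ?a = "\<lambda>m q. l (flow_iter l m q, snd q)" and ?b = "\<lambda>q. l (flow l q, snd q)"
  note ca = cont_along[OF cont_flow_iter cont_l] and cb = cont_along_flow[OF cont_l]
  have "\<bar>tint (?a m) (y, t) - tint ?b (y, t)\<bar> \<le> (\<bar>t\<bar> * (L * C)) * (1/2) ^ m" for m
  proof -
    have "\<bar>tint (\<lambda>q. ?a m q - ?b q) (y, t)\<bar> \<le> \<bar>t\<bar> * (L * (C * (1/2) ^ m))"
    proof (rule tint_abs_bound)
      show "continuous_on UNIV (\<lambda>q. ?a m q - ?b q)" by (intro continuous_intros ca cb)
      fix s assume s: "\<bar>s\<bar> \<le> \<bar>t\<bar>"
      have "\<bar>flow_iter l m (y, s)\<bar> \<le> R'" "\<bar>flow l (y, s)\<bar> \<le> R'"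
        using flow_iter_bound[OF c(2) s c(1), of m y] flow_bound[OF c(2) s c(1), of y]
        by (auto simp: R'_def)
      then have "\<bar>?a m (y, s) - ?b (y, s)\<bar> \<le> L * \<bar>flow_iter l m (y, s) - flow l (y, s)\<bar>"
        unfolding snd_conv using L s by (intro lipschitz_l[of R' "\<bar>t\<bar>"]) auto
      also have "\<dots> \<le> L * (C * (1/2) ^ m)"
        using C[OF s] L by (intro mult_left_mono) auto
      finally show "\<bar>?a m (y, s) - ?b (y, s)\<bar> \<le> L * (C * (1/2) ^ m)" .
    qed
    then show ?thesis using tint_diff[OF ca cb, of m y t] by (simp add: mult.assoc)
  qed
  moreover have "(\<lambda>m. (\<bar>t\<bar> * (L * C)) * (1/2) ^ m) \<longlonglongrightarrow> 0"
    by (intro tendsto_mult_right_zero LIMSEQ_power_zero) simp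
  ultimately have "(\<lambda>m. tint (?a m) (y, t) - tint ?b (y, t)) \<longlonglongrightarrow> 0"
    by (intro Lim_null_comparison[of "\<lambda>m. tint (?a m) (y, t) - tint ?b (y, t)"]) (auto intro!: always_eventually)
  then have "(\<lambda>m. tint (?a m) (y, t)) \<longlonglongrightarrow> tint ?b (y, t)" by (simp only: LIM_zero_iff)
  then have "(\<lambda>m. flow_iter l (Suc m) (y, t)) \<longlonglongrightarrow> y + tint ?b (y, t)"
    by (auto intro!: tendsto_intros)
  moreover have "(\<lambda>m. flow_iter l (Suc m) (y, t)) \<longlonglongrightarrow> flow l (y, t)"
    using geometric_limit_tendsto[OF flow_iter_limit] by (rule LIMSEQ_Suc)
  ultimately show ?thesis by (rule LIMSEQ_unique[rotated])
qed

lemma flow_0 [simp]: "flow l (y, 0) = y"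
  using flow_eq[of y 0] by simp

lemma DERIV_flow_time: "((\<lambda>t. flow l (y, t)) has_real_derivative l (flow l (y, t), t)) (at t)"
proof -
  have "((\<lambda>t. y + tint (\<lambda>q. l (flow l q, snd q)) (y, t)) has_real_derivative
      0 + l (flow l (y, t), snd (y, t))) (at t)"
    by (intro DERIV_add DERIV_const DERIV_tint_time cont_along_flow[OF cont_l])
  then show ?thesis by (simp only: flow_eq[symmetric] snd_conv add_0)
qed

lemma flow_speed:
  assumes c: "\<And>x t. \<bar>t\<bar> \<le> T \<Longrightarrow> \<bar>l (x, t)\<bar> \<le> c" and "\<bar>s\<bar> \<le> T" "\<bar>t\<bar> \<le> T"
  shows "\<bar>flow l (y, s) - flow l (y, t)\<bar> \<le> c * \<bar>s - t\<bar>"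
proof -
  have "norm (flow l (y, s) - flow l (y, t)) \<le> c * norm (s - t)"
  proof (rule field_differentiable_bound[of "{-T..T}"])
    show "((\<lambda>s. flow l (y, s)) has_field_derivative l (flow l (y, z), z)) (at z within {-T..T})" for z
      using DERIV_flow_time has_field_derivative_at_within by blast
  qed (use assms in auto)
  then show ?thesis by simp
qed

section \<open>Differentiability of the flow in the starting point\<close>

definition dflow :: "real \<times> real \<Rightarrow> real"
  where "dflow p = exp (tint (\<lambda>q. px l (flow l q, snd q)) p)"

lemma linear_ode_unique:
  assumes k: "continuous_on UNIV k" and d: "\<And>t. (d has_real_derivative k (h, t) * d t) (at t)"
  shows "d t = d 0 * exp (tint k (h, t))"
proof -
  have "((\<lambda>t. d t * exp (- tint k (h, t))) has_real_derivative 0) (at t)" for t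
  proof -
    have "((\<lambda>t. - tint k (h, t)) has_real_derivative - k (h, t)) (at t)"
      by (intro DERIV_minus DERIV_tint_time k)
    from DERIV_mult[OF d DERIV_chain2[OF DERIV_exp this]] show ?thesis by (simp add: mult_ac)
  qed
  then have "d t * exp (- tint k (h, t)) = d 0 * exp (- tint k (h, 0))"
    using DERIV_isconst_all[of "\<lambda>t. d t * exp (- tint k (h, t))" t 0] by blast
  then show ?thesis by (simp add: exp_minus field_simps)
qed

text \<open>The difference of two characteristics satisfies a scalar linear equation whose
  coefficient \<open>K\<close> is the mean of \<open>px l\<close> over the segment between them; an
  integrating factor solves it exactly. Strict monotonicity and differentiability in the starting
  point are both read off from the formula.\<close>

lemma flow_difference:
  "\<exists>K. continuous_on UNIV K \<and> (\<forall>t. K (0, t) = px l (flow l (y, t), t)) \<and>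
    (\<forall>h t. flow l (y + h, t) - flow l (y, t) = h * exp (tint K (h, t)))"
proof -
  define K where "K p = integral (cbox 0 1)
      (\<lambda>\<sigma>. px l (flow l (y, snd p) + \<sigma> * (flow l (y + fst p, snd p) - flow l (y, snd p)), snd p))"
    for p :: "real \<times> real"
  note cpx = smooth_imp_continuous[OF smooth_px[OF smooth_l]]
  have cK: "continuous_on UNIV K"
    unfolding K_def
  proof (rule integral_continuous_on_param)
    show "continuous_on (UNIV \<times> cbox 0 1) (\<lambda>(p :: real \<times> real, \<sigma>). px l (flow l (y, snd p) + \<sigma> * (flow l (y + fst p, snd p) - flow l (y, snd p)), snd p))"
      unfolding case_prod_unfold
      by (intro continuous_on_plane_compose[OF cpx] continuous_intros continuous_on_plane_compose[OF cont_flow])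
  qed
  have K: "l (flow l (y + h, t), t) - l (flow l (y, t), t) = K (h, t) * (flow l (y + h, t) - flow l (y, t))" for h t
  proof -
    let ?b = "flow l (y, t)" and ?D = "flow l (y + h, t) - flow l (y, t)"
    have "((\<lambda>\<sigma>. px l (?b + \<sigma> * ?D, t) * ?D) has_integral l (?b + 1 * ?D, t) - l (?b + 0 * ?D, t)) {0..1}"
    proof (rule fundamental_theorem_of_calculus)
      fix \<sigma> :: real
      have "((\<lambda>\<sigma>. ?b + \<sigma> * ?D) has_real_derivative ?D) (at \<sigma> within {0..1})"
        by (auto intro!: derivative_eq_intros)
      from DERIV_chain2[of "\<lambda>x. l (x, t)" _ "\<lambda>\<sigma>. ?b + \<sigma> * ?D" \<sigma>, OF has_gradD(5)[OF smooth_has_grad[OF smooth_l]] this]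
      show "((\<lambda>\<sigma>. l (?b + \<sigma> * ?D, t)) has_vector_derivative px l (?b + \<sigma> * ?D, t) * ?D) (at \<sigma> within {0..1})"
        by (simp only: has_real_derivative_iff_has_vector_derivative)
    qed simp
    from integral_unique[OF this] show ?thesis by (simp add: K_def)
  qed
  have "flow l (y + h, t) - flow l (y, t) = h * exp (tint K (h, t))" for h t
    using linear_ode_unique[OF cK, where d = "\<lambda>t. flow l (y + h, t) - flow l (y, t)" and h = h and t = t]
      DERIV_diff[OF DERIV_flow_time[of "y + h"] DERIV_flow_time[of y]] K by simp
  moreover have "K (0, t) = px l (flow l (y, t), t)" for t
    by (simp add: K_def)
  ultimately show ?thesis using cK by blast
qed

text \<open>Caratheodory's criterion: \<open>exp (tint K (z - y, t))\<close> is a continuous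
  difference quotient. Its value at z = y is the closed-form solution of the variational equation,
  which is \<open>dflow\<close>.\<close>

lemma DERIV_flow_space: "((\<lambda>y. flow l (y, t)) has_real_derivative dflow (y, t)) (at y)"
proof -
  obtain K where K: "continuous_on UNIV K" "\<And>t. K (0, t) = px l (flow l (y, t), t)"
    "\<And>h t. flow l (y + h, t) - flow l (y, t) = h * exp (tint K (h, t))"
    using flow_difference[of y] by blast
  have "tint K (0, t) = tint (\<lambda>q. px l (flow l q, snd q)) (y, t)"
    by (simp add: tint_def K(2))
  then have e: "exp (tint K (y - y, t)) = dflow (y, t)" by (simp add: dflow_def)
  have "continuous_on UNIV (\<lambda>z. exp (tint K (z - y, t)))"
    by (intro continuous_on_exp continuous_on_plane_compose[OF continuous_tint[OF K(1)]] continuous_intros)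
  then have "isCont (\<lambda>z. exp (tint K (z - y, t))) y"
    by (simp add: continuous_on_eq_continuous_at)
  then show ?thesis
    unfolding CARAT_DERIV using K(3)[of "_ - y" t] e
    by (intro exI[of _ "\<lambda>z. exp (tint K (z - y, t))"]) (simp add: mult.commute)
qed

lemma cont_dflow: "continuous_on UNIV dflow"
  unfolding dflow_def[abs_def]
  by (rule continuous_on_exp[OF continuous_tint[OF cont_along_flow[OF smooth_imp_continuous[OF smooth_px[OF smooth_l]]]]])

lemma flow_grad: "has_grad (flow l) dflow (\<lambda>q. l (flow l q, snd q))"
  using has_gradI[OF DERIV_flow_space _ cont_dflow cont_along_flow[OF cont_l]] DERIV_flow_time
  by simp

lemma along_flow_grad:
  assumes "has_grad h hx ht"
  shows "has_grad (\<lambda>q. h (flow l q, snd q)) (\<lambda>q. hx (flow l q, snd q) * dflow q)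
    (\<lambda>q. hx (flow l q, snd q) * l (flow l q, snd q) + ht (flow l q, snd q))"
  by (rule has_grad_shear[OF assms flow_grad])

lemma dflow_grad:
  "has_grad dflow (\<lambda>p. dflow p * tint (\<lambda>q. px (px l) (flow l q, snd q) * dflow q) p)
    (\<lambda>p. dflow p * px l (flow l p, snd p))"
proof -
  note g = along_flow_grad[OF smooth_has_grad[OF smooth_px[OF smooth_l]]]
  have T: "has_grad (tint (\<lambda>q. px l (flow l q, snd q))) (tint (\<lambda>q. px (px l) (flow l q, snd q) * dflow q))
      (\<lambda>q. px l (flow l q, snd q))"
    by (rule has_grad_tint[OF has_gradD(3)[OF g] has_gradD(1)[OF g] has_gradD(5)[OF g]])
  from has_grad_compose_real[of exp exp, OF DERIV_exp continuous_on_exp[OF has_gradD(3)[OF T]] T]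
  show ?thesis unfolding dflow_def[symmetric] .
qed

text \<open>Closure under \<open>tint\<close> matters here: the x-derivative of \<open>dflow\<close>
  is \<open>dflow\<close> times the time integral of another function along the flow. With it, the
  gradients of all generators stay in the generated class.\<close>

lemma smooth_flow: "smooth (flow l)" and smooth_dflow: "smooth dflow"
proof -
  let ?G = "insert dflow {(\<lambda>q. h (flow l q, snd q)) | h. smooth h}"
  have sh: "(\<lambda>q. h (flow l q, snd q)) \<in> tint_closure ?G" if "smooth h" for h
    using that by (intro tint_closure.gen) auto
  have df: "dflow \<in> tint_closure ?G" by (intro tint_closure.gen) simp
  have step: "\<exists>gx\<in>tint_closure ?G. \<exists>gt\<in>tint_closure ?G. has_grad g gx gt" if "g \<in> ?G" for g
  proof -
    from that consider "g = dflow" | h where "smooth h" "g = (\<lambda>q. h (flow l q, snd q))" by auto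
    then show ?thesis
    proof cases
      case 1
      show ?thesis unfolding 1
        by (rule closure_stepI[OF dflow_grad])
          (intro tint_closure.mult tint_closure.tint df sh[of "px l"] sh[of "px (px l)"] smooth_px smooth_l)+
    next
      case 2
      show ?thesis unfolding 2(2)
        by (rule closure_stepI[OF along_flow_grad[OF smooth_has_grad[OF 2(1)]]])
          (intro tint_closure.add tint_closure.mult df sh[of "px h"] sh[of "pt h"] sh[of l]
            smooth_px smooth_pt smooth_l 2)+
    qed
  qed
  \<comment> \<open>The flow is \<open>fst\<close> composed with the flow map, hence itself a
    generator.\<close>
  show "smooth (flow l)"
    using smooth_tint_closure[OF sh[OF smooth_fst] step] by simp
  show "smooth dflow" by (rule smooth_tint_closure[OF df step])
qed

lemma dflow_pos: "dflow p > 0" by (simp add: dflow_def)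

section \<open>The foot point as inverse of the flow\<close>

lemma flow_strict_mono: "y < z \<Longrightarrow> flow l (y, t) < flow l (z, t)"
proof -
  assume "y < z"
  obtain K where K: "\<And>h t. flow l (y + h, t) - flow l (y, t) = h * exp (tint K (h, t))"
    using flow_difference[of y] by blast
  show ?thesis using K[of "z - y" t] \<open>y < z\<close>
    by (smt (verit) exp_gt_zero mult_pos_pos)
qed

lemma flow_less_iff: "flow l (y, t) < flow l (z, t) \<longleftrightarrow> y < z"
  using flow_strict_mono[of y z t] flow_strict_mono[of z y t] by (cases y z rule: linorder_cases) auto

lemma flow_eq_iff: "flow l (y, t) = flow l (z, t) \<longleftrightarrow> y = z"
  using flow_less_iff[of y t z] flow_less_iff[of z t y] by (cases y z rule: linorder_cases) auto

text \<open>Up to time t the flow moves every point by at most c |t|, so its values at x - c |t| and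
  x + c |t| enclose x.\<close>

lemma flow_surj: "\<exists>y. flow l (y, t) = x"
proof -
  obtain c where c: "c > 0" "\<And>x s. \<bar>s\<bar> \<le> \<bar>t\<bar> \<Longrightarrow> \<bar>l (x, s)\<bar> \<le> c"
    using bounded_ex[of "\<bar>t\<bar>"] by blast
  note b = flow_bound[where T = "\<bar>t\<bar>" and t = t and c = c, OF c(2) order_refl c(1)]
  have "\<exists>y\<ge>x - c * \<bar>t\<bar>. y \<le> x + c * \<bar>t\<bar> \<and> flow l (y, t) = x"
  proof (rule IVT')
    show "flow l (x - c * \<bar>t\<bar>, t) \<le> x" using b[of "x - c * \<bar>t\<bar>"] by linarith
    show "x \<le> flow l (x + c * \<bar>t\<bar>, t)" using b[of "x + c * \<bar>t\<bar>"] by linarith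
    show "x - c * \<bar>t\<bar> \<le> x + c * \<bar>t\<bar>" using c(1) by simp
    show "continuous_on {x - c * \<bar>t\<bar>..x + c * \<bar>t\<bar>} (\<lambda>y. flow l (y, t))"
      by (intro continuous_on_plane_compose[OF cont_flow] continuous_intros)
  qed
  then show ?thesis by blast
qed

lemma flow_foot [simp]: "flow l (foot l (x, t), t) = x"
proof -
  obtain y where y: "flow l (y, t) = x" using flow_surj[of t x] ..
  have "foot l (x, t) = y"
    unfolding foot_def snd_conv fst_conv
  proof (rule the_equality)
    show "flow l (y, t) = x" by (rule y)
    show "z = y" if "flow l (z, t) = x" for z using that y flow_eq_iff[of z t y] by simp
  qed
  then show ?thesis using y by simp
qed

lemma foot_flow [simp]: "foot l (flow l (y, t), t) = y"
  using flow_foot[of "flow l (y, t)" t] by (simp only: flow_eq_iff)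

lemma foot_0 [simp]: "foot l (x, 0) = x"
  using foot_flow[of x 0] by simp

text \<open>Replaces a condition on the inverse function by one on the flow from a fixed starting
  point; in this form the measurability of the foot point follows from that of the flow.\<close>

lemma foot_le_iff: "foot l (x, t) \<le> y \<longleftrightarrow> x \<le> flow l (y, t)"
  using flow_less_iff[of y t "foot l (x, t)"] unfolding flow_foot by linarith

text \<open>By monotonicity, a < foot q means that the flow from a at time \<open>snd q\<close> lies
  below \<open>fst q\<close>, an open condition on q because the flow is continuous; likewise for
  the opposite inequality.\<close>

lemma cont_foot: "continuous_on UNIV (foot l)"
  unfolding continuous_on_eq_continuous_at[OF open_UNIV] isCont_def
proof (intro ballI order_tendstoI)
  fix p :: "real \<times> real" and a
  obtain x t where p: "p = (x, t)" by fastforce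
  have "continuous_on UNIV (\<lambda>q :: real \<times> real. fst q - flow l (a, snd q))"
    by (intro continuous_intros continuous_on_plane_compose[OF cont_flow])
  then have c: "((\<lambda>q :: real \<times> real. fst q - flow l (a, snd q)) \<longlongrightarrow> fst p - flow l (a, snd p)) (at p)"
    unfolding isCont_def[symmetric, where f = "\<lambda>q. fst q - flow l (a, snd q)"]
    by (rule continuous_on_UNIV_isCont)
  have e: "flow l (a, snd q) < fst q \<longleftrightarrow> a < foot l q" "fst q < flow l (a, snd q) \<longleftrightarrow> foot l q < a" for q
    using flow_less_iff[of a "snd q" "foot l q"] flow_less_iff[of "foot l q" "snd q" a] flow_foot[of "fst q" "snd q"]
    by (simp_all del: flow_foot)
  show "\<forall>\<^sub>F q in at p. a < foot l q" if "a < foot l p"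
    using order_tendstoD(1)[OF c, of 0] that unfolding e(1)[symmetric] by simp
  show "\<forall>\<^sub>F q in at p. foot l q < a" if "foot l p < a"
    using order_tendstoD(2)[OF c, of 0] that unfolding e(2)[symmetric] by simp
qed

lemma stretch_eq: "stretch l p = inverse (dflow (foot l p, snd p))"
  by (simp add: stretch_def dflow_def exp_minus)

lemma stretch_pos: "stretch l p > 0"
  by (simp add: stretch_def)

lemma cont_along_foot: "continuous_on UNIV h \<Longrightarrow> continuous_on UNIV (\<lambda>q. h (foot l q, snd q) :: real)"
  by (rule cont_along[OF cont_foot, of h])

lemma cont_stretch: "continuous_on UNIV (stretch l)"
  unfolding stretch_eq[abs_def]
  by (intro continuous_on_inverse cont_along_foot[OF cont_dflow]) (simp add: dflow_def)

text \<open>The inverse function rule for the plane map \<Psi>, whose derivative is triangular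
  because time is preserved. \<open>g'\<close> inverts that derivative, and its first component is
  the gradient of the foot point.\<close>

lemma foot_grad: "has_grad (foot l) (stretch l) (\<lambda>p. - (l p * stretch l p))"
  unfolding has_grad_def
proof (intro conjI allI)
  show "continuous_on UNIV (stretch l)" "continuous_on UNIV (\<lambda>p. - (l p * stretch l p))"
    by (intro continuous_intros cont_stretch cont_l)+
  fix p :: "real \<times> real"
  define \<Phi> where "\<Phi> q = (foot l q, snd q)" for q :: "real \<times> real"
  define \<Psi> where "\<Psi> q = (flow l q, snd q)" for q :: "real \<times> real"
  define g' where "g' h = (stretch l p * (fst h - snd h * l p), snd h)" for h :: "real \<times> real"
  have \<Psi>\<Phi>: "\<Psi> (\<Phi> q) = q" for q using flow_foot[of "fst q" "snd q"] by (simp add: \<Phi>_def \<Psi>_def)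
  have lp: "l (flow l (\<Phi> p), snd (\<Phi> p)) = l p" using \<Psi>\<Phi>[of p] by (simp add: \<Psi>_def)
  have d: "(\<Psi> has_derivative (\<lambda>h. (fst h * dflow (\<Phi> p) + snd h * l p, snd h))) (at (\<Phi> p))"
    unfolding \<Psi>_def using has_gradD(4)[OF flow_grad, of "\<Phi> p"] unfolding lp
    by (auto intro!: derivative_eq_intros)
  have s: "stretch l p * dflow (\<Phi> p) = 1"
    using dflow_pos[of "\<Phi> p"] by (simp add: stretch_eq \<Phi>_def)
  have "(\<Phi> has_derivative g') (at p)"
  proof (rule has_derivative_inverse_basic[where f = \<Psi> and g = \<Phi> and T = UNIV, OF d])
    show "bounded_linear g'"
      unfolding g'_def
      by (intro bounded_linear_Pair bounded_linear_const_mult bounded_linear_sub bounded_linear_fst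
          bounded_linear_snd bounded_linear_mult_const)
    have "stretch l p * (a * dflow (\<Phi> p)) = a" for a
      using s by (simp add: mult.left_commute)
    then show "g' \<circ> (\<lambda>h. (fst h * dflow (\<Phi> p) + snd h * l p, snd h)) = id"
      by (auto simp: g'_def fun_eq_iff)
    have "continuous_on UNIV \<Phi>" unfolding \<Phi>_def by (intro continuous_intros cont_foot)
    then show "isCont \<Phi> p" by (rule continuous_on_UNIV_isCont)
  qed (simp_all add: \<Psi>\<Phi>)
  then have "((\<lambda>q. fst (\<Phi> q)) has_derivative (\<lambda>h. fst (g' h))) (at p)"
    by (rule has_derivative_fst)
  moreover have "(\<lambda>q. fst (\<Phi> q)) = foot l"
    by (simp add: \<Phi>_def)
  moreover have "(\<lambda>h. fst (g' h)) = (\<lambda>h. fst h * stretch l p + snd h * (- (l p * stretch l p)))"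
    by (simp add: g'_def algebra_simps)
  ultimately show "(foot l has_derivative (\<lambda>h. fst h * stretch l p + snd h * - (l p * stretch l p))) (at p)"
    by simp
qed

text \<open>By \<open>stretch_eq\<close> the x-derivative of the foot point is again a smooth
  function composed with the foot map, so the gradient formula stays inside the generated
  class.\<close>

lemma smooth_foot: "smooth (foot l)"
proof -
  let ?G = "Collect smooth \<union> {(\<lambda>q. h (foot l q, snd q)) | h. smooth h}"
  have sh: "(\<lambda>q. h (foot l q, snd q)) \<in> tint_closure ?G" if "smooth h" for h
    using that by (intro tint_closure.gen) auto
  have sm: "h \<in> tint_closure ?G" if "smooth h" for h
    using that by (intro tint_closure.gen) auto
  have "smooth (\<lambda>p. inverse (dflow p))"
    by (intro smooth_inverse smooth_dflow) (simp add: dflow_def)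
  from sh[OF this] have st: "stretch l \<in> tint_closure ?G" by (simp add: stretch_eq[abs_def])
  have ml: "(\<lambda>p. - (l p * stretch l p)) \<in> tint_closure ?G"
    using tint_closure.mult[OF sm[OF smooth_uminus[OF smooth_l]] st] by simp
  have step: "\<exists>gx\<in>tint_closure ?G. \<exists>gt\<in>tint_closure ?G. has_grad g gx gt" if "g \<in> ?G" for g
  proof -
    from that consider "smooth g" | h where "smooth h" "g = (\<lambda>q. h (foot l q, snd q))" by auto
    then show ?thesis
    proof cases
      case 1
      then show ?thesis by (rule smooth_closure_step) auto
    next
      case 2
      show ?thesis unfolding 2(2)
        by (rule closure_stepI[OF has_grad_shear[OF smooth_has_grad[OF 2(1)] foot_grad]])
          (intro tint_closure.add tint_closure.mult st ml sh[of "px h"] sh[of "pt h"] smooth_px smooth_pt 2)+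
    qed
  qed
  show ?thesis
    using smooth_tint_closure[OF sh[OF smooth_fst] step] by simp
qed

lemma px_foot: "px (foot l) = stretch l"
  by (rule has_grad_px[OF foot_grad])

lemma smooth_stretch: "smooth (stretch l)"
  using smooth_px[OF smooth_foot] by (simp add: px_foot)

subsection \<open>Integration along characteristics\<close>

lemma cont_char_int: "continuous_on UNIV a \<Longrightarrow> continuous_on UNIV (char_int l a)"
  unfolding char_int_def[abs_def]
  by (rule cont_along_foot[OF continuous_tint[OF cont_along_flow]])

lemma smooth_char_int: "smooth a \<Longrightarrow> smooth (char_int l a)"
  unfolding char_int_def[abs_def]
  by (rule smooth_shear[OF smooth_tint[OF smooth_shear[OF _ smooth_flow]] smooth_foot])

lemma char_int_0 [simp]: "char_int l a (x, 0) = 0"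
  by (simp add: char_int_def)

lemma char_int_diff:
  assumes "continuous_on UNIV a" "continuous_on UNIV b"
  shows "char_int l (\<lambda>p. a p - b p) p = char_int l a p - char_int l b p"
  unfolding char_int_def by (rule tint_diff[OF cont_along_flow[OF assms(1)] cont_along_flow[OF assms(2)]])

text \<open>Pulling a back along the flow produces the factor \<open>dflow\<close>, which is
  1/\<open>stretch\<close> at the moving point, while differentiating the foot point produces
  \<open>stretch\<close> outside. Hence the x-derivative divided by \<open>stretch l\<close> is
  again an integral along the same characteristics; this is the origin of the rescaling used for
  systems. The transport equation then gives the t-derivative.\<close>

lemma char_int_grad:
  assumes a: "continuous_on UNIV a" and ax: "continuous_on UNIV ax"
    and d: "\<And>x t. ((\<lambda>x. a (x, t)) has_real_derivative ax (x, t)) (at x)"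
  defines "b \<equiv> (\<lambda>p. stretch l p * char_int l (\<lambda>q. ax q / stretch l q) p)"
  shows "has_grad (char_int l a) b (\<lambda>p. a p - l p * b p)"
proof -
  let ?ax = "\<lambda>q. ax (flow l q, snd q) * dflow q"
  have T: "has_grad (tint (\<lambda>q. a (flow l q, snd q))) (tint ?ax) (\<lambda>q. a (flow l q, snd q))"
  proof (rule has_grad_tint)
    show "((\<lambda>x. a (flow l (x, t), snd (x, t))) has_real_derivative ?ax (x, t)) (at x)" for x t
      using DERIV_chain2[of "\<lambda>x. a (x, t)" _ "\<lambda>x. flow l (x, t)" x, OF d DERIV_flow_space]
      by simp
  qed (rule cont_along_flow[OF a] continuous_on_mult[OF cont_along_flow[OF ax] cont_dflow])+
  have b: "tint ?ax (foot l p, snd p) * stretch l p = b p" for p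
  proof -
    have "?ax = (\<lambda>q. ax (flow l q, snd q) / stretch l (flow l q, snd q))"
      by (simp add: fun_eq_iff stretch_eq divide_inverse)
    then show ?thesis by (simp add: b_def char_int_def mult.commute)
  qed
  have e1: "(\<lambda>p. tint ?ax (foot l p, snd p) * stretch l p) = b"
    using b by (rule ext)
  have e2: "(\<lambda>p. tint ?ax (foot l p, snd p) * - (l p * stretch l p) + a (flow l (foot l p, snd p), snd p)) = (\<lambda>p. a p - l p * b p)"
  proof
    fix p
    have "a (flow l (foot l p, snd p), snd p) = a p"
      using flow_foot[of "fst p" "snd p"] by simp
    then show "tint ?ax (foot l p, snd p) * - (l p * stretch l p) + a (flow l (foot l p, snd p), snd p) = a p - l p * b p"
      unfolding b[symmetric] by simp
  qed
  from has_grad_shear[OF T foot_grad] show ?thesis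
    unfolding char_int_def[abs_def] snd_conv e1 e2 .
qed

text \<open>Along a characteristic the left-hand side of the equation is the total time derivative
  of u.\<close>

lemma transport_unique:
  assumes u: "has_grad u ux ut" and eq: "\<And>p. ut p + l p * ux p = b p"
  shows "u p = u (foot l p, 0) + char_int l b p"
proof -
  obtain x t where p: "p = (x, t)" by fastforce
  let ?y = "foot l p"
  have "((\<lambda>s. u (flow l (?y, s), s)) has_real_derivative b (flow l (?y, s), s)) (at s)" for s
    using has_gradD(6)[OF along_flow_grad[OF u], of ?y s] eq[of "(flow l (?y, s), s)"]
    by (simp add: mult.commute add.commute)
  then have "tint (\<lambda>q. b (flow l q, snd q)) (?y, t) = u (flow l (?y, t), t) - u (flow l (?y, 0), 0)"
    by (intro tint_eqI) simp
  then show ?thesis by (simp add: char_int_def p)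
qed

text \<open>Going from time t towards 0 until time s moves the characteristic by at most c (|t| -
  |s|), exactly the amount by which the trapezoid widens.\<close>

lemma characteristic_in_trapezoid:
  assumes c: "\<And>x t. \<bar>t\<bar> \<le> T \<Longrightarrow> \<bar>l (x, t)\<bar> \<le> c"
    and p: "p \<in> trapezoid c R T" and s: "\<bar>s\<bar> \<le> \<bar>snd p\<bar>" "s * snd p \<ge> 0"
  shows "(flow l (foot l p, s), s) \<in> trapezoid c R T"
proof -
  obtain x t where pt: "p = (x, t)" by fastforce
  have t: "\<bar>t\<bar> \<le> T" "\<bar>x\<bar> \<le> R + c * (T - \<bar>t\<bar>)" using p by (auto simp: trapezoid_def pt)
  have "\<bar>s - t\<bar> = \<bar>t\<bar> - \<bar>s\<bar>" using s by (auto simp: pt abs_if zero_le_mult_iff split: if_splits)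
  moreover have "\<bar>flow l (foot l p, s) - x\<bar> \<le> c * \<bar>s - t\<bar>"
    using flow_speed[OF c, of T s t "foot l p"] s t by (simp add: pt)
  ultimately have "\<bar>flow l (foot l p, s) - x\<bar> \<le> c * (\<bar>t\<bar> - \<bar>s\<bar>)" by simp
  then have "\<bar>flow l (foot l p, s)\<bar> \<le> R + c * (T - \<bar>t\<bar>) + c * (\<bar>t\<bar> - \<bar>s\<bar>)"
    using t by linarith
  then show ?thesis using s t by (simp add: trapezoid_def pt algebra_simps)
qed

lemma char_int_bound:
  assumes c: "\<And>x t. \<bar>t\<bar> \<le> T \<Longrightarrow> \<bar>l (x, t)\<bar> \<le> c" and mu: "\<mu> > 0" and a: "continuous_on UNIV a"
    and bound: "\<And>q. q \<in> trapezoid c R T \<Longrightarrow> \<bar>a q\<bar> \<le> N * exp (\<mu> * \<bar>snd q\<bar>) + H"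
    and p: "p \<in> trapezoid c R T"
  shows "\<bar>char_int l a p\<bar> \<le> N * (exp (\<mu> * \<bar>snd p\<bar>) - 1) / \<mu> + \<bar>snd p\<bar> * H"
  unfolding char_int_def
proof (rule tint_abs_exp_bound[OF _ mu])
  have "continuous_on UNIV (\<lambda>s. (\<lambda>q. a (flow l q, snd q)) (foot l p, s))"
    by (rule continuous_on_plane_compose[OF cont_along_flow[OF a] continuous_on_const continuous_on_id])
  then show "continuous_on UNIV (\<lambda>s. a (flow l (foot l p, s), snd (foot l p, s)))" .
  fix s assume s: "\<bar>s\<bar> \<le> \<bar>snd p\<bar>" "s * snd p \<ge> 0"
  have "(flow l (foot l p, s), s) \<in> trapezoid c R T"
    using characteristic_in_trapezoid[where p = p and s = s and R = R, OF c p s] .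
  from bound[OF this] show "\<bar>a (flow l (foot l p, s), snd (foot l p, s))\<bar> \<le> N * exp (\<mu> * \<bar>s\<bar>) + H"
    by (simp only: snd_conv)
qed

end

subsection \<open>Linear systems along characteristics\<close>

lemma finite_uniform_bound:
  fixes P :: "'i \<Rightarrow> real \<Rightarrow> bool"
  assumes "finite I" "\<And>i. i \<in> I \<Longrightarrow> \<exists>c>0. P i c"
    and mono: "\<And>i c d. P i c \<Longrightarrow> c \<le> d \<Longrightarrow> P i d"
  shows "\<exists>c>0. \<forall>i\<in>I. P i c"
  using assms(1,2)
proof (induction I)
  case empty
  show ?case by (intro exI[of _ 1]) simp
next
  case (insert i I)
  then obtain c d where "c > 0" "\<forall>i\<in>I. P i c" "d > 0" "P i d" by (meson insertCI)
  then show ?case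
    using mono[of _ c "max c d"] mono[of i d "max c d"] by (intro exI[of _ "max c d"]) auto
qed

lemma trapezoid_subset_box:
  assumes "c \<ge> 0" "p \<in> trapezoid c R T"
  shows "p \<in> {-(R + c * T)..R + c * T} \<times> {-T..T}"
proof -
  have "c * (T - \<bar>snd p\<bar>) \<le> c * T" using assms by (intro mult_left_mono) auto
  then show ?thesis using assms by (cases p) (auto simp: trapezoid_def)
qed

lemma box_subset_trapezoid:
  assumes "c \<ge> 0" "\<bar>x\<bar> \<le> R" "\<bar>t\<bar> \<le> T" shows "(x, t) \<in> trapezoid c R T"
proof -
  have "0 \<le> c * (T - \<bar>t\<bar>)" using assms by simp
  then have "\<bar>x\<bar> \<le> R + c * (T - \<bar>t\<bar>)" using assms by linarith
  then show ?thesis using assms by (simp add: trapezoid_def)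
qed

text \<open>The Picard iterates of \<open>u\<^sub>i = h\<^sub>i + char_int (l i) (\<Sum>\<^sub>j F\<^sub>i\<^sub>j u\<^sub>j)\<close>.\<close>

primrec sol_iter :: "'i set \<Rightarrow> ('i \<Rightarrow> real \<times> real \<Rightarrow> real) \<Rightarrow> ('i \<Rightarrow> 'i \<Rightarrow> real \<times> real \<Rightarrow> real) \<Rightarrow>
    ('i \<Rightarrow> real \<times> real \<Rightarrow> real) \<Rightarrow> nat \<Rightarrow> 'i \<Rightarrow> real \<times> real \<Rightarrow> real" where
  "sol_iter I l F h 0 = (\<lambda>i p. 0)"
| "sol_iter I l F h (Suc m) =
    (\<lambda>i p. h i p + char_int (l i) (\<lambda>q. \<Sum>j\<in>I. F i j q * sol_iter I l F h m j q) p)"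

definition sol :: "'i set \<Rightarrow> ('i \<Rightarrow> real \<times> real \<Rightarrow> real) \<Rightarrow> ('i \<Rightarrow> 'i \<Rightarrow> real \<times> real \<Rightarrow> real) \<Rightarrow>
    ('i \<Rightarrow> real \<times> real \<Rightarrow> real) \<Rightarrow> 'i \<Rightarrow> real \<times> real \<Rightarrow> real"
  where "sol I l F h i p = lim (\<lambda>m. sol_iter I l F h m i p)"

text \<open>Only the integral equation is treated at this level, so continuity of F and h is the
  right regularity; h is the part of the solution that the data determine directly.\<close>

locale transport_system =
  fixes I :: "'i set" and l :: "'i \<Rightarrow> real \<times> real \<Rightarrow> real"
    and F :: "'i \<Rightarrow> 'i \<Rightarrow> real \<times> real \<Rightarrow> real" and h :: "'i \<Rightarrow> real \<times> real \<Rightarrow> real"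
  assumes finite_I: "finite I" and speed_l: "i \<in> I \<Longrightarrow> speed (l i)"
    and cont_F: "i \<in> I \<Longrightarrow> j \<in> I \<Longrightarrow> continuous_on UNIV (F i j)"
    and cont_h: "i \<in> I \<Longrightarrow> continuous_on UNIV (h i)"
begin

abbreviation "iter \<equiv> sol_iter I l F h"
abbreviation "u \<equiv> sol I l F h"

lemma common_speed: "\<exists>c>0. \<forall>i\<in>I. \<forall>x t. \<bar>t\<bar> \<le> T \<longrightarrow> \<bar>l i (x, t)\<bar> \<le> c"
  by (rule finite_uniform_bound[OF finite_I])
    (use speed.bounded_ex[OF speed_l] order_trans in blast)+

lemma common_bound:
  assumes "\<And>i. i \<in> I \<Longrightarrow> continuous_on UNIV (f i)"
  shows "\<exists>D>0. \<forall>i\<in>I. \<forall>p\<in>{-R..R::real} \<times> {-T..T::real}. \<bar>f i p\<bar> \<le> (D :: real)"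
proof (rule finite_uniform_bound[OF finite_I])
  fix i assume "i \<in> I"
  from compact_bounded_plane[OF assms[OF this] compact_box[of R T]]
  show "\<exists>c>0. \<forall>p\<in>{-R..R} \<times> {-T..T}. \<bar>f i p\<bar> \<le> c" by metis
qed (meson order_trans)

lemma common_row_bound: "\<exists>A>0. \<forall>i\<in>I. \<forall>p\<in>{-R..R::real} \<times> {-T..T::real}. (\<Sum>j\<in>I. \<bar>F i j p\<bar>) \<le> (A :: real)"
proof -
  have "\<exists>A>0. \<forall>i\<in>I. \<forall>p\<in>{-R..R} \<times> {-T..T}. \<bar>\<Sum>j\<in>I. \<bar>F i j p\<bar>\<bar> \<le> (A :: real)"
    by (intro common_bound continuous_on_sum continuous_on_rabs cont_F)
  then show ?thesis by simp
qed

lemma row_bound: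
  assumes "(\<Sum>j\<in>I. \<bar>F i j q\<bar>) \<le> A" "\<And>j. j \<in> I \<Longrightarrow> \<bar>w j\<bar> \<le> B" "0 \<le> B"
  shows "\<bar>\<Sum>j\<in>I. F i j q * w j\<bar> \<le> A * B"
proof -
  have "\<bar>\<Sum>j\<in>I. F i j q * w j\<bar> \<le> (\<Sum>j\<in>I. \<bar>F i j q\<bar> * B)"
    by (rule order_trans[OF sum_abs sum_mono]) (auto simp: abs_mult intro!: mult_left_mono assms)
  also have "\<dots> \<le> A * B" using assms by (simp add: sum_distrib_right[symmetric] mult_right_mono)
  finally show ?thesis .
qed

lemma cont_rhs:
  assumes "i \<in> I" "\<And>j. j \<in> I \<Longrightarrow> continuous_on UNIV (w j)"
  shows "continuous_on UNIV (\<lambda>q. \<Sum>j\<in>I. F i j q * w j q)"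
  using assms by (intro continuous_on_sum continuous_on_mult cont_F) auto

lemma cont_iter: "i \<in> I \<Longrightarrow> continuous_on UNIV (iter m i)"
proof (induction m arbitrary: i)
  case (Suc m)
  show ?case unfolding sol_iter.simps
    by (intro continuous_on_add cont_h speed.cont_char_int[OF speed_l] cont_rhs Suc)
qed simp

text \<open>With A a bound for the absolute row sums, the weight exp (2 A |t|) again gives the ratio
  1/2. One trapezoid for the common speed bound c serves every component, although each is
  integrated along its own characteristics.\<close>

lemma iter_step:
  "\<exists>C. \<forall>m. \<forall>i\<in>I. \<forall>x t. \<bar>x\<bar> \<le> R \<longrightarrow> \<bar>t\<bar> \<le> T \<longrightarrow> \<bar>iter (Suc m) i (x, t) - iter m i (x, t)\<bar> \<le> C * (1/2) ^ m"
proof -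
  obtain c where c: "c > 0" "\<And>i x t. i \<in> I \<Longrightarrow> \<bar>t\<bar> \<le> T \<Longrightarrow> \<bar>l i (x, t)\<bar> \<le> c"
    using common_speed[of T] by blast
  let ?B = "{-(R + c * T)..R + c * T} \<times> {-T..T}" and ?S = "trapezoid c R T"
  have SB: "p \<in> ?B" if "p \<in> ?S" for p using trapezoid_subset_box[OF less_imp_le[OF c(1)] that] .
  obtain D where D: "D > 0" "\<And>i p. i \<in> I \<Longrightarrow> p \<in> ?B \<Longrightarrow> \<bar>h i p\<bar> \<le> D"
    using common_bound[of h "R + c * T" T, OF cont_h] by blast
  obtain A where A: "A > 0" "\<And>i p. i \<in> I \<Longrightarrow> p \<in> ?B \<Longrightarrow> (\<Sum>j\<in>I. \<bar>F i j p\<bar>) \<le> A"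
    using common_row_bound[of "R + c * T" T] by blast
  have step: "\<bar>iter (Suc m) i p - iter m i p\<bar> \<le> D * (1/2) ^ m * exp (2 * A * \<bar>snd p\<bar>)"
    if "i \<in> I" "p \<in> ?S" for m i p
    using that
  proof (induction m arbitrary: i p)
    case 0
    have "D * 1 \<le> D * exp (2 * A * \<bar>snd p\<bar>)"
      using D(1) A(1) by (intro mult_left_mono) auto
    with D(2)[OF 0(1) SB[OF 0(2)]] show ?case
      by (simp add: char_int_def tint_def)
  next
    case (Suc m)
    let ?a = "\<lambda>m q. \<Sum>j\<in>I. F i j q * iter m j q"
    have ca: "continuous_on UNIV (?a m)" for m by (intro cont_rhs cont_iter Suc.prems)
    have "\<bar>char_int (l i) (\<lambda>q. ?a (Suc m) q - ?a m q) p\<bar>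
        \<le> (A * (D * (1/2) ^ m)) * (exp (2 * A * \<bar>snd p\<bar>) - 1) / (2 * A) + \<bar>snd p\<bar> * 0"
    proof (rule speed.char_int_bound[OF speed_l[OF Suc.prems(1)] c(2)[OF Suc.prems(1)] _ _ _ Suc.prems(2)])
      show "continuous_on UNIV (\<lambda>q. ?a (Suc m) q - ?a m q)" by (intro continuous_on_diff ca)
      fix q assume q: "q \<in> ?S"
      have "\<bar>\<Sum>j\<in>I. F i j q * (iter (Suc m) j q - iter m j q)\<bar> \<le> A * (D * (1/2) ^ m * exp (2 * A * \<bar>snd q\<bar>))"
        using D(1) by (intro row_bound A(2) Suc.prems SB q Suc.IH) (auto intro!: mult_nonneg_nonneg)
      then show "\<bar>?a (Suc m) q - ?a m q\<bar> \<le> A * (D * (1/2) ^ m) * exp (2 * A * \<bar>snd q\<bar>) + 0"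
        by (simp only: right_diff_distrib sum_subtractf mult.assoc add_0_right)
    qed (use A(1) in auto)
    also have "char_int (l i) (\<lambda>q. ?a (Suc m) q - ?a m q) p = iter (Suc (Suc m)) i p - iter (Suc m) i p"
      using speed.char_int_diff[OF speed_l[OF Suc.prems(1)] ca ca, of "Suc m" m p] by simp
    also have "(A * (D * (1/2) ^ m)) * (exp (2 * A * \<bar>snd p\<bar>) - 1) / (2 * A) + \<bar>snd p\<bar> * 0
        = D * (1/2) ^ Suc m * (exp (2 * A * \<bar>snd p\<bar>) - 1)"
      using A(1) by simp
    also have "\<dots> \<le> D * (1/2) ^ Suc m * exp (2 * A * \<bar>snd p\<bar>)"
      using D(1) by (intro mult_left_mono) auto
    finally show ?case .
  qed
  show ?thesis
  proof (intro exI[of _ "D * exp (2 * A * T)"] allI ballI impI)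
    fix m i x t assume i: "i \<in> I" and xt: "\<bar>x\<bar> \<le> R" "\<bar>t\<bar> \<le> T"
    have "D * (1/2) ^ m * exp (2 * A * \<bar>t\<bar>) \<le> D * (1/2) ^ m * exp (2 * A * T)"
      using D A xt by (intro mult_left_mono) auto
    with step[OF i box_subset_trapezoid[OF less_imp_le[OF c(1)] xt], of m]
    show "\<bar>iter (Suc m) i (x, t) - iter m i (x, t)\<bar> \<le> D * exp (2 * A * T) * (1/2) ^ m"
      by (simp add: mult_ac)
  qed
qed

lemma iter_limit:
  assumes "i \<in> I" shows "geometric_limit (\<lambda>m. iter m i) (u i)"
proof -
  have "geometric_limit (\<lambda>m. iter m i) (\<lambda>p. lim (\<lambda>m. iter m i p))"
    by (rule geometric_limit_lim) (use iter_step assms in blast)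
  then show ?thesis by (simp add: sol_def[abs_def])
qed

lemma cont_sol: "i \<in> I \<Longrightarrow> continuous_on UNIV (u i)"
  by (rule geometric_limit_continuous[OF cont_iter iter_limit])

lemma common_limit_bound:
  "\<exists>C>0. \<forall>i\<in>I. \<forall>m x t. \<bar>x\<bar> \<le> R \<longrightarrow> \<bar>t\<bar> \<le> T \<longrightarrow> \<bar>iter m i (x, t) - u i (x, t)\<bar> \<le> C * (1/2) ^ m"
proof (rule finite_uniform_bound[OF finite_I])
  fix i assume "i \<in> I"
  from iter_limit[OF this, unfolded geometric_limit_def]
  obtain C where C: "\<forall>m x t. \<bar>x\<bar> \<le> R \<longrightarrow> \<bar>t\<bar> \<le> T \<longrightarrow> \<bar>iter m i (x, t) - u i (x, t)\<bar> \<le> C * (1/2) ^ m"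
    by blast
  have "C * (1/2) ^ m \<le> max C 1 * (1/2) ^ m" for m by (intro mult_right_mono) auto
  with C show "\<exists>C>0. \<forall>m x t. \<bar>x\<bar> \<le> R \<longrightarrow> \<bar>t\<bar> \<le> T \<longrightarrow> \<bar>iter m i (x, t) - u i (x, t)\<bar> \<le> C * (1/2) ^ m"
    by (intro exI[of _ "max C 1"]) (meson less_max_iff_disj order_trans zero_less_one)
next
  fix i and C D :: real
  assume C: "\<forall>m x t. \<bar>x\<bar> \<le> R \<longrightarrow> \<bar>t\<bar> \<le> T \<longrightarrow> \<bar>iter m i (x, t) - u i (x, t)\<bar> \<le> C * (1/2) ^ m" and "C \<le> D"
  have "C * (1/2) ^ m \<le> D * (1/2) ^ m" for m using \<open>C \<le> D\<close> by (intro mult_right_mono) auto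
  with C show "\<forall>m x t. \<bar>x\<bar> \<le> R \<longrightarrow> \<bar>t\<bar> \<le> T \<longrightarrow> \<bar>iter m i (x, t) - u i (x, t)\<bar> \<le> D * (1/2) ^ m"
    by (meson order_trans)
qed

lemma sol_eq:
  assumes i: "i \<in> I"
  shows "u i p = h i p + char_int (l i) (\<lambda>q. \<Sum>j\<in>I. F i j q * u j q) p"
proof -
  define T where "T = \<bar>snd p\<bar>"
  define R where "R = \<bar>fst p\<bar>"
  obtain c where c: "c > 0" "\<And>i x t. i \<in> I \<Longrightarrow> \<bar>t\<bar> \<le> T \<Longrightarrow> \<bar>l i (x, t)\<bar> \<le> c"
    using common_speed[of T] by blast
  let ?B = "{-(R + c * T)..R + c * T} \<times> {-T..T}" and ?S = "trapezoid c R T"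
  have SB: "p \<in> ?B" if "p \<in> ?S" for p using trapezoid_subset_box[OF less_imp_le[OF c(1)] that] .
  have p: "p \<in> ?S" using box_subset_trapezoid[OF less_imp_le[OF c(1)], of "fst p" R "snd p" T] by (simp add: R_def T_def)
  obtain A where A: "A > 0" "\<And>i p. i \<in> I \<Longrightarrow> p \<in> ?B \<Longrightarrow> (\<Sum>j\<in>I. \<bar>F i j p\<bar>) \<le> A"
    using common_row_bound[of "R + c * T" T] by blast
  obtain C where C: "C > 0" "\<And>i m x t. i \<in> I \<Longrightarrow> \<bar>x\<bar> \<le> R + c * T \<Longrightarrow> \<bar>t\<bar> \<le> T \<Longrightarrow> \<bar>iter m i (x, t) - u i (x, t)\<bar> \<le> C * (1/2) ^ m"
    using common_limit_bound[of "R + c * T" T] by blast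
  let ?a = "\<lambda>m q. \<Sum>j\<in>I. F i j q * iter m j q" and ?b = "\<lambda>q. \<Sum>j\<in>I. F i j q * u j q"
  have ca: "continuous_on UNIV (?a m)" for m by (intro cont_rhs cont_iter i)
  have cb: "continuous_on UNIV ?b" by (intro cont_rhs cont_sol i)
  have bound: "norm (char_int (l i) (?a m) p - char_int (l i) ?b p) \<le> (T * (A * C)) * (1/2) ^ m" for m
  proof -
    have "\<bar>char_int (l i) (\<lambda>q. ?a m q - ?b q) p\<bar>
        \<le> 0 * (exp (1 * \<bar>snd p\<bar>) - 1) / 1 + \<bar>snd p\<bar> * (A * (C * (1/2) ^ m))"
    proof (rule speed.char_int_bound[OF speed_l[OF i] c(2)[OF i] _ _ _ p])
      show "continuous_on UNIV (\<lambda>q. ?a m q - ?b q)" by (intro continuous_on_diff ca cb)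
      fix q assume q: "q \<in> ?S"
      have "\<bar>\<Sum>j\<in>I. F i j q * (iter m j q - u j q)\<bar> \<le> A * (C * (1/2) ^ m)"
      proof (rule row_bound)
        show "\<bar>iter m j q - u j q\<bar> \<le> C * (1/2) ^ m" if "j \<in> I" for j
          using C(2)[OF that, of "fst q" "snd q" m] SB[OF q] by (cases q) auto
      qed (use C A(2)[OF i SB[OF q]] in auto)
      then show "\<bar>?a m q - ?b q\<bar> \<le> 0 * exp (1 * \<bar>snd q\<bar>) + A * (C * (1/2) ^ m)"
        by (simp only: right_diff_distrib sum_subtractf mult_zero_left add_0_left)
    qed auto
    then show ?thesis
      using speed.char_int_diff[OF speed_l[OF i] ca cb, of m p] by (simp add: T_def mult.assoc)
  qed
  have "(\<lambda>m. (T * (A * C)) * (1/2) ^ m) \<longlonglongrightarrow> 0"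
    by (intro tendsto_mult_right_zero LIMSEQ_power_zero) simp
  then have "(\<lambda>m. char_int (l i) (?a m) p - char_int (l i) ?b p) \<longlonglongrightarrow> 0"
    by (rule Lim_null_comparison[rotated]) (intro always_eventually allI bound)
  then have "(\<lambda>m. char_int (l i) (?a m) p) \<longlonglongrightarrow> char_int (l i) ?b p" by (simp only: LIM_zero_iff)
  then have "(\<lambda>m. iter (Suc m) i p) \<longlonglongrightarrow> h i p + char_int (l i) ?b p"
    unfolding sol_iter.simps by (intro tendsto_add tendsto_const)
  moreover have "(\<lambda>m. iter (Suc m) i p) \<longlonglongrightarrow> u i p"
    using geometric_limit_tendsto[OF iter_limit[OF i]] by (rule LIMSEQ_Suc)
  ultimately show ?thesis by (rule LIMSEQ_unique[rotated])
qed

end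

text \<open>Weighting with \<open>exp (2 A \<bar>t\<bar>)\<close> makes the integral equation a contraction with factor 1/2, which
  replaces Gronwall's inequality.\<close>

lemma transport_energy_estimate:
  fixes l :: "'i \<Rightarrow> real \<times> real \<Rightarrow> real"
  assumes fin: "finite I" and sp: "\<And>i. i \<in> I \<Longrightarrow> speed (l i)"
    and u: "\<And>i. i \<in> I \<Longrightarrow> has_grad (u i) (ux i) (ut i)"
    and F: "\<And>i j. i \<in> I \<Longrightarrow> j \<in> I \<Longrightarrow> continuous_on UNIV (F i j)"
    and H: "\<And>i. i \<in> I \<Longrightarrow> continuous_on UNIV (H i)"
    and eq: "\<And>i p. i \<in> I \<Longrightarrow> ut i p + l i p * ux i p = (\<Sum>j\<in>I. F i j p * u j p) + H i p"
    and c: "c > 0" "\<And>i x t. i \<in> I \<Longrightarrow> \<bar>t\<bar> \<le> T \<Longrightarrow> \<bar>l i (x, t)\<bar> \<le> c"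
    and A: "A > 0" "\<And>i p. i \<in> I \<Longrightarrow> p \<in> trapezoid c R T \<Longrightarrow> (\<Sum>j\<in>I. \<bar>F i j p\<bar>) \<le> A"
    and B: "\<And>i p. i \<in> I \<Longrightarrow> p \<in> trapezoid c R T \<Longrightarrow> \<bar>H i p\<bar> \<le> B"
    and D: "\<And>i x. i \<in> I \<Longrightarrow> \<bar>x\<bar> \<le> R + c * T \<Longrightarrow> \<bar>u i (x, 0)\<bar> \<le> D"
    and i: "i \<in> I" and p: "p \<in> trapezoid c R T"
  shows "\<bar>u i p\<bar> \<le> 2 * (D + T * B) * exp (2 * A * T)"
proof -
  let ?S = "trapezoid c R T"
  interpret transport_system I l F H by (rule transport_system.intro) (use fin sp F H in auto)
  define K where "K = D + T * B"
  have cu: "continuous_on UNIV (u i)" if "i \<in> I" for i using has_gradD(3)[OF u[OF that]] .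
  have T0: "0 \<le> T" using p by (auto simp: trapezoid_def)
  have B0: "0 \<le> B" using B[OF i p] by linarith
  have foot: "\<bar>foot (l i) p\<bar> \<le> R + c * T" if "i \<in> I" "p \<in> ?S" for i p
  proof -
    have "(flow (l i) (foot (l i) p, 0), 0) \<in> ?S"
      by (rule speed.characteristic_in_trapezoid[OF sp[OF that(1)] c(2)[OF that(1)] that(2)]) auto
    then show ?thesis by (simp add: speed.flow_0[OF sp[OF that(1)]] trapezoid_def)
  qed
  have D0: "0 \<le> D" using D[OF i foot[OF i p]] by linarith
  have K0: "0 \<le> K" using T0 B0 D0 by (simp add: K_def)
  \<comment> \<open>This bound comes from compactness alone and says nothing about size. In the
    induction below its share is halved at each pass, while 2 K is the fixed point of X = K + X / 2;
    the limit in m then removes N.\<close>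
  obtain N where N: "N > 0" "\<And>i p. i \<in> I \<Longrightarrow> p \<in> {-(R + c * T)..R + c * T} \<times> {-T..T} \<Longrightarrow> \<bar>u i p\<bar> \<le> N"
    using common_bound[of u "R + c * T" T, OF cu] by blast
  have bound: "\<bar>u i p\<bar> \<le> (2 * K + N * (1/2) ^ m) * exp (2 * A * \<bar>snd p\<bar>)" if "i \<in> I" "p \<in> ?S" for i p m
    using that
  proof (induction m arbitrary: i p)
    case 0
    have "\<bar>u i p\<bar> \<le> (2 * K + N) * 1"
      using N(2)[OF 0(1) trapezoid_subset_box[OF less_imp_le[OF c(1)] 0(2)]] K0 by simp
    also have "\<dots> \<le> (2 * K + N) * exp (2 * A * \<bar>snd p\<bar>)"
      using K0 N(1) A(1) by (intro mult_left_mono) auto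
    finally show ?case by simp
  next
    case (Suc m)
    let ?N = "2 * K + N * (1/2) ^ m" and ?b = "\<lambda>q. (\<Sum>j\<in>I. F i j q * u j q) + H i q"
    have N0: "0 \<le> ?N" using K0 N(1) by simp
    have "\<bar>char_int (l i) ?b p\<bar> \<le> (A * ?N) * (exp (2 * A * \<bar>snd p\<bar>) - 1) / (2 * A) + \<bar>snd p\<bar> * B"
    proof (rule speed.char_int_bound[OF sp[OF Suc.prems(1)] c(2)[OF Suc.prems(1)] _ _ _ Suc.prems(2)])
      show "continuous_on UNIV ?b"
        by (intro continuous_on_add cont_rhs cu H Suc.prems)
      fix q assume q: "q \<in> ?S"
      have "\<bar>\<Sum>j\<in>I. F i j q * u j q\<bar> \<le> A * (?N * exp (2 * A * \<bar>snd q\<bar>))"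
        using N0 by (intro row_bound A(2) Suc.prems q Suc.IH) (auto intro!: mult_nonneg_nonneg)
      then show "\<bar>?b q\<bar> \<le> A * ?N * exp (2 * A * \<bar>snd q\<bar>) + B"
        using B[OF Suc.prems(1) q] unfolding mult.assoc by linarith
    qed (use A(1) in auto)
    also have "(A * ?N) * (exp (2 * A * \<bar>snd p\<bar>) - 1) / (2 * A) = ?N / 2 * (exp (2 * A * \<bar>snd p\<bar>) - 1)"
      using A(1) by simp
    finally have 0: "\<bar>char_int (l i) ?b p\<bar> \<le> ?N / 2 * (exp (2 * A * \<bar>snd p\<bar>) - 1) + \<bar>snd p\<bar> * B" .
    have 1: "\<bar>char_int (l i) ?b p\<bar> \<le> ?N / 2 * exp (2 * A * \<bar>snd p\<bar>) + \<bar>snd p\<bar> * B"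
    proof -
      have "?N / 2 * (exp (2 * A * \<bar>snd p\<bar>) - 1) \<le> ?N / 2 * exp (2 * A * \<bar>snd p\<bar>)"
        using N0 by (intro mult_left_mono) auto
      then show ?thesis using 0 by linarith
    qed
    have "\<bar>snd p\<bar> * B \<le> T * B" using Suc.prems(2) B0 by (intro mult_right_mono) (auto simp: trapezoid_def)
    moreover have "u i p = u i (foot (l i) p, 0) + char_int (l i) ?b p"
      by (rule speed.transport_unique[OF sp[OF Suc.prems(1)] u[OF Suc.prems(1)] eq[OF Suc.prems(1)]])
    ultimately have "\<bar>u i p\<bar> \<le> K + ?N / 2 * exp (2 * A * \<bar>snd p\<bar>)"
      using 1 D[OF Suc.prems(1) foot[OF Suc.prems]] unfolding K_def by linarith
    moreover have "K \<le> K * exp (2 * A * \<bar>snd p\<bar>)"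
      using mult_left_mono[of 1 "exp (2 * A * \<bar>snd p\<bar>)" K] K0 A(1) by simp
    moreover have "(2 * K + N * (1/2) ^ Suc m) * exp (2 * A * \<bar>snd p\<bar>)
        = K * exp (2 * A * \<bar>snd p\<bar>) + ?N / 2 * exp (2 * A * \<bar>snd p\<bar>)"
      by (simp add: field_simps)
    ultimately show ?case by linarith
  qed
  have "(\<lambda>m. (2 * K + N * (1/2) ^ m) * exp (2 * A * \<bar>snd p\<bar>)) \<longlonglongrightarrow> (2 * K + 0) * exp (2 * A * \<bar>snd p\<bar>)"
    by (intro tendsto_intros tendsto_mult_right_zero LIMSEQ_power_zero) simp
  then have "\<bar>u i p\<bar> \<le> (2 * K + 0) * exp (2 * A * \<bar>snd p\<bar>)"
    by (rule LIMSEQ_le_const) (use bound[OF i p] in blast)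
  also have "\<dots> \<le> (2 * K + 0) * exp (2 * A * T)"
    using K0 A(1) p by (intro mult_left_mono) (auto simp: trapezoid_def)
  finally show ?thesis by (simp add: K_def)
qed

subsection \<open>Smoothness of the solution of a linear system\<close>

text \<open>Indices are natural numbers so that the doubled system below has the same type as the
  original one and can be doubled again, once for each further derivative.\<close>

locale smooth_system =
  fixes I :: "nat set" and l :: "nat \<Rightarrow> real \<times> real \<Rightarrow> real"
    and F :: "nat \<Rightarrow> nat \<Rightarrow> real \<times> real \<Rightarrow> real" and h :: "nat \<Rightarrow> real \<times> real \<Rightarrow> real"
  assumes fin: "finite I" and sp: "i \<in> I \<Longrightarrow> speed (l i)"
    and smooth_F: "i \<in> I \<Longrightarrow> j \<in> I \<Longrightarrow> smooth (F i j)"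
    and smooth_h: "i \<in> I \<Longrightarrow> smooth (h i)"
begin

sublocale transport_system I l F h
  by (rule transport_system.intro) (simp_all add: fin sp smooth_F smooth_h smooth_imp_continuous)

text \<open>The derivatives \<open>\<partial>\<^sub>x u\<^sub>i\<close>, divided by \<open>stretch (l i)\<close>, solve a system of the same form together
  with the \<open>u\<^sub>i\<close>. In the doubled system the index \<open>2 i\<close> stands for \<open>u\<^sub>i\<close> and \<open>2 i + 1\<close> for
  \<open>\<partial>\<^sub>x u\<^sub>i / stretch (l i)\<close>.\<close>

definition dI :: "nat set" where "dI = (\<lambda>i. 2 * i) ` I \<union> (\<lambda>i. Suc (2 * i)) ` I"
definition dl :: "nat \<Rightarrow> real \<times> real \<Rightarrow> real" where "dl m = l (m div 2)"
text \<open>Read off from \<open>char_int_grad\<close>: with \<open>v\<^sub>j\<close> the rescaled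
  derivative, the x-derivative of a term of the sum is \<open>px (F i j)\<close> times
  \<open>u\<^sub>j\<close> plus \<open>F i j\<close> times \<open>stretch (l j)\<close> times
  \<open>v\<^sub>j\<close>, and the whole is divided by \<open>stretch (l i)\<close>. The zero block
  reflects that the equations for the \<open>u\<^sub>i\<close> contain no derivatives on the
  right.\<close>

definition dF :: "nat \<Rightarrow> nat \<Rightarrow> real \<times> real \<Rightarrow> real" where
  "dF m k = (let i = m div 2; j = k div 2 in
    if even m then (if even k then F i j else (\<lambda>p. 0))
    else if even k then (\<lambda>p. px (F i j) p * inverse (stretch (l i) p))
    else (\<lambda>p. F i j p * (stretch (l j) p * inverse (stretch (l i) p))))"
definition dh :: "nat \<Rightarrow> real \<times> real \<Rightarrow> real" where
  "dh m = (let i = m div 2 in if even m then h i else (\<lambda>p. px (h i) p * inverse (stretch (l i) p)))"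

lemma dI_cases:
  assumes "m \<in> dI" obtains i where "i \<in> I" "m = 2 * i" | i where "i \<in> I" "m = Suc (2 * i)"
  using assms by (auto simp: dI_def)

lemma sum_dI: "(\<Sum>k\<in>dI. f k) = (\<Sum>j\<in>I. f (2 * j)) + (\<Sum>j\<in>I. f (Suc (2 * j)))" for f :: "nat \<Rightarrow> real"
proof -
  have "(\<Sum>k\<in>dI. f k) = sum f ((\<lambda>i. 2 * i) ` I) + sum f ((\<lambda>i. Suc (2 * i)) ` I)"
    unfolding dI_def using fin by (intro sum.union_disjoint) (auto, presburger)
  then show ?thesis by (simp add: sum.reindex inj_on_def)
qed

lemma smooth_inverse_stretch: "i \<in> I \<Longrightarrow> smooth (\<lambda>p. inverse (stretch (l i) p))"
  using speed.stretch_pos[OF sp] by (intro smooth_inverse speed.smooth_stretch sp) (auto simp: less_le)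

lemma doubled: "smooth_system dI dl dF dh"
proof (rule smooth_system.intro)
  show "finite dI" using fin by (simp add: dI_def)
  fix m assume m: "m \<in> dI"
  then have mI: "m div 2 \<in> I" by (cases rule: dI_cases) auto
  then show "speed (dl m)" by (simp add: dl_def sp)
  show "smooth (dh m)"
    using mI by (auto simp: dh_def Let_def intro!: smooth_h smooth_mult smooth_px smooth_inverse_stretch)
  fix k assume k: "k \<in> dI"
  then have kI: "k div 2 \<in> I" by (cases rule: dI_cases) auto
  show "smooth (dF m k)"
    using mI kI
    by (auto simp: dF_def Let_def intro!: smooth_F smooth_mult smooth_px smooth_inverse_stretch speed.smooth_stretch sp)
qed

sublocale D: transport_system dI dl dF dh
proof -
  interpret d: smooth_system dI dl dF dh by (rule doubled)
  show "transport_system dI dl dF dh" by (rule d.transport_system_axioms)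
qed

lemma D_even: "dl (2 * i) = l i" "dh (2 * i) = h i" "dF (2 * i) (2 * j) = F i j" "dF (2 * i) (Suc (2 * j)) = (\<lambda>p. 0)"
  and D_odd: "dl (Suc (2 * i)) = l i" "dh (Suc (2 * i)) = (\<lambda>p. px (h i) p * inverse (stretch (l i) p))"
    "dF (Suc (2 * i)) (2 * j) = (\<lambda>p. px (F i j) p * inverse (stretch (l i) p))"
    "dF (Suc (2 * i)) (Suc (2 * j)) = (\<lambda>p. F i j p * (stretch (l j) p * inverse (stretch (l i) p)))"
  by (simp_all add: dl_def dh_def dF_def)

lemma D_iter_even: "D.iter m (2 * i) = iter m i"
  by (induction m arbitrary: i) (simp_all add: sum_dI D_even)

lemma D_mem: "i \<in> I \<Longrightarrow> 2 * i \<in> dI" "i \<in> I \<Longrightarrow> Suc (2 * i) \<in> dI"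
  by (auto simp: dI_def)

text \<open>Differentiating one Picard step by \<open>char_int_grad\<close> gives one Picard step of
  the doubled system, so derivatives of iterates are, up to \<open>stretch\<close>, again
  iterates.\<close>

lemma DERIV_iter:
  "i \<in> I \<Longrightarrow> ((\<lambda>x. iter m i (x, t)) has_real_derivative stretch (l i) (x, t) * D.iter m (Suc (2 * i)) (x, t)) (at x)"
proof (induction m arbitrary: i x t)
  case (Suc m)
  let ?a = "\<lambda>q. \<Sum>j\<in>I. F i j q * iter m j q"
  let ?ax = "\<lambda>q. \<Sum>j\<in>I. px (F i j) q * iter m j q + F i j q * (stretch (l j) q * D.iter m (Suc (2 * j)) q)"
  note s0 = speed.stretch_pos[OF sp[OF Suc.prems]]
  have g: "has_grad (char_int (l i) ?a) (\<lambda>p. stretch (l i) p * char_int (l i) (\<lambda>q. ?ax q / stretch (l i) q) p)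
      (\<lambda>p. ?a p - l i p * (stretch (l i) p * char_int (l i) (\<lambda>q. ?ax q / stretch (l i) q) p))"
  proof (rule speed.char_int_grad[OF sp[OF Suc.prems]])
    show "continuous_on UNIV ?a" by (intro cont_rhs cont_iter Suc.prems)
    show "continuous_on UNIV ?ax"
      by (intro continuous_on_sum continuous_on_add continuous_on_mult cont_iter cont_F D.cont_iter D_mem
          smooth_imp_continuous[OF smooth_px[OF smooth_F]] speed.cont_stretch sp Suc.prems)
    show "((\<lambda>x. ?a (x, t)) has_real_derivative ?ax (x, t)) (at x)" for x t
    proof (rule DERIV_sum)
      fix j assume j: "j \<in> I"
      have "((\<lambda>x. F i j (x, t)) has_real_derivative px (F i j) (x, t)) (at x)"
        by (rule has_gradD(5)[OF smooth_has_grad[OF smooth_F[OF Suc.prems j]]])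
      from DERIV_mult[OF this Suc.IH[OF j]]
      show "((\<lambda>x. F i j (x, t) * iter m j (x, t)) has_real_derivative
          px (F i j) (x, t) * iter m j (x, t) + F i j (x, t) * (stretch (l j) (x, t) * D.iter m (Suc (2 * j)) (x, t))) (at x)"
        by (simp add: mult_ac)
    qed
  qed
  have "(\<lambda>q. \<Sum>k\<in>dI. dF (Suc (2 * i)) k q * D.iter m k q) = (\<lambda>q. ?ax q / stretch (l i) q)"
    unfolding sum_dI D_odd D_iter_even divide_inverse sum_distrib_right sum.distrib[symmetric]
    by (intro ext sum.cong refl) (simp add: algebra_simps)
  then have e: "D.iter (Suc m) (Suc (2 * i)) p = px (h i) p * inverse (stretch (l i) p)
      + char_int (l i) (\<lambda>q. ?ax q / stretch (l i) q) p" for p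
    by (simp add: D_odd)
  have "((\<lambda>x. h i (x, t)) has_real_derivative px (h i) (x, t)) (at x)"
    by (rule has_gradD(5)[OF smooth_has_grad[OF smooth_h[OF Suc.prems]]])
  from DERIV_add[OF this has_gradD(5)[OF g, of t x]]
  moreover have "stretch (l i) (x, t) * (px (h i) (x, t) * inverse (stretch (l i) (x, t))) = px (h i) (x, t)"
    using s0[of "(x, t)"] by (simp add: field_simps)
  ultimately show ?case unfolding e distrib_left unfolding sol_iter.simps by (simp only:)
qed simp

text \<open>The derivatives of the iterates come from iterates of the doubled system and therefore
  converge locally uniformly, which permits interchanging differentiation and limit.\<close>

lemma DERIV_sol:
  assumes i: "i \<in> I"
  shows "((\<lambda>x. u i (x, t)) has_real_derivative stretch (l i) (x, t) * D.u (Suc (2 * i)) (x, t)) (at x)"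
proof -
  \<comment> \<open>The margin 1 makes x an interior point, so that the derivative within the
    interval is a full derivative.\<close>
  define R where "R = \<bar>x\<bar> + 1"
  let ?d = "\<lambda>m x. stretch (l i) (x, t) * D.iter m (Suc (2 * i)) (x, t)"
  let ?e = "\<lambda>x. stretch (l i) (x, t) * D.u (Suc (2 * i)) (x, t)"
  obtain Q where Q: "Q > 0" "\<And>p. p \<in> {-R..R} \<times> {-\<bar>t\<bar>..\<bar>t\<bar>} \<Longrightarrow> \<bar>stretch (l i) p\<bar> \<le> Q"
    using compact_bounded_plane[OF speed.cont_stretch[OF sp[OF i]] compact_box] by metis
  obtain C where C: "C > 0" "\<And>m x. \<bar>x\<bar> \<le> R \<Longrightarrow> \<bar>D.iter m (Suc (2 * i)) (x, t) - D.u (Suc (2 * i)) (x, t)\<bar> \<le> C * (1/2) ^ m"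
    using D.common_limit_bound[of R "\<bar>t\<bar>"] D_mem(2)[OF i] by (meson order_refl)
  have bound: "\<bar>?d m x - ?e x\<bar> \<le> Q * C * (1/2) ^ m" if "x \<in> {-R..R}" for m x
  proof -
    have "\<bar>?d m x - ?e x\<bar> = \<bar>stretch (l i) (x, t)\<bar> * \<bar>D.iter m (Suc (2 * i)) (x, t) - D.u (Suc (2 * i)) (x, t)\<bar>"
      by (simp only: right_diff_distrib[symmetric] abs_mult)
    also have "\<dots> \<le> Q * (C * (1/2) ^ m)"
      using that Q C(1) by (intro mult_mono Q C(2)) auto
    finally show ?thesis by (simp add: mult.assoc)
  qed
  have lim0: "(\<lambda>m. Q * C * (1/2) ^ m) \<longlonglongrightarrow> 0"
    by (intro tendsto_mult_right_zero LIMSEQ_power_zero) simp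
  have "\<exists>g. \<forall>x\<in>{-R..R}. (\<lambda>m. iter m i (x, t)) \<longlonglongrightarrow> g x \<and> (g has_derivative (\<lambda>k. ?e x * k)) (at x within {-R..R})"
  proof (rule has_derivative_sequence[where f' = "\<lambda>m x k. ?d m x * k"])
    show "((\<lambda>x. iter m i (x, t)) has_derivative (\<lambda>k. ?d m x * k)) (at x within {-R..R})" for m x
      using DERIV_iter[OF i, of m t x] has_derivative_at_withinI
      unfolding has_field_derivative_def by blast
    show "\<forall>\<^sub>F m in sequentially. \<forall>x\<in>{-R..R}. \<forall>k. norm (?d m x * k - ?e x * k) \<le> e * norm k" if "e > 0" for e
      using order_tendstoD(2)[OF lim0 that]
    proof eventually_elim
      case (elim m)
      show ?case
      proof (intro ballI allI)
        fix x k assume "x \<in> {-R..R}"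
        then have "\<bar>?d m x - ?e x\<bar> \<le> e" using bound[of x m] elim by linarith
        then show "norm (?d m x * k - ?e x * k) \<le> e * norm k"
          by (simp only: left_diff_distrib[symmetric] real_norm_def abs_mult mult_right_mono abs_ge_zero)
      qed
    qed
    show "0 \<in> {-R..R}" by (simp add: R_def)
    show "(\<lambda>m. iter m i (0, t)) \<longlonglongrightarrow> u i (0, t)"
      by (rule geometric_limit_tendsto[OF iter_limit[OF i]])
  qed simp
  then obtain g where g: "\<And>x. x \<in> {-R..R} \<Longrightarrow> (\<lambda>m. iter m i (x, t)) \<longlonglongrightarrow> g x"
      "\<And>x. x \<in> {-R..R} \<Longrightarrow> (g has_derivative (\<lambda>k. ?e x * k)) (at x within {-R..R})" by blast
  have gu: "g x = u i (x, t)" if "x \<in> {-R..R}" for x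
    using LIMSEQ_unique[OF g(1)[OF that] geometric_limit_tendsto[OF iter_limit[OF i]]] .
  have x: "x \<in> {-R<..<R}" by (auto simp: R_def)
  then have "(g has_real_derivative ?e x) (at x)"
    using g(2)[of x] at_within_Icc_at[of "-R" x R] by (simp add: has_field_derivative_def)
  then show ?thesis
    by (rule has_field_derivative_transform_within_open[of _ _ _ "{-R<..<R}"]) (use x gu in auto)
qed

text \<open>The t-derivative is written with sums and products of smooth functions, solutions and a
  component of the doubled system, the shape needed for membership in the generated class.\<close>

lemma sol_grad:
  assumes i: "i \<in> I"
  shows "has_grad (u i) (\<lambda>p. stretch (l i) p * D.u (Suc (2 * i)) p)
    (\<lambda>p. pt (h i) p + (\<Sum>j\<in>I. F i j p * u j p) + - l i p * (stretch (l i) p * D.u (Suc (2 * i)) p + - px (h i) p))"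
proof -
  let ?v = "\<lambda>j p. stretch (l j) p * D.u (Suc (2 * j)) p"
  let ?a = "\<lambda>q. \<Sum>j\<in>I. F i j q * u j q"
  let ?ax = "\<lambda>q. \<Sum>j\<in>I. px (F i j) q * u j q + F i j q * ?v j q"
  have cax: "continuous_on UNIV ?ax"
    by (intro continuous_on_sum continuous_on_add continuous_on_mult cont_sol cont_F D.cont_sol D_mem
          smooth_imp_continuous[OF smooth_px[OF smooth_F]] speed.cont_stretch sp i)
  have dax: "((\<lambda>x. ?a (x, t)) has_real_derivative ?ax (x, t)) (at x)" for x t
  proof (rule DERIV_sum)
    fix j assume j: "j \<in> I"
    have "((\<lambda>x. F i j (x, t)) has_real_derivative px (F i j) (x, t)) (at x)"
      by (rule has_gradD(5)[OF smooth_has_grad[OF smooth_F[OF i j]]])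
    from DERIV_mult[OF this DERIV_sol[OF j]]
    show "((\<lambda>x. F i j (x, t) * u j (x, t)) has_real_derivative
        px (F i j) (x, t) * u j (x, t) + F i j (x, t) * ?v j (x, t)) (at x)"
      by (simp add: mult_ac)
  qed
  obtain b where b: "has_grad (char_int (l i) ?a) b (\<lambda>p. ?a p - l i p * b p)"
    using speed.char_int_grad[OF sp[OF i] cont_rhs[OF i cont_sol] cax dax] by blast
  have u: "u i = (\<lambda>p. h i p + char_int (l i) ?a p)"
    using sol_eq[OF i] by (rule ext)
  have g: "has_grad (u i) (\<lambda>p. px (h i) p + b p) (\<lambda>p. pt (h i) p + (?a p - l i p * b p))"
    by (subst u) (rule has_grad_add[OF smooth_has_grad[OF smooth_h[OF i]] b])
  \<comment> \<open>Two expressions for the x-derivative of \<open>u i\<close>, one from the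
    integral equation and one from the limit of iterates, determine b.\<close>
  have "px (h i) p + b p = ?v i p" for p
    using DERIV_unique[OF has_gradD(5)[OF g, of "snd p" "fst p"] DERIV_sol[OF i]] by simp
  then have b_eq: "b p = ?v i p + - px (h i) p" for p by (simp add: algebra_simps)
  show ?thesis using g unfolding b_eq by (simp add: algebra_simps)
qed

end

lemma sum_closure:
  assumes "\<And>i. i \<in> I \<Longrightarrow> f i \<in> tint_closure G" "(\<lambda>p. 0) \<in> G"
  shows "(\<lambda>p. \<Sum>i\<in>I. f i p) \<in> tint_closure G"
  using assms(1)
  by (induction I rule: infinite_finite_induct) (auto intro: tint_closure.gen tint_closure.add assms(2))

text \<open>The generators are the solutions of all smooth systems. The x-derivative of such a
  solution is \<open>stretch\<close> times a component of the solution of the doubled system, again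
  a generator; the solutions of one fixed system need not suffice.\<close>

lemma (in smooth_system) smooth_sol:
  assumes i: "i \<in> I" shows "smooth (u i)"
proof -
  let ?G = "Collect smooth \<union> {sol I l F h i | I l F h i. smooth_system I l F h \<and> i \<in> I}"
  have sm: "f \<in> tint_closure ?G" if "smooth f" for f using that by (intro tint_closure.gen) simp
  have so: "sol I l F h i \<in> tint_closure ?G" if "smooth_system I l F h" "i \<in> I" for I l F h i
    using that by (intro tint_closure.gen) blast
  show ?thesis
  proof (rule smooth_tint_closure[OF so[OF smooth_system_axioms i]])
    fix g assume "g \<in> ?G"
    then consider "smooth g" | I l F h i where "smooth_system I l F h" "i \<in> I" "g = sol I l F h i" by blast
    then show "\<exists>gx\<in>tint_closure ?G. \<exists>gt\<in>tint_closure ?G. has_grad g gx gt"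
    proof cases
      case 1
      then show ?thesis by (rule smooth_closure_step) simp
    next
      case (2 I l F h i)
      interpret s: smooth_system I l F h by (rule 2(1))
      have v: "(\<lambda>p. stretch (l i) p * s.D.u (Suc (2 * i)) p) \<in> tint_closure ?G"
        by (intro tint_closure.mult sm so speed.smooth_stretch s.sp s.doubled s.D_mem 2(2))
      have z: "(\<lambda>p. 0) \<in> ?G" by simp
      show ?thesis unfolding 2(3)
      proof (rule closure_stepI[OF s.sol_grad[OF 2(2)] v])
        show "(\<lambda>p. pt (h i) p + (\<Sum>j\<in>I. F i j p * s.u j p)
            + - l i p * (stretch (l i) p * s.D.u (Suc (2 * i)) p + - px (h i) p)) \<in> tint_closure ?G"
          by (intro tint_closure.add tint_closure.mult[OF sm[OF smooth_uminus]] sum_closure z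
              tint_closure.mult[OF sm[OF s.smooth_F] so] v sm[OF smooth_pt] sm[OF smooth_uminus] smooth_px
              s.smooth_h speed.smooth_l s.sp 2(1,2))
      qed
    qed
  qed
qed

subsection \<open>The Cauchy problem for smooth data\<close>

text \<open>The solution of the uncoupled equation with source g and initial value v. As the
  inhomogeneous term of the integral equation it carries both data.\<close>

definition free_part :: "(real \<times> real \<Rightarrow> real) \<Rightarrow> (real \<times> real \<Rightarrow> real) \<Rightarrow> (real \<Rightarrow> real) \<Rightarrow> real \<times> real \<Rightarrow> real"
  where "free_part l g v p = v (foot l p) + char_int l g p"

lemma free_part:
  assumes "speed l" and g: "smooth g" and v: "smooth v"
  shows "smooth (free_part l g v)" "pt (free_part l g v) p + l p * px (free_part l g v) p = g p"
    "free_part l g v (x, 0) = v x"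
proof -
  interpret speed l by fact
  show "smooth (free_part l g v)"
    unfolding free_part_def[abs_def]
    by (rule smooth_add[OF smooth_compose_real[OF v smooth_foot] smooth_char_int[OF g]])
  show "free_part l g v (x, 0) = v x" by (simp add: free_part_def)
  have "continuous_on UNIV (\<lambda>p. partial_deriv 1 v (foot l p))"
    by (rule continuous_on_compose2[OF smooth_imp_continuous[OF smooth_partial_deriv[OF v]] cont_foot]) auto
  from has_grad_compose_real[OF smooth_real_deriv[OF v] this foot_grad]
  have 1: "has_grad (\<lambda>p. v (foot l p)) (\<lambda>p. partial_deriv 1 v (foot l p) * stretch l p)
    (\<lambda>p. partial_deriv 1 v (foot l p) * - (l p * stretch l p))" .
  note gg = smooth_has_grad[OF g]
  obtain b where 2: "has_grad (char_int l g) b (\<lambda>p. g p - l p * b p)"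
    using char_int_grad[OF has_gradD(3,1)[OF gg] has_gradD(5)[OF gg]] by blast
  have 3: "has_grad (free_part l g v) (\<lambda>p. partial_deriv 1 v (foot l p) * stretch l p + b p)
      (\<lambda>p. partial_deriv 1 v (foot l p) * - (l p * stretch l p) + (g p - l p * b p))"
    unfolding free_part_def[abs_def] by (rule has_grad_add[OF 1 2])
  show "pt (free_part l g v) p + l p * px (free_part l g v) p = g p"
    unfolding has_grad_px[OF 3] has_grad_pt[OF 3] by (simp add: algebra_simps)
qed

lemma classical_solution:
  fixes I :: "nat set"
  assumes fin: "finite I" and sp: "\<And>i. i \<in> I \<Longrightarrow> speed (l i)"
    and F: "\<And>i j. i \<in> I \<Longrightarrow> j \<in> I \<Longrightarrow> smooth (F i j)"
    and g: "\<And>i. i \<in> I \<Longrightarrow> smooth (g i)" and v: "\<And>i. i \<in> I \<Longrightarrow> smooth (v i)"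
    and i: "i \<in> I"
  defines "u \<equiv> sol I l F (\<lambda>i. free_part (l i) (g i) (v i))"
  shows "smooth (u i)" "pt (u i) p + l i p * px (u i) p = (\<Sum>j\<in>I. F i j p * u j p) + g i p"
    "u i (x, 0) = v i x"
proof -
  let ?h = "\<lambda>i. free_part (l i) (g i) (v i)"
  interpret s: smooth_system I l F ?h
    by (rule smooth_system.intro) (simp_all add: fin sp F g v free_part(1))
  show "smooth (u i)" unfolding u_def by (rule s.smooth_sol[OF i])
  show "u i (x, 0) = v i x"
    using s.sol_eq[OF i, of "(x, 0)"] free_part(3)[OF sp[OF i] g[OF i] v[OF i], of x]
    by (simp add: u_def speed.char_int_0[OF sp[OF i]])
  note gr = s.sol_grad[OF i]
  have "pt (u i) p + l i p * px (u i) p =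
      (\<Sum>j\<in>I. F i j p * u j p) + (pt (?h i) p + l i p * px (?h i) p)"
    unfolding u_def has_grad_px[OF gr] has_grad_pt[OF gr] by (simp add: algebra_simps)
  then show "pt (u i) p + l i p * px (u i) p = (\<Sum>j\<in>I. F i j p * u j p) + g i p"
    using free_part(2)[OF sp[OF i] g[OF i] v[OF i], of p] by simp
qed

subsection \<open>Measurability in the random parameter\<close>

text \<open>Z is a pointwise limit of simple functions. For a simple function the composite is
  pieced together from finitely many \<open>a x\<close>, and continuity in x gives the
  limit.\<close>

lemma borel_measurable_caratheodory:
  fixes a :: "'a::euclidean_space \<Rightarrow> 'w \<Rightarrow> real"
  assumes cont: "\<And>w. continuous_on UNIV (\<lambda>x. a x w)" and meas: "\<And>x. a x \<in> borel_measurable M"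
    and Z: "Z \<in> borel_measurable M"
  shows "(\<lambda>w. a (Z w) w) \<in> borel_measurable M"
proof -
  obtain F where F: "\<And>i. simple_function M (F i)" "\<And>w. w \<in> space M \<Longrightarrow> (\<lambda>i. F i w) \<longlonglongrightarrow> Z w"
    using borel_measurable_implies_sequence_metric[OF Z, of 0] by blast
  show ?thesis
  proof (rule borel_measurable_LIMSEQ_real)
    show "(\<lambda>i. a (F i w) w) \<longlonglongrightarrow> a (Z w) w" if "w \<in> space M" for w
      using continuous_on_tendsto_compose[OF cont F(2)[OF that]] by simp
    fix i
    have fin: "finite (F i ` space M)" using F(1)[of i] by (simp add: simple_function_def)
    have "F i \<in> measurable M (count_space (F i ` space M))"
      using F(1)[of i] by (subst measurable_count_space_eq2[OF fin]) (auto simp: simple_function_def)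
    then show "(\<lambda>w. a (F i w) w) \<in> borel_measurable M"
      by (rule measurable_compose_countable'[OF meas _ countable_finite[OF fin]])
  qed
qed

lemma tint_eq_lborel:
  assumes "continuous_on UNIV b"
  shows "tint b (x, t) = (\<integral>s. indicator {0..1} s *\<^sub>R (t * b (x, t * s)) \<partial>lborel)"
proof -
  have "continuous_on {0..1} (\<lambda>s. t * b (x, t * s))"
    by (intro continuous_on_mult continuous_on_const continuous_on_plane_compose[OF assms] continuous_on_id)
  then have "set_integrable lborel {0..1} (\<lambda>s. t * b (x, t * s))"
    by (rule borel_integrable_atLeastAtMost')
  from set_borel_integral_eq_integral(2)[OF this] show ?thesis
    by (simp only: tint_def set_lebesgue_integral_def fst_conv snd_conv)
qed

text \<open>The starting point X may depend on the random parameter because foot points do.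
  \<open>borel_measurable_caratheodory\<close> on the product with the time axis gives joint
  measurability of the integrand, and integrating out the time preserves measurability.\<close>

lemma borel_measurable_tint:
  fixes b :: "real \<times> real \<Rightarrow> 'w \<Rightarrow> real"
  assumes cont: "\<And>w. continuous_on UNIV (\<lambda>p. b p w)" and meas: "\<And>p. b p \<in> borel_measurable M"
    and X: "X \<in> borel_measurable M"
  shows "(\<lambda>w. tint (\<lambda>p. b p w) (X w, t)) \<in> borel_measurable M"
proof -
  have Z: "(\<lambda>z. (X (fst z), t * snd z)) \<in> borel_measurable (M \<Otimes>\<^sub>M lborel)"
    using X by (intro borel_measurable_Pair borel_measurable_times measurable_compose[OF measurable_fst X])
      (auto simp: measurable_snd'')
  have "(\<lambda>z. b (X (fst z), t * snd z) (fst z)) \<in> borel_measurable (M \<Otimes>\<^sub>M lborel)"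
    using borel_measurable_caratheodory[of "\<lambda>p z. b p (fst z)", OF cont measurable_compose[OF measurable_fst meas] Z] .
  then have "(\<lambda>z. indicator {0..1} (snd z) *\<^sub>R (t * b (X (fst z), t * snd z) (fst z))) \<in> borel_measurable (M \<Otimes>\<^sub>M lborel)"
    by (intro borel_measurable_scaleR borel_measurable_times borel_measurable_const
        measurable_compose[OF measurable_snd, of _ M lborel]) auto
  then have "(\<lambda>w. \<integral>s. indicator {0..1} s *\<^sub>R (t * b (X w, t * s) w) \<partial>lborel) \<in> borel_measurable M"
    by (intro lborel.borel_measurable_lebesgue_integral) (simp add: case_prod_unfold)
  then show ?thesis by (simp only: tint_eq_lborel[OF cont])
qed

text \<open>The conditions on the speed are imposed for every w, so that the iterations converge
  everywhere; the final proof achieves this by setting the data to 0 off a good set.\<close>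

locale random_speed =
  fixes M :: "'w measure" and l :: "real \<times> real \<Rightarrow> 'w \<Rightarrow> real"
  assumes speed: "speed (\<lambda>p. l p w)" and meas_l: "l p \<in> borel_measurable M"
begin

lemma meas_plane:
  fixes a :: "real \<times> real \<Rightarrow> 'w \<Rightarrow> real"
  assumes "\<And>w. continuous_on UNIV (\<lambda>x. a x w)" "\<And>x. a x \<in> borel_measurable M" "Z \<in> borel_measurable M"
  shows "(\<lambda>w. a (Z w, t) w) \<in> borel_measurable M"
  by (rule borel_measurable_caratheodory[OF assms(1,2)]) (intro borel_measurable_Pair assms(3) borel_measurable_const)

lemma meas_flow_iter: "(\<lambda>w. flow_iter (\<lambda>p. l p w) m p) \<in> borel_measurable M"
proof (induction m arbitrary: p)
  case (Suc m)
  obtain x t where p: "p = (x, t)" by fastforce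
  have "(\<lambda>w. tint (\<lambda>q. l (flow_iter (\<lambda>p. l p w) m q, snd q) w) (x, t)) \<in> borel_measurable M"
  proof (rule borel_measurable_tint)
    show "continuous_on UNIV (\<lambda>q. l (flow_iter (\<lambda>p. l p w) m q, snd q) w)" for w
      by (rule speed.cont_along[OF speed speed.cont_flow_iter[OF speed] speed.cont_l[OF speed]])
    show "(\<lambda>w. l (flow_iter (\<lambda>p. l p w) m q, snd q) w) \<in> borel_measurable M" for q
      by (rule meas_plane[OF speed.cont_l[OF speed] meas_l Suc])
  qed simp
  then show ?case unfolding flow_iter.simps p by (intro borel_measurable_add) simp_all
qed simp

lemma meas_flow: "(\<lambda>w. flow (\<lambda>p. l p w) p) \<in> borel_measurable M"
  by (rule borel_measurable_LIMSEQ_real[OF geometric_limit_tendsto[OF speed.flow_iter_limit[OF speed]] meas_flow_iter])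

lemma meas_foot: "(\<lambda>w. foot (\<lambda>p. l p w) p) \<in> borel_measurable M"
proof -
  obtain x t where p: "p = (x, t)" by fastforce
  show ?thesis unfolding p
  proof (rule borel_measurable_iff_le[THEN iffD2], rule allI)
    fix y
    have "{w \<in> space M. x \<le> flow (\<lambda>p. l p w) (y, t)} \<in> sets M"
      using meas_flow by (intro borel_measurable_le) auto
    then show "{w \<in> space M. foot (\<lambda>p. l p w) (x, t) \<le> y} \<in> sets M"
      by (simp only: speed.foot_le_iff[OF speed])
  qed
qed

lemma meas_char_int:
  assumes "\<And>w. continuous_on UNIV (\<lambda>p. a p w)" "\<And>p. a p \<in> borel_measurable M"
  shows "(\<lambda>w. char_int (\<lambda>p. l p w) (\<lambda>p. a p w) p) \<in> borel_measurable M"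
  unfolding char_int_def
proof (rule borel_measurable_tint[OF _ _ meas_foot])
  show "continuous_on UNIV (\<lambda>q. a (flow (\<lambda>p. l p w) q, snd q) w)" for w
    by (rule speed.cont_along_flow[OF speed assms(1)])
  show "(\<lambda>w. a (flow (\<lambda>p. l p w) q, snd q) w) \<in> borel_measurable M" for q
    by (rule meas_plane[OF assms meas_flow])
qed

lemma meas_free_part:
  assumes "\<And>w. smooth (\<lambda>p. g p w)" "\<And>p. g p \<in> borel_measurable M"
    "\<And>w. smooth (\<lambda>x. v x w)" "\<And>x. v x \<in> borel_measurable M"
  shows "(\<lambda>w. free_part (\<lambda>p. l p w) (\<lambda>p. g p w) (\<lambda>x. v x w) p) \<in> borel_measurable M"
  unfolding free_part_def
  by (rule borel_measurable_add[OF borel_measurable_caratheodory[OF smooth_imp_continuous[OF assms(3)] assms(4) meas_foot]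
        meas_char_int[OF smooth_imp_continuous[OF assms(1)] assms(2)]])

end

lemma meas_sol:
  fixes l :: "'i \<Rightarrow> real \<times> real \<Rightarrow> 'w \<Rightarrow> real"
  assumes ts: "\<And>w. transport_system I (\<lambda>i p. l i p w) (\<lambda>i j p. F i j p w) (\<lambda>i p. h i p w)"
    and l: "\<And>i. i \<in> I \<Longrightarrow> random_speed M (l i)"
    and F: "\<And>i j p. i \<in> I \<Longrightarrow> j \<in> I \<Longrightarrow> F i j p \<in> borel_measurable M"
    and h: "\<And>i p. i \<in> I \<Longrightarrow> h i p \<in> borel_measurable M"
    and i: "i \<in> I"
  shows "(\<lambda>w. sol I (\<lambda>i p. l i p w) (\<lambda>i j p. F i j p w) (\<lambda>i p. h i p w) i p) \<in> borel_measurable M"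
proof -
  have "(\<lambda>w. sol_iter I (\<lambda>i p. l i p w) (\<lambda>i j p. F i j p w) (\<lambda>i p. h i p w) m i p) \<in> borel_measurable M"
    if "i \<in> I" for m i p
    using that
  proof (induction m arbitrary: i p)
    case (Suc m)
    let ?it = "\<lambda>j q w. sol_iter I (\<lambda>i p. l i p w) (\<lambda>i j p. F i j p w) (\<lambda>i p. h i p w) m j q"
    have "(\<lambda>w. char_int (\<lambda>p. l i p w) (\<lambda>q. \<Sum>j\<in>I. F i j q w * ?it j q w) p) \<in> borel_measurable M"
    proof (rule random_speed.meas_char_int[OF l[OF Suc.prems], of "\<lambda>q w. \<Sum>j\<in>I. F i j q w * ?it j q w"])
      show "continuous_on UNIV (\<lambda>q. \<Sum>j\<in>I. F i j q w * ?it j q w)" for w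
        by (rule transport_system.cont_rhs[OF ts Suc.prems transport_system.cont_iter[OF ts]])
      show "(\<lambda>w. \<Sum>j\<in>I. F i j q w * ?it j q w) \<in> borel_measurable M" for q
        by (intro borel_measurable_sum borel_measurable_times F Suc)
    qed
    then show ?case unfolding sol_iter.simps by (intro borel_measurable_add h Suc.prems)
  qed simp
  from borel_measurable_LIMSEQ_real[OF geometric_limit_tendsto[OF transport_system.iter_limit[OF ts i]] this[OF i]]
  show ?thesis .
qed

subsection \<open>Growth of families\<close>

lemma eventually_unit: "\<forall>\<^sub>F \<epsilon> in at_right 0. \<epsilon> \<in> {0<..<1::real}"
  unfolding eventually_at_right_field by (intro exI[of _ 1]) auto

lemma eventually_unit': "\<forall>\<^sub>F \<epsilon> in at_right 0. \<epsilon> \<in> {0<..1::real}"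
  using eventually_unit by (rule eventually_mono) auto

text \<open>What moderate and negligible families have in common: a module over the moderate
  families, closed under domination for small \<epsilon>. The estimates for solutions are proved
  once for such a P.\<close>

locale growth =
  fixes P :: "(real \<Rightarrow> real) \<Rightarrow> bool"
  assumes mono: "P r \<Longrightarrow> \<forall>\<^sub>F \<epsilon> in at_right 0. \<bar>s \<epsilon>\<bar> \<le> \<bar>r \<epsilon>\<bar> \<Longrightarrow> P s"
    and add: "P r \<Longrightarrow> P s \<Longrightarrow> P (\<lambda>\<epsilon>. r \<epsilon> + s \<epsilon>)"
    and mult: "moderate m \<Longrightarrow> P r \<Longrightarrow> P (\<lambda>\<epsilon>. m \<epsilon> * r \<epsilon>)"
    and zero: "P (\<lambda>\<epsilon>. 0)"

lemma bigo_powr_mono: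
  assumes "a \<le> b" shows "(\<lambda>\<epsilon>. \<epsilon> powr b) \<in> O[at_right 0](\<lambda>\<epsilon>::real. \<epsilon> powr a)"
proof (rule landau_o.bigI[of 1])
  show "\<forall>\<^sub>F \<epsilon> in at_right 0. norm (\<epsilon> powr b) \<le> 1 * norm (\<epsilon> powr a)"
    using eventually_unit by eventually_elim (use assms in \<open>auto intro!: powr_mono'\<close>)
qed simp

lemma bigo_of_bound:
  assumes "\<forall>\<^sub>F \<epsilon> in at_right 0. \<bar>s \<epsilon>\<bar> \<le> \<bar>r \<epsilon>\<bar>" shows "s \<in> O[at_right 0](r :: real \<Rightarrow> real)"
  using assms by (intro landau_o.bigI[of 1]) auto

lemma moderate_powr: "moderate (\<lambda>\<epsilon>. \<epsilon> powr a)"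
  unfolding moderate_def using bigo_powr_mono[of "- \<bar>a\<bar>" a] by (intro exI[of _ "\<bar>a\<bar>"]) auto

interpretation moderate: growth moderate
proof
  fix r s :: "real \<Rightarrow> real"
  assume "moderate r" and s: "\<forall>\<^sub>F \<epsilon> in at_right 0. \<bar>s \<epsilon>\<bar> \<le> \<bar>r \<epsilon>\<bar>"
  then show "moderate s"
    unfolding moderate_def using landau_o.big_trans[OF bigo_of_bound[OF s]] by blast
next
  fix r s assume "moderate r" "moderate s"
  then obtain a b where *: "a \<ge> 0" "r \<in> O[at_right 0](\<lambda>\<epsilon>. \<epsilon> powr - a)" "b \<ge> 0" "s \<in> O[at_right 0](\<lambda>\<epsilon>. \<epsilon> powr - b)"
    unfolding moderate_def by blast
  have "r \<in> O[at_right 0](\<lambda>\<epsilon>. \<epsilon> powr - max a b)" "s \<in> O[at_right 0](\<lambda>\<epsilon>. \<epsilon> powr - max a b)"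
    using landau_o.big_trans[OF *(2) bigo_powr_mono] landau_o.big_trans[OF *(4) bigo_powr_mono] by auto
  then show "moderate (\<lambda>\<epsilon>. r \<epsilon> + s \<epsilon>)"
    unfolding moderate_def using *(1) by (intro exI[of _ "max a b"] conjI sum_in_bigo) auto
next
  fix r s assume "moderate r" "moderate s"
  then obtain a b where *: "a \<ge> 0" "r \<in> O[at_right 0](\<lambda>\<epsilon>. \<epsilon> powr - a)" "b \<ge> 0" "s \<in> O[at_right 0](\<lambda>\<epsilon>. \<epsilon> powr - b)"
    unfolding moderate_def by blast
  have "(\<lambda>\<epsilon>. r \<epsilon> * s \<epsilon>) \<in> O[at_right 0](\<lambda>\<epsilon>. \<epsilon> powr (- (a + b)))"
    using landau_o.big.mult[OF *(2,4)] by (simp add: powr_add[symmetric] add.commute)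
  then show "moderate (\<lambda>\<epsilon>. r \<epsilon> * s \<epsilon>)"
    unfolding moderate_def using *(1,3) by (intro exI[of _ "a + b"]) auto
next
  show "moderate (\<lambda>\<epsilon>. 0)" unfolding moderate_def by (intro exI[of _ 0]) auto
qed

interpretation negligible: growth negligible_family
proof
  fix r s :: "real \<Rightarrow> real"
  assume "negligible_family r" and s: "\<forall>\<^sub>F \<epsilon> in at_right 0. \<bar>s \<epsilon>\<bar> \<le> \<bar>r \<epsilon>\<bar>"
  then show "negligible_family s"
    unfolding negligible_family_def using landau_o.big_trans[OF bigo_of_bound[OF s]] by blast
next
  fix r s assume "negligible_family r" "negligible_family s"
  then show "negligible_family (\<lambda>\<epsilon>. r \<epsilon> + s \<epsilon>)"
    unfolding negligible_family_def by (auto intro: sum_in_bigo)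
next
  fix m r assume "moderate m" and r: "negligible_family r"
  then obtain a where a: "a \<ge> 0" "m \<in> O[at_right 0](\<lambda>\<epsilon>. \<epsilon> powr - a)"
    unfolding moderate_def by blast
  show "negligible_family (\<lambda>\<epsilon>. m \<epsilon> * r \<epsilon>)"
    unfolding negligible_family_def
  proof (intro allI impI)
    fix b :: real assume "b \<ge> 0"
    then have "r \<in> O[at_right 0](\<lambda>\<epsilon>. \<epsilon> powr (a + b))" using r a(1) unfolding negligible_family_def by simp
    from landau_o.big.mult[OF a(2) this] show "(\<lambda>\<epsilon>. m \<epsilon> * r \<epsilon>) \<in> O[at_right 0](\<lambda>\<epsilon>. \<epsilon> powr b)"
      by (simp add: powr_add[symmetric])
  qed
next
  show "negligible_family (\<lambda>\<epsilon>. 0)" unfolding negligible_family_def by auto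
qed

lemma negligible_imp_moderate: "negligible_family r \<Longrightarrow> moderate r"
  unfolding negligible_family_def moderate_def by (intro exI[of _ 0]) auto

lemma moderate_const: "moderate (\<lambda>\<epsilon>. c)"
proof -
  have "moderate (\<lambda>\<epsilon>. \<epsilon> powr 0)" by (rule moderate_powr)
  moreover have "\<forall>\<^sub>F \<epsilon>::real in at_right 0. \<epsilon> powr 0 = 1"
    using eventually_unit by eventually_elim auto
  ultimately have "moderate (\<lambda>\<epsilon>. 1)"
    by (rule moderate.mono[OF _ eventually_mono]) auto
  moreover have "(\<lambda>\<epsilon>. c) \<in> O[at_right 0](\<lambda>\<epsilon>::real. 1 :: real)" by simp
  ultimately show ?thesis unfolding moderate_def using landau_o.big_trans by blast
qed

text \<open>Naming a majorant for each compact set avoids suprema and the question whether they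
  exist; for continuous functions \<open>dominated_iff_SUP\<close> recovers the supremum
  form.\<close>

definition dominated :: "((real \<Rightarrow> real) \<Rightarrow> bool) \<Rightarrow> (real \<Rightarrow> 'a::topological_space \<Rightarrow> real) \<Rightarrow> bool"
  where "dominated P u \<longleftrightarrow>
    (\<forall>K. compact K \<longrightarrow> (\<exists>r. P r \<and> (\<forall>\<^sub>F \<epsilon> in at_right 0. \<forall>x\<in>K. \<bar>u \<epsilon> x\<bar> \<le> r \<epsilon>)))"

lemma dominatedD:
  assumes "dominated P u" "compact K"
  shows "\<exists>r. P r \<and> (\<forall>\<^sub>F \<epsilon> in at_right 0. \<forall>x\<in>K. \<bar>u \<epsilon> x\<bar> \<le> r \<epsilon>)"
  using assms unfolding dominated_def by blast

lemma dominated_cong: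
  assumes "dominated P u" "\<And>\<epsilon>. \<epsilon> \<in> {0<..1} \<Longrightarrow> v \<epsilon> = u \<epsilon>"
  shows "dominated P v"
  unfolding dominated_def
proof (intro allI impI)
  fix K :: "'a set" assume "compact K"
  then obtain r where r: "P r" "\<forall>\<^sub>F \<epsilon> in at_right 0. \<forall>x\<in>K. \<bar>u \<epsilon> x\<bar> \<le> r \<epsilon>"
    using dominatedD[OF assms(1)] by blast
  have "\<forall>\<^sub>F \<epsilon> in at_right 0. \<forall>x\<in>K. \<bar>v \<epsilon> x\<bar> \<le> r \<epsilon>"
    using r(2) eventually_unit' by eventually_elim (simp add: assms(2))
  with r(1) show "\<exists>r. P r \<and> (\<forall>\<^sub>F \<epsilon> in at_right 0. \<forall>x\<in>K. \<bar>v \<epsilon> x\<bar> \<le> r \<epsilon>)" by blast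
qed

lemma dominated_negligible_imp_moderate: "dominated negligible_family u \<Longrightarrow> dominated moderate u"
  unfolding dominated_def using negligible_imp_moderate by blast

context growth
begin

lemma dominated_zero: "dominated P (\<lambda>\<epsilon> x. 0)"
  unfolding dominated_def using zero by (intro allI impI exI[of _ "\<lambda>\<epsilon>. 0"]) auto

lemma dominated_abs: "dominated P (\<lambda>\<epsilon> x. \<bar>u \<epsilon> x\<bar>) \<longleftrightarrow> dominated P u"
  by (simp add: dominated_def)

lemma dominated_uminus: "dominated P (\<lambda>\<epsilon> x. - u \<epsilon> x) \<longleftrightarrow> dominated P u"
  by (simp add: dominated_def)

lemma dominated_add:
  assumes "dominated P u" "dominated P v" shows "dominated P (\<lambda>\<epsilon> x. u \<epsilon> x + v \<epsilon> x)"
  unfolding dominated_def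
proof (intro allI impI)
  fix K :: "'a set" assume K: "compact K"
  obtain r s where r: "P r" "\<forall>\<^sub>F \<epsilon> in at_right 0. \<forall>x\<in>K. \<bar>u \<epsilon> x\<bar> \<le> r \<epsilon>"
    and s: "P s" "\<forall>\<^sub>F \<epsilon> in at_right 0. \<forall>x\<in>K. \<bar>v \<epsilon> x\<bar> \<le> s \<epsilon>"
    using dominatedD[OF assms(1) K] dominatedD[OF assms(2) K] by blast
  have "\<forall>\<^sub>F \<epsilon> in at_right 0. \<forall>x\<in>K. \<bar>u \<epsilon> x + v \<epsilon> x\<bar> \<le> r \<epsilon> + s \<epsilon>"
    using r(2) s(2)
  proof eventually_elim
    case (elim \<epsilon>)
    show ?case
    proof
      fix x assume "x \<in> K"
      then have "\<bar>u \<epsilon> x\<bar> \<le> r \<epsilon>" "\<bar>v \<epsilon> x\<bar> \<le> s \<epsilon>" using elim by auto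
      then show "\<bar>u \<epsilon> x + v \<epsilon> x\<bar> \<le> r \<epsilon> + s \<epsilon>" by linarith
    qed
  qed
  with add[OF r(1) s(1)] show "\<exists>r. P r \<and> (\<forall>\<^sub>F \<epsilon> in at_right 0. \<forall>x\<in>K. \<bar>u \<epsilon> x + v \<epsilon> x\<bar> \<le> r \<epsilon>)"
    by (intro exI[of _ "\<lambda>\<epsilon>. r \<epsilon> + s \<epsilon>"] conjI)
qed

lemma dominated_mult:
  assumes "dominated moderate u" "dominated P v" shows "dominated P (\<lambda>\<epsilon> x. u \<epsilon> x * v \<epsilon> x)"
  unfolding dominated_def
proof (intro allI impI)
  fix K :: "'a set" assume K: "compact K"
  obtain r s where r: "moderate r" "\<forall>\<^sub>F \<epsilon> in at_right 0. \<forall>x\<in>K. \<bar>u \<epsilon> x\<bar> \<le> r \<epsilon>"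
    and s: "P s" "\<forall>\<^sub>F \<epsilon> in at_right 0. \<forall>x\<in>K. \<bar>v \<epsilon> x\<bar> \<le> s \<epsilon>"
    using dominatedD[OF assms(1) K] dominatedD[OF assms(2) K] by blast
  have "\<forall>\<^sub>F \<epsilon> in at_right 0. \<forall>x\<in>K. \<bar>u \<epsilon> x * v \<epsilon> x\<bar> \<le> r \<epsilon> * s \<epsilon>"
    using r(2) s(2)
  proof eventually_elim
    case (elim \<epsilon>)
    show ?case
    proof
      fix x assume "x \<in> K"
      then have "\<bar>u \<epsilon> x\<bar> \<le> r \<epsilon>" "\<bar>v \<epsilon> x\<bar> \<le> s \<epsilon>" using elim by auto
      moreover from this(1) have "0 \<le> r \<epsilon>" by linarith
      ultimately show "\<bar>u \<epsilon> x * v \<epsilon> x\<bar> \<le> r \<epsilon> * s \<epsilon>"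
        unfolding abs_mult by (intro mult_mono) auto
    qed
  qed
  with mult[OF r(1) s(1)] show "\<exists>r. P r \<and> (\<forall>\<^sub>F \<epsilon> in at_right 0. \<forall>x\<in>K. \<bar>u \<epsilon> x * v \<epsilon> x\<bar> \<le> r \<epsilon>)"
    by (intro exI[of _ "\<lambda>\<epsilon>. r \<epsilon> * s \<epsilon>"] conjI)
qed

lemma dominated_sum:
  "(\<And>i. i \<in> I \<Longrightarrow> dominated P (u i)) \<Longrightarrow> dominated P (\<lambda>\<epsilon> x. \<Sum>i\<in>I. u i \<epsilon> x)"
  by (induction I rule: infinite_finite_induct) (auto intro: dominated_zero dominated_add)

lemma dominated_iff_SUP:
  fixes u :: "real \<Rightarrow> 'a::metric_space \<Rightarrow> real"
  assumes cont: "\<And>\<epsilon>. \<epsilon> \<in> {0<..1} \<Longrightarrow> continuous_on UNIV (u \<epsilon>)"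
  shows "dominated P u \<longleftrightarrow> (\<forall>K. compact K \<and> K \<noteq> {} \<longrightarrow> P (\<lambda>\<epsilon>. SUP x\<in>K. \<bar>u \<epsilon> x\<bar>))"
proof -
  have bdd: "bdd_above ((\<lambda>x. \<bar>u \<epsilon> x\<bar>) ` K)" if "compact K" "\<epsilon> \<in> {0<..1}" for \<epsilon> K
  proof -
    have "compact ((\<lambda>x. \<bar>u \<epsilon> x\<bar>) ` K)"
      using that by (intro compact_continuous_image continuous_on_rabs continuous_on_subset[OF cont]) auto
    then show ?thesis by (intro bounded_imp_bdd_above compact_imp_bounded)
  qed
  show ?thesis
  proof (intro iffI allI impI)
    fix K :: "'a set" assume u: "dominated P u" and K: "compact K \<and> K \<noteq> {}"
    then obtain r where r: "P r" "\<forall>\<^sub>F \<epsilon> in at_right 0. \<forall>x\<in>K. \<bar>u \<epsilon> x\<bar> \<le> r \<epsilon>"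
      using dominatedD[OF u] by blast
    from r(1) show "P (\<lambda>\<epsilon>. SUP x\<in>K. \<bar>u \<epsilon> x\<bar>)"
    proof (rule mono)
      show "\<forall>\<^sub>F \<epsilon> in at_right 0. \<bar>SUP x\<in>K. \<bar>u \<epsilon> x\<bar>\<bar> \<le> \<bar>r \<epsilon>\<bar>"
        using r(2) eventually_unit'
      proof eventually_elim
        case (elim \<epsilon>)
        obtain z where z: "z \<in> K" using K by blast
        have "(SUP x\<in>K. \<bar>u \<epsilon> x\<bar>) \<le> r \<epsilon>" using K elim by (intro cSUP_least) auto
        moreover have "\<bar>u \<epsilon> z\<bar> \<le> (SUP x\<in>K. \<bar>u \<epsilon> x\<bar>)" using K elim bdd z by (intro cSUP_upper) auto
        ultimately show ?case by linarith
      qed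
    qed
  next
    assume sup: "\<forall>K. compact K \<and> K \<noteq> {} \<longrightarrow> P (\<lambda>\<epsilon>. SUP x\<in>K. \<bar>u \<epsilon> x\<bar>)"
    show "dominated P u"
      unfolding dominated_def
    proof (intro allI impI)
      fix K :: "'a set" assume K: "compact K"
      show "\<exists>r. P r \<and> (\<forall>\<^sub>F \<epsilon> in at_right 0. \<forall>x\<in>K. \<bar>u \<epsilon> x\<bar> \<le> r \<epsilon>)"
      proof (cases "K = {}")
        case True
        then show ?thesis using zero by auto
      next
        case False
        have "\<forall>\<^sub>F \<epsilon> in at_right 0. \<forall>x\<in>K. \<bar>u \<epsilon> x\<bar> \<le> (SUP x\<in>K. \<bar>u \<epsilon> x\<bar>)"
          using eventually_unit' by eventually_elim (auto intro!: cSUP_upper bdd[OF K])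
        with sup K False show ?thesis by blast
      qed
    qed
  qed
qed

end

definition smooth_growth :: "((real \<Rightarrow> real) \<Rightarrow> bool) \<Rightarrow> (real \<Rightarrow> 'a::euclidean_space \<Rightarrow> real) set"
  where "smooth_growth P = {u. (\<forall>\<epsilon>\<in>{0<..1}. smooth (u \<epsilon>)) \<and>
    (\<forall>bs\<in>lists Basis. dominated P (\<lambda>\<epsilon>. partial_derivs bs (u \<epsilon>)))}"

lemma smooth_growthD:
  assumes "u \<in> smooth_growth P"
  shows "\<epsilon> \<in> {0<..1} \<Longrightarrow> smooth (u \<epsilon>)" "bs \<in> lists Basis \<Longrightarrow> dominated P (\<lambda>\<epsilon>. partial_derivs bs (u \<epsilon>))"
    "dominated P u"
proof -
  show bs: "dominated P (\<lambda>\<epsilon>. partial_derivs bs (u \<epsilon>))" if "bs \<in> lists Basis" for bs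
    using assms that unfolding smooth_growth_def by blast
  show "dominated P u" using bs[of "[]"] by simp
  show "smooth (u \<epsilon>)" if "\<epsilon> \<in> {0<..1}"
    using assms that unfolding smooth_growth_def by blast
qed

lemma (in growth) smooth_growth_SUP:
  "smooth_growth P = {u. (\<forall>\<epsilon>\<in>{0<..1}. smooth (u \<epsilon>)) \<and>
    (\<forall>K bs. compact K \<and> K \<noteq> {} \<and> bs \<in> lists Basis \<longrightarrow>
      P (\<lambda>\<epsilon>. SUP x\<in>K. \<bar>partial_derivs bs (u \<epsilon>) x\<bar>))}"
proof -
  have "dominated P (\<lambda>\<epsilon>. partial_derivs bs (u \<epsilon>)) \<longleftrightarrow>
      (\<forall>K. compact K \<and> K \<noteq> {} \<longrightarrow> P (\<lambda>\<epsilon>. SUP x\<in>K. \<bar>partial_derivs bs (u \<epsilon>) x\<bar>))"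
    if "\<forall>\<epsilon>\<in>{0<..1}. smooth (u \<epsilon>)" "bs \<in> lists Basis" for u :: "real \<Rightarrow> 'a::euclidean_space \<Rightarrow> real" and bs
  proof (rule dominated_iff_SUP)
    fix \<epsilon> :: real assume "\<epsilon> \<in> {0<..1}"
    with that show "continuous_on UNIV (partial_derivs bs (u \<epsilon>))"
      using smooth_imp_continuous[OF smooth_partial_derivs] by blast
  qed
  note * = this
  show ?thesis
    unfolding smooth_growth_def
  proof (intro Collect_cong conj_cong refl)
    fix u :: "real \<Rightarrow> 'a \<Rightarrow> real" assume u: "\<forall>\<epsilon>\<in>{0<..1}. smooth (u \<epsilon>)"
    have "(\<forall>bs\<in>lists Basis. dominated P (\<lambda>\<epsilon>. partial_derivs bs (u \<epsilon>))) \<longleftrightarrow>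
      (\<forall>bs\<in>lists Basis. \<forall>K. compact K \<and> K \<noteq> {} \<longrightarrow> P (\<lambda>\<epsilon>. SUP x\<in>K. \<bar>partial_derivs bs (u \<epsilon>) x\<bar>))"
      by (intro ball_cong refl *[OF u])
    then show "(\<forall>bs\<in>lists Basis. dominated P (\<lambda>\<epsilon>. partial_derivs bs (u \<epsilon>))) \<longleftrightarrow>
      (\<forall>K bs. compact K \<and> K \<noteq> {} \<and> bs \<in> lists Basis \<longrightarrow> P (\<lambda>\<epsilon>. SUP x\<in>K. \<bar>partial_derivs bs (u \<epsilon>) x\<bar>))"
      by (simp only: Ball_def) (intro iffI allI impI; elim conjE; simp)
  qed
qed

lemma EM_eq: "EM = smooth_growth moderate"
  unfolding EM_def moderate.smooth_growth_SUP ..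

lemma NEG_eq: "NEG = smooth_growth negligible_family"
  unfolding NEG_def negligible.smooth_growth_SUP ..

lemma NEG_subset_EM: "NEG \<subseteq> EM"
  unfolding EM_eq NEG_eq smooth_growth_def using dominated_negligible_imp_moderate by blast

lemma smooth_growth_partial_deriv:
  assumes "u \<in> smooth_growth P" "b \<in> Basis"
  shows "(\<lambda>\<epsilon>. partial_deriv b (u \<epsilon>)) \<in> smooth_growth P"
proof -
  have "dominated P (\<lambda>\<epsilon>. partial_derivs bs (partial_deriv b (u \<epsilon>)))" if "bs \<in> lists Basis" for bs
    using smooth_growthD(2)[OF assms(1), of "bs @ [b]"] that assms(2) by (simp add: partial_derivs_append)
  then show ?thesis
    using smooth_partial_deriv[OF smooth_growthD(1)[OF assms(1)] assms(2)] unfolding smooth_growth_def by blast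
qed

context growth
begin

text \<open>The Leibniz rule by induction on the list of directions, splitting off the innermost
  one. The hypotheses concern only derivatives along sublists of \<open>bs\<close>, so the lemma can
  be used inside inductions where u is controlled up to a certain order only.\<close>

lemma dominated_partial_derivs_mult:
  fixes f u :: "real \<Rightarrow> 'a::euclidean_space \<Rightarrow> real"
  assumes "bs \<in> lists Basis" "\<And>\<epsilon>. \<epsilon> \<in> {0<..1} \<Longrightarrow> smooth (f \<epsilon>)" "\<And>\<epsilon>. \<epsilon> \<in> {0<..1} \<Longrightarrow> smooth (u \<epsilon>)"
    and "\<And>cs. subseq cs bs \<Longrightarrow> dominated moderate (\<lambda>\<epsilon>. partial_derivs cs (f \<epsilon>))"
    and "\<And>cs. subseq cs bs \<Longrightarrow> dominated P (\<lambda>\<epsilon>. partial_derivs cs (u \<epsilon>))"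
  shows "dominated P (\<lambda>\<epsilon>. partial_derivs bs (\<lambda>x. f \<epsilon> x * u \<epsilon> x))"
  using assms
proof (induction bs arbitrary: f u rule: rev_induct)
  case Nil
  then show ?case using Nil(4)[of "[]"] Nil(5)[of "[]"] by (simp add: dominated_mult)
next
  case (snoc b bs)
  then have b: "b \<in> Basis" and bs: "bs \<in> lists Basis" by auto
  have sub: "subseq cs (bs @ [b])" "subseq (cs @ [b]) (bs @ [b])" if "subseq cs bs" for cs
    using that by (auto intro: subseq_rev_drop_many list_emb_append_mono)
  have df: "dominated moderate (\<lambda>\<epsilon>. partial_derivs cs (partial_deriv b (f \<epsilon>)))"
    and du: "dominated P (\<lambda>\<epsilon>. partial_derivs cs (partial_deriv b (u \<epsilon>)))" if "subseq cs bs" for cs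
    using snoc.prems(4,5)[OF sub(2)[OF that]] by (simp_all add: partial_derivs_append)
  have "dominated P (\<lambda>\<epsilon>. partial_derivs bs (\<lambda>x. partial_deriv b (f \<epsilon>) x * u \<epsilon> x))"
    by (rule snoc.IH[OF bs smooth_partial_deriv[OF snoc.prems(2) b] snoc.prems(3) df snoc.prems(5)[OF sub(1)]])
  moreover have "dominated P (\<lambda>\<epsilon>. partial_derivs bs (\<lambda>x. f \<epsilon> x * partial_deriv b (u \<epsilon>) x))"
    by (rule snoc.IH[OF bs snoc.prems(2) smooth_partial_deriv[OF snoc.prems(3) b] snoc.prems(4)[OF sub(1)] du])
  ultimately show ?case
  proof (rule dominated_cong[OF dominated_add])
    fix \<epsilon> :: real assume e: "\<epsilon> \<in> {0<..1}"
    note sm = snoc.prems(2)[OF e] snoc.prems(3)[OF e]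
    have "partial_derivs (bs @ [b]) (\<lambda>x. f \<epsilon> x * u \<epsilon> x)
        = partial_derivs bs (\<lambda>x. partial_deriv b (f \<epsilon>) x * u \<epsilon> x + f \<epsilon> x * partial_deriv b (u \<epsilon>) x)"
      by (simp only: partial_derivs_append partial_derivs_Cons partial_derivs_Nil partial_deriv_mult[OF sm b])
    also have "\<dots> = (\<lambda>x. partial_derivs bs (\<lambda>x. partial_deriv b (f \<epsilon>) x * u \<epsilon> x) x
        + partial_derivs bs (\<lambda>x. f \<epsilon> x * partial_deriv b (u \<epsilon>) x) x)"
      by (rule partial_derivs_add[OF smooth_mult[OF smooth_partial_deriv[OF sm(1) b] sm(2)]
            smooth_mult[OF sm(1) smooth_partial_deriv[OF sm(2) b]] bs])
    finally show "partial_derivs (bs @ [b]) (\<lambda>x. f \<epsilon> x * u \<epsilon> x) = \<dots>" .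
  qed
qed

lemma smooth_growth_zero: "(\<lambda>\<epsilon> x. 0) \<in> smooth_growth P"
proof -
  have "partial_derivs bs (\<lambda>x. 0) = (\<lambda>x. 0)" for bs :: "'a list"
    by (induction bs) auto
  then show ?thesis by (simp add: smooth_growth_def dominated_zero)
qed

lemma smooth_growth_add:
  assumes u: "u \<in> smooth_growth P" and v: "v \<in> smooth_growth P"
  shows "(\<lambda>\<epsilon> x. u \<epsilon> x + v \<epsilon> x) \<in> smooth_growth P"
  unfolding smooth_growth_def mem_Collect_eq
proof (intro conjI ballI)
  fix bs :: "'a list" assume bs: "bs \<in> lists Basis"
  show "dominated P (\<lambda>\<epsilon>. partial_derivs bs (\<lambda>x. u \<epsilon> x + v \<epsilon> x))"
    by (rule dominated_cong[OF dominated_add[OF smooth_growthD(2)[OF u bs] smooth_growthD(2)[OF v bs]]])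
      (intro partial_derivs_add smooth_growthD(1)[OF u] smooth_growthD(1)[OF v] bs)
qed (intro smooth_add smooth_growthD(1)[OF u] smooth_growthD(1)[OF v])

lemma smooth_growth_uminus:
  assumes u: "u \<in> smooth_growth P" shows "(\<lambda>\<epsilon> x. - u \<epsilon> x) \<in> smooth_growth P"
  unfolding smooth_growth_def mem_Collect_eq
proof (intro conjI ballI)
  fix bs :: "'a list" assume bs: "bs \<in> lists Basis"
  have "dominated P (\<lambda>\<epsilon> x. - partial_derivs bs (u \<epsilon>) x)"
    using smooth_growthD(2)[OF u bs] by (simp add: dominated_uminus)
  then show "dominated P (\<lambda>\<epsilon>. partial_derivs bs (\<lambda>x. - u \<epsilon> x))"
    by (rule dominated_cong) (intro partial_derivs_uminus smooth_growthD(1)[OF u] bs)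
qed (intro smooth_uminus smooth_growthD(1)[OF u])

lemma smooth_growth_mult:
  assumes u: "u \<in> smooth_growth moderate" and v: "v \<in> smooth_growth P"
  shows "(\<lambda>\<epsilon> x. u \<epsilon> x * v \<epsilon> x) \<in> smooth_growth P"
  unfolding smooth_growth_def mem_Collect_eq
proof (intro conjI ballI)
  fix bs :: "'a list" assume bs: "bs \<in> lists Basis"
  have "cs \<in> lists Basis" if "subseq cs bs" for cs
    using that bs by (induction rule: list_emb.induct) auto
  then show "dominated P (\<lambda>\<epsilon>. partial_derivs bs (\<lambda>x. u \<epsilon> x * v \<epsilon> x))"
    by (intro dominated_partial_derivs_mult[OF bs smooth_growthD(1)[OF u] smooth_growthD(1)[OF v]
        smooth_growthD(2)[OF u] smooth_growthD(2)[OF v]])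
qed (intro smooth_mult smooth_growthD(1)[OF u] smooth_growthD(1)[OF v])

end

lemma smooth_growth_const: "(\<lambda>\<epsilon> x. c) \<in> smooth_growth moderate"
proof -
  have "dominated moderate (\<lambda>\<epsilon>. partial_derivs bs (\<lambda>x :: 'a. c))" for bs
  proof (induction bs rule: rev_induct)
    case Nil
    show ?case using moderate_const[of "\<bar>c\<bar>"] by (auto simp: dominated_def)
  next
    case (snoc b bs)
    have "partial_derivs cs (\<lambda>x. 0) = (\<lambda>x. 0)" for cs :: "'a list" by (induction cs) auto
    then show ?case by (simp add: partial_derivs_append moderate.dominated_zero)
  qed
  then show ?thesis by (simp add: smooth_growth_def)
qed

subsection \<open>Growth of solutions\<close>

text \<open>Only small \<epsilon> are constrained: |log \<epsilon>| vanishes at \<epsilon> = 1, and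
  a bound there would not survive the addition of a negligible family.\<close>

definition log_type :: "(real \<Rightarrow> real \<times> real \<Rightarrow> real) \<Rightarrow> bool"
  where "log_type u \<longleftrightarrow> (\<forall>K. compact K \<longrightarrow> (\<exists>C. \<forall>\<^sub>F \<epsilon> in at_right 0. \<forall>p\<in>K. \<bar>u \<epsilon> p\<bar> \<le> C * \<bar>ln \<epsilon>\<bar>))"

lemma log_type_zero: "log_type (\<lambda>\<epsilon> p. 0)"
  unfolding log_type_def by (intro allI impI exI[of _ 0]) simp

lemma log_type_uminus: "log_type (\<lambda>\<epsilon> p. - u \<epsilon> p) \<longleftrightarrow> log_type u"
  and log_type_abs: "log_type (\<lambda>\<epsilon> p. \<bar>u \<epsilon> p\<bar>) \<longleftrightarrow> log_type u"
  by (simp_all add: log_type_def)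

lemma log_type_add:
  assumes "log_type u" "log_type v" shows "log_type (\<lambda>\<epsilon> p. u \<epsilon> p + v \<epsilon> p)"
  unfolding log_type_def
proof (intro allI impI)
  fix K :: "(real \<times> real) set" assume "compact K"
  then obtain C D where "\<forall>\<^sub>F \<epsilon> in at_right 0. \<forall>p\<in>K. \<bar>u \<epsilon> p\<bar> \<le> C * \<bar>ln \<epsilon>\<bar>"
    "\<forall>\<^sub>F \<epsilon> in at_right 0. \<forall>p\<in>K. \<bar>v \<epsilon> p\<bar> \<le> D * \<bar>ln \<epsilon>\<bar>"
    using assms unfolding log_type_def by blast
  then have "\<forall>\<^sub>F \<epsilon> in at_right 0. \<forall>p\<in>K. \<bar>u \<epsilon> p + v \<epsilon> p\<bar> \<le> (C + D) * \<bar>ln \<epsilon>\<bar>"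
  proof eventually_elim
    case (elim \<epsilon>)
    show ?case
    proof
      fix p assume "p \<in> K"
      then have "\<bar>u \<epsilon> p\<bar> \<le> C * \<bar>ln \<epsilon>\<bar>" "\<bar>v \<epsilon> p\<bar> \<le> D * \<bar>ln \<epsilon>\<bar>" using elim by auto
      then show "\<bar>u \<epsilon> p + v \<epsilon> p\<bar> \<le> (C + D) * \<bar>ln \<epsilon>\<bar>" unfolding distrib_right by linarith
    qed
  qed
  then show "\<exists>C. \<forall>\<^sub>F \<epsilon> in at_right 0. \<forall>p\<in>K. \<bar>u \<epsilon> p + v \<epsilon> p\<bar> \<le> C * \<bar>ln \<epsilon>\<bar>" ..
qed

lemma log_type_sum: "(\<And>i. i \<in> I \<Longrightarrow> log_type (u i)) \<Longrightarrow> log_type (\<lambda>\<epsilon> p. \<Sum>i\<in>I. u i \<epsilon> p)"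
  by (induction I rule: infinite_finite_induct) (auto intro: log_type_zero log_type_add)

text \<open>A negligible family is bounded for small \<epsilon>, and |log \<epsilon>| exceeds 1 once
  \<epsilon> < exp (-1). This lets a logarithmic bound pass between representatives of one
  class.\<close>

lemma log_type_negligible:
  assumes "dominated negligible_family u" shows "log_type u"
  unfolding log_type_def
proof (intro allI impI)
  fix K :: "(real \<times> real) set" assume "compact K"
  then obtain r where r: "negligible_family r" "\<forall>\<^sub>F \<epsilon> in at_right 0. \<forall>x\<in>K. \<bar>u \<epsilon> x\<bar> \<le> r \<epsilon>"
    using dominatedD[OF assms] by blast
  have "r \<in> O[at_right 0](\<lambda>\<epsilon>. \<epsilon> powr 0)" using r(1) unfolding negligible_family_def by blast
  then obtain C where C: "C > 0" "\<forall>\<^sub>F \<epsilon> in at_right 0. norm (r \<epsilon>) \<le> C * norm (\<epsilon> powr 0)"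
    by (rule landau_o.bigE)
  have "\<forall>\<^sub>F \<epsilon>::real in at_right 0. \<epsilon> < exp (- 1)"
    unfolding eventually_at_right_field by (intro exI[of _ "exp (- 1)"]) auto
  then have "\<forall>\<^sub>F \<epsilon> in at_right 0. \<forall>p\<in>K. \<bar>u \<epsilon> p\<bar> \<le> C * \<bar>ln \<epsilon>\<bar>"
    using r(2) C(2) eventually_unit
  proof eventually_elim
    case (elim \<epsilon>)
    then have "ln \<epsilon> < -1" by (metis greaterThanLessThan_iff ln_less_cancel_iff exp_gt_zero ln_exp)
    then have "C * 1 \<le> C * \<bar>ln \<epsilon>\<bar>" using C(1) by (intro mult_left_mono) auto
    with elim show ?case by fastforce
  qed
  then show "\<exists>C. \<forall>\<^sub>F \<epsilon> in at_right 0. \<forall>p\<in>K. \<bar>u \<epsilon> p\<bar> \<le> C * \<bar>ln \<epsilon>\<bar>" ..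
qed

section \<open>Restriction to time 0 and reordering of derivatives\<close>

lemma partial_derivs_sum:
  assumes "\<And>i. i \<in> I \<Longrightarrow> smooth (f i)" "bs \<in> lists Basis"
  shows "partial_derivs bs (\<lambda>x. \<Sum>i\<in>I. f i x) = (\<lambda>x. \<Sum>i\<in>I. partial_derivs bs (f i) x)"
  using assms(2)
  by (induction bs) (simp_all add: partial_deriv_sum assms smooth_partial_derivs)

lemma partial_derivs_replicate_at0:
  fixes f :: "real \<times> real \<Rightarrow> real"
  assumes "smooth f"
  shows "partial_derivs (replicate m 1) (\<lambda>x. f (x, 0)) = (\<lambda>x. partial_derivs (replicate m (1, 0)) f (x, 0))"
proof (induction m)
  case (Suc m)
  have s: "smooth (partial_derivs (replicate m (1, 0)) f)"
    by (intro smooth_partial_derivs assms) (auto simp: Basis_plane)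
  have "partial_deriv 1 (\<lambda>x. partial_derivs (replicate m (1, 0)) f (x, 0)) x = px (partial_derivs (replicate m (1, 0)) f) (x, 0)" for x
    using smooth_has_partial[OF s, of "(1, 0)" "(x, 0)"]
    by (intro partial_deriv_eqI) (simp add: Basis_plane)
  then show ?case by (simp add: Suc fun_eq_iff)
qed simp

lemma lists_Basis_real: "bs \<in> lists (Basis :: real set) \<Longrightarrow> bs = replicate (length bs) 1"
  by (induction bs) auto

lemma smooth_at0:
  fixes f :: "real \<times> real \<Rightarrow> real"
  assumes "smooth f" shows "smooth (\<lambda>x. f (x, 0))"
proof (rule smooth_coinduct[of _ "(\<lambda>(f :: real \<times> real \<Rightarrow> real) x. f (x, 0)) ` Collect smooth"])
  let ?A = "(\<lambda>(f :: real \<times> real \<Rightarrow> real) x. f (x, 0)) ` Collect smooth"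
  show "(\<lambda>x. f (x, 0)) \<in> ?A"
    using assms by (intro imageI CollectI)
  fix h :: "real \<Rightarrow> real" assume "h \<in> ?A"
  then obtain f :: "real \<times> real \<Rightarrow> real" where f: "h = (\<lambda>x. f (x, 0))" "smooth f" by blast
  show "continuous_on UNIV h"
    unfolding f(1)
    by (rule continuous_on_plane_compose[OF smooth_imp_continuous[OF f(2)] continuous_on_id continuous_on_const])
  fix b :: real assume "b \<in> Basis"
  then have "((\<lambda>s. h (x + s *\<^sub>R b)) has_real_derivative px f (x, 0)) (at 0)" for x
    using smooth_has_partial[OF f(2), of "(1, 0)" "(x, 0)"] by (simp add: Basis_plane f(1))
  then show "\<exists>f'\<in>?A. \<forall>x. ((\<lambda>s. h (x + s *\<^sub>R b)) has_real_derivative f' x) (at 0)"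
    using smooth_px[OF f(2)] by (intro bexI[of _ "\<lambda>x. px f (x, 0)"] imageI CollectI) simp_all
qed

lemma (in growth) smooth_growth_at0:
  fixes u :: "real \<Rightarrow> real \<times> real \<Rightarrow> real"
  assumes u: "u \<in> smooth_growth P"
  shows "(\<lambda>\<epsilon> x. u \<epsilon> (x, 0)) \<in> smooth_growth P"
  unfolding smooth_growth_def mem_Collect_eq
proof (intro conjI ballI)
  fix bs :: "real list" assume bs: "bs \<in> lists Basis"
  have m: "replicate (length bs) (1, 0) \<in> lists (Basis :: (real \<times> real) set)" by (auto simp: Basis_plane)
  have "dominated P (\<lambda>\<epsilon> x. partial_derivs (replicate (length bs) (1, 0)) (u \<epsilon>) (x, 0))"
    unfolding dominated_def
  proof (intro allI impI)
    fix K :: "real set" assume "compact K"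
    then have "compact (K \<times> {0 :: real})" by (intro compact_Times) auto
    from dominatedD[OF smooth_growthD(2)[OF u m] this] obtain r where "P r"
      "\<forall>\<^sub>F \<epsilon> in at_right 0. \<forall>p\<in>K \<times> {0}. \<bar>partial_derivs (replicate (length bs) (1, 0)) (u \<epsilon>) p\<bar> \<le> r \<epsilon>" by blast
    then show "\<exists>r. P r \<and> (\<forall>\<^sub>F \<epsilon> in at_right 0. \<forall>x\<in>K. \<bar>partial_derivs (replicate (length bs) (1, 0)) (u \<epsilon>) (x, 0)\<bar> \<le> r \<epsilon>)"
      by (intro exI[of _ r]) auto
  qed
  then show "dominated P (\<lambda>\<epsilon>. partial_derivs bs (\<lambda>x. u \<epsilon> (x, 0)))"
    by (rule dominated_cong)
      (subst lists_Basis_real[OF bs], rule partial_derivs_replicate_at0[OF smooth_growthD(1)[OF u]])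
qed (intro smooth_at0 smooth_growthD(1)[OF u])

lemma partial_derivs_partial_deriv:
  fixes f :: "real \<times> real \<Rightarrow> real"
  assumes "smooth f" "cs \<in> lists Basis" "b \<in> Basis"
  shows "partial_deriv b (partial_derivs cs f) = partial_derivs cs (partial_deriv b f)"
  using assms(2)
proof (induction cs)
  case (Cons c cs)
  then have c: "c \<in> Basis" "cs \<in> lists Basis" by auto
  have "partial_deriv b (partial_deriv c (partial_derivs cs f)) = partial_deriv c (partial_deriv b (partial_derivs cs f))"
    using px_pt_commute[OF smooth_partial_derivs[OF assms(1) c(2)]] assms(3) c(1) by (auto simp: Basis_plane)
  then show ?case using Cons c by simp
qed simp

text \<open>Moves one occurrence of a direction to the innermost place, where the differential
  equation can replace a t-derivative.\<close>

lemma partial_derivs_remove1: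
  fixes f :: "real \<times> real \<Rightarrow> real"
  assumes "smooth f" "bs \<in> lists Basis" "b \<in> set bs"
  shows "partial_derivs bs f = partial_derivs (remove1 b bs) (partial_deriv b f)"
  using assms(2,3)
proof (induction bs)
  case (Cons c cs)
  show ?case
  proof (cases "c = b")
    case True
    have "b \<in> Basis" "cs \<in> lists Basis" using Cons.hyps True by auto
    from partial_derivs_partial_deriv[OF assms(1) this(2,1)] True show ?thesis by (simp only: partial_derivs_Cons remove1.simps if_True simp_thms)
  next
    case False
    then have "partial_derivs cs f = partial_derivs (remove1 b cs) (partial_deriv b f)"
      using Cons.prems by (intro Cons.IH) auto
    then show ?thesis using False by simp
  qed
qed simp

text \<open>The growth of H and u is left open: H changes with every x-differentiation, and the
  growth class is chosen only in the estimates. In this form the assumptions are stable under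
  differentiation in x (\<open>px_family\<close>).\<close>

locale transport_family =
  fixes I :: "'i set" and l :: "'i \<Rightarrow> real \<Rightarrow> real \<times> real \<Rightarrow> real"
    and F :: "'i \<Rightarrow> 'i \<Rightarrow> real \<Rightarrow> real \<times> real \<Rightarrow> real" and H u :: "'i \<Rightarrow> real \<Rightarrow> real \<times> real \<Rightarrow> real"
  assumes finite_I: "finite I"
    and speed_l: "i \<in> I \<Longrightarrow> \<epsilon> \<in> {0<..1} \<Longrightarrow> speed (l i \<epsilon>)"
    and bounded_l: "\<exists>c>0. \<forall>i\<in>I. \<forall>\<epsilon>\<in>{0<..1}. \<forall>x t. \<bar>t\<bar> \<le> T \<longrightarrow> \<bar>l i \<epsilon> (x, t)\<bar> \<le> c"
    and moderate_l: "i \<in> I \<Longrightarrow> l i \<in> smooth_growth moderate"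
    and log_l: "i \<in> I \<Longrightarrow> log_type (\<lambda>\<epsilon>. px (l i \<epsilon>))"
    and moderate_F: "i \<in> I \<Longrightarrow> j \<in> I \<Longrightarrow> F i j \<in> smooth_growth moderate"
    and log_F: "i \<in> I \<Longrightarrow> j \<in> I \<Longrightarrow> log_type (F i j)"
    and smooth_H: "i \<in> I \<Longrightarrow> \<epsilon> \<in> {0<..1} \<Longrightarrow> smooth (H i \<epsilon>)"
    and smooth_u: "i \<in> I \<Longrightarrow> \<epsilon> \<in> {0<..1} \<Longrightarrow> smooth (u i \<epsilon>)"
    and eq: "i \<in> I \<Longrightarrow> \<epsilon> \<in> {0<..1} \<Longrightarrow>
      pt (u i \<epsilon>) p + l i \<epsilon> p * px (u i \<epsilon>) p = (\<Sum>j\<in>I. F i j \<epsilon> p * u j \<epsilon> p) + H i \<epsilon> p"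
begin

lemma smooth_F: "i \<in> I \<Longrightarrow> j \<in> I \<Longrightarrow> \<epsilon> \<in> {0<..1} \<Longrightarrow> smooth (F i j \<epsilon>)"
  using smooth_growthD(1)[OF moderate_F] .

lemma smooth_l: "i \<in> I \<Longrightarrow> \<epsilon> \<in> {0<..1} \<Longrightarrow> smooth (l i \<epsilon>)"
  using smooth_growthD(1)[OF moderate_l] .

lemma dominated_solution:
  assumes "growth P"
    and H: "\<And>i. i \<in> I \<Longrightarrow> dominated P (H i)"
    and u0: "\<And>i. i \<in> I \<Longrightarrow> dominated P (\<lambda>\<epsilon> x. u i \<epsilon> (x, 0))"
    and i: "i \<in> I"
  shows "dominated P (u i)"
  unfolding dominated_def
proof (intro allI impI)
  interpret growth P by fact
  fix K :: "(real \<times> real) set" assume "compact K"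
  then have "bounded K" by (rule compact_imp_bounded)
  then obtain R where R: "R > 0" "\<forall>p\<in>K. norm p \<le> R" unfolding bounded_pos by blast
  \<comment> \<open>K lies in the ball of radius R, so R bounds positions and times alike.\<close>
  define T where "T = R"
  obtain c where c: "c > 0" "\<And>i \<epsilon> x t. i \<in> I \<Longrightarrow> \<epsilon> \<in> {0<..1} \<Longrightarrow> \<bar>t\<bar> \<le> T \<Longrightarrow> \<bar>l i \<epsilon> (x, t)\<bar> \<le> c"
    using bounded_l[of T] by blast
  define R' where "R' = R + c * T"
  let ?B = "{-R'..R'} \<times> {-T..T}" and ?S = "trapezoid c R T"
  have SB: "p \<in> ?B" if "p \<in> ?S" for p
    using trapezoid_subset_box[OF less_imp_le[OF c(1)] that] by (simp add: R'_def)
  have "dominated P (\<lambda>\<epsilon> p. \<Sum>i\<in>I. \<bar>H i \<epsilon> p\<bar>)" by (intro dominated_sum) (simp add: dominated_abs H)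
  from dominatedD[OF this compact_box] obtain rH where
    rH: "P rH" "\<forall>\<^sub>F \<epsilon> in at_right 0. \<forall>p\<in>?B. \<bar>\<Sum>i\<in>I. \<bar>H i \<epsilon> p\<bar>\<bar> \<le> rH \<epsilon>" by blast
  have "dominated P (\<lambda>\<epsilon> x. \<Sum>i\<in>I. \<bar>u i \<epsilon> (x, 0)\<bar>)" by (intro dominated_sum) (simp add: dominated_abs u0)
  from dominatedD[OF this compact_Icc[of "-R'" R']] obtain r0 where
    r0: "P r0" "\<forall>\<^sub>F \<epsilon> in at_right 0. \<forall>x\<in>{-R'..R'}. \<bar>\<Sum>i\<in>I. \<bar>u i \<epsilon> (x, 0)\<bar>\<bar> \<le> r0 \<epsilon>" by blast
  have "log_type (\<lambda>\<epsilon> p. \<Sum>i\<in>I. \<Sum>j\<in>I. \<bar>F i j \<epsilon> p\<bar>)"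
    by (intro log_type_sum) (simp add: log_type_abs log_F)
  then obtain C where C: "\<forall>\<^sub>F \<epsilon> in at_right 0. \<forall>p\<in>?B. \<bar>\<Sum>i\<in>I. \<Sum>j\<in>I. \<bar>F i j \<epsilon> p\<bar>\<bar> \<le> C * \<bar>ln \<epsilon>\<bar>"
    unfolding log_type_def using compact_box by blast
  \<comment> \<open>\<open>\<bar>C\<bar> + 1\<close> in place of C makes \<open>A \<epsilon>\<close>
    positive for \<epsilon> < 1, as the energy estimate demands.\<close>
  define A where "A \<epsilon> = (\<bar>C\<bar> + 1) * \<bar>ln \<epsilon>\<bar>" for \<epsilon> :: real
  define E where "E \<epsilon> = 2 * exp (2 * A \<epsilon> * T)" for \<epsilon>
  \<comment> \<open>For \<epsilon> < 1 this family equals \<open>E\<close>, because |log \<epsilon>|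
    = - log \<epsilon> turns the exponential into a power.\<close>
  have "moderate (\<lambda>\<epsilon>. 2 * \<epsilon> powr (- (2 * (\<bar>C\<bar> + 1) * T)))"
    by (intro moderate.mult moderate_const moderate_powr)
  then have mE: "moderate E"
  proof (rule moderate.mono)
    show "\<forall>\<^sub>F \<epsilon> in at_right 0. \<bar>E \<epsilon>\<bar> \<le> \<bar>2 * \<epsilon> powr - (2 * (\<bar>C\<bar> + 1) * T)\<bar>"
      using eventually_unit
    proof eventually_elim
      case (elim \<epsilon>)
      then have "\<bar>ln \<epsilon>\<bar> = - ln \<epsilon>" by simp
      then have "2 * A \<epsilon> * T = - (2 * (\<bar>C\<bar> + 1) * T) * ln \<epsilon>" by (simp add: A_def)
      then show ?case using elim by (simp add: E_def powr_def)
    qed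
  qed
  let ?r = "\<lambda>\<epsilon>. E \<epsilon> * (r0 \<epsilon> + T * rH \<epsilon>)"
  have "P ?r" by (intro mult[OF mE] add r0(1) mult[OF moderate_const] rH(1))
  moreover have "\<forall>\<^sub>F \<epsilon> in at_right 0. \<forall>p\<in>K. \<bar>u i \<epsilon> p\<bar> \<le> ?r \<epsilon>"
    using rH(2) r0(2) C eventually_unit
  proof eventually_elim
    case (elim \<epsilon>)
    then have e: "\<epsilon> \<in> {0<..1}" by auto
    show ?case
    proof
      fix p assume "p \<in> K"
      then have n: "norm (fst p) \<le> R" "norm (snd p) \<le> R"
        using R(2) norm_fst_le[of "fst p" "snd p"] norm_snd_le[of "snd p" "fst p"] by auto
      have p: "p \<in> ?S"
        using box_subset_trapezoid[OF less_imp_le[OF c(1)], of "fst p" R "snd p" T] n by (simp add: T_def)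
      have "\<bar>u i \<epsilon> p\<bar> \<le> 2 * (r0 \<epsilon> + T * rH \<epsilon>) * exp (2 * A \<epsilon> * T)"
      proof (rule transport_energy_estimate[OF finite_I speed_l smooth_has_grad[OF smooth_u]
            smooth_imp_continuous[OF smooth_F] smooth_imp_continuous[OF smooth_H] eq c(1) c(2) _ _ _ _ i p])
        have "ln \<epsilon> < 0" using elim(4) by simp
        then show "A \<epsilon> > 0" unfolding A_def by (intro mult_pos_pos) auto
        show "(\<Sum>j\<in>I. \<bar>F i j \<epsilon> q\<bar>) \<le> A \<epsilon>" if "i \<in> I" "q \<in> ?S" for i q
        proof -
          have "(\<Sum>j\<in>I. \<bar>F i j \<epsilon> q\<bar>) \<le> (\<Sum>i\<in>I. \<Sum>j\<in>I. \<bar>F i j \<epsilon> q\<bar>)"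
            using that(1) finite_I by (intro member_le_sum[of i I "\<lambda>i. \<Sum>j\<in>I. \<bar>F i j \<epsilon> q\<bar>"] sum_nonneg) auto
          also have "\<dots> \<le> C * \<bar>ln \<epsilon>\<bar>" using elim(3) SB[OF that(2)] by force
          also have "\<dots> \<le> A \<epsilon>" unfolding A_def by (intro mult_right_mono) auto
          finally show ?thesis .
        qed
        show "\<bar>H i \<epsilon> q\<bar> \<le> rH \<epsilon>" if "i \<in> I" "q \<in> ?S" for i q
        proof -
          have "\<bar>H i \<epsilon> q\<bar> \<le> (\<Sum>i\<in>I. \<bar>H i \<epsilon> q\<bar>)"
            using that(1) finite_I by (intro member_le_sum[of i I "\<lambda>i. \<bar>H i \<epsilon> q\<bar>"]) auto
          also have "\<dots> \<le> rH \<epsilon>" using elim(1) SB[OF that(2)] by force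
          finally show ?thesis .
        qed
        show "\<bar>u i \<epsilon> (x, 0)\<bar> \<le> r0 \<epsilon>" if "i \<in> I" "\<bar>x\<bar> \<le> R + c * T" for i x
        proof -
          have "\<bar>u i \<epsilon> (x, 0)\<bar> \<le> (\<Sum>i\<in>I. \<bar>u i \<epsilon> (x, 0)\<bar>)"
            using that(1) finite_I by (intro member_le_sum[of i I "\<lambda>i. \<bar>u i \<epsilon> (x, 0)\<bar>"]) auto
          moreover have "x \<in> {-R'..R'}" using that(2) by (auto simp: R'_def abs_le_iff)
          ultimately show ?thesis using elim(2) by force
        qed
      qed (use e in auto)
      then show "\<bar>u i \<epsilon> p\<bar> \<le> ?r \<epsilon>" unfolding E_def by (simp only: mult_ac)
    qed
  qed
  ultimately show "\<exists>r. P r \<and> (\<forall>\<^sub>F \<epsilon> in at_right 0. \<forall>p\<in>K. \<bar>u i \<epsilon> p\<bar> \<le> r \<epsilon>)" by blast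
qed

text \<open>Differentiating the transport term leaves \<open>px l * px u\<close>, which joins the
  diagonal of F with a minus sign and keeps it of logarithmic type. The terms
  \<open>px F * u\<close> contain no derivative of u and go into the inhomogeneity; hence no
  logarithmic bound on \<open>px F\<close> is called for.\<close>

lemma px_family:
  "transport_family I l (\<lambda>i j \<epsilon> p. F i j \<epsilon> p + (if i = j then - px (l i \<epsilon>) p else 0))
    (\<lambda>i \<epsilon> p. px (H i \<epsilon>) p + (\<Sum>j\<in>I. px (F i j \<epsilon>) p * u j \<epsilon> p)) (\<lambda>i \<epsilon>. px (u i \<epsilon>))"
proof (rule transport_family.intro[OF finite_I speed_l bounded_l moderate_l log_l])
  show "(\<lambda>\<epsilon> p. F i j \<epsilon> p + (if i = j then - px (l i \<epsilon>) p else 0)) \<in> smooth_growth moderate" if "i \<in> I" "j \<in> I" for i j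
  proof (cases "i = j")
    case True
    have "(\<lambda>\<epsilon>. px (l i \<epsilon>)) \<in> smooth_growth moderate"
      by (rule smooth_growth_partial_deriv[OF moderate_l[OF that(1)]]) (simp add: Basis_plane)
    from moderate.smooth_growth_add[OF moderate_F[OF that] moderate.smooth_growth_uminus[OF this]] True
    show ?thesis by (simp only: if_True simp_thms)
  next
    case False
    then show ?thesis using moderate_F[OF that] by (simp only: if_False simp_thms add_0_right)
  qed
  show "log_type (\<lambda>\<epsilon> p. F i j \<epsilon> p + (if i = j then - px (l i \<epsilon>) p else 0))" if "i \<in> I" "j \<in> I" for i j
  proof (cases "i = j")
    case True
    from log_type_add[OF log_F[OF that] iffD2[OF log_type_uminus log_l[OF that(1)]]] True
    show ?thesis by (simp only: if_True simp_thms)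
  next
    case False
    then show ?thesis using log_F[OF that] by (simp only: if_False simp_thms add_0_right)
  qed
  fix i and \<epsilon> :: real assume i: "i \<in> I" and e: "\<epsilon> \<in> {0<..1}"
  note sm = smooth_u[OF _ e] smooth_F[OF _ _ e] smooth_H[OF _ e] smooth_l[OF _ e]
  show "smooth (\<lambda>p. px (H i \<epsilon>) p + (\<Sum>j\<in>I. px (F i j \<epsilon>) p * u j \<epsilon> p))"
    by (intro smooth_add smooth_sum smooth_mult smooth_px sm i)
  show "smooth (px (u i \<epsilon>))" by (intro smooth_px sm i)
  fix p
  have x: "(1, 0) \<in> (Basis :: (real \<times> real) set)" by (simp add: Basis_plane)
  have "(\<lambda>p. pt (u i \<epsilon>) p + l i \<epsilon> p * px (u i \<epsilon>) p) = (\<lambda>p. (\<Sum>j\<in>I. F i j \<epsilon> p * u j \<epsilon> p) + H i \<epsilon> p)"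
    using eq[OF i e] by (rule ext)
  then have "px (\<lambda>p. pt (u i \<epsilon>) p + l i \<epsilon> p * px (u i \<epsilon>) p) p = px (\<lambda>p. (\<Sum>j\<in>I. F i j \<epsilon> p * u j \<epsilon> p) + H i \<epsilon> p) p"
    by (simp only:)
  moreover have "px (\<lambda>p. pt (u i \<epsilon>) p + l i \<epsilon> p * px (u i \<epsilon>) p) p
      = px (pt (u i \<epsilon>)) p + (px (l i \<epsilon>) p * px (u i \<epsilon>) p + l i \<epsilon> p * px (px (u i \<epsilon>)) p)"
    using sm i x by (simp add: partial_deriv_add partial_deriv_mult smooth_pt smooth_px smooth_mult)
  moreover have "px (\<lambda>p. (\<Sum>j\<in>I. F i j \<epsilon> p * u j \<epsilon> p) + H i \<epsilon> p) p
      = (\<Sum>j\<in>I. px (F i j \<epsilon>) p * u j \<epsilon> p + F i j \<epsilon> p * px (u j \<epsilon>) p) + px (H i \<epsilon>) p"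
    using sm i x by (simp add: partial_deriv_add partial_deriv_mult partial_deriv_sum smooth_sum smooth_mult cong: sum.cong)
  moreover have "px (pt (u i \<epsilon>)) p = pt (px (u i \<epsilon>)) p"
    using px_pt_commute[OF sm(1)[OF i]] by simp
  moreover have "(\<Sum>j\<in>I. (F i j \<epsilon> p + (if i = j then - px (l i \<epsilon>) p else 0)) * px (u j \<epsilon>) p)
      = (\<Sum>j\<in>I. F i j \<epsilon> p * px (u j \<epsilon>) p) - px (l i \<epsilon>) p * px (u i \<epsilon>) p"
  proof -
    have "(\<Sum>j\<in>I. (if i = j then - px (l i \<epsilon>) p else 0) * px (u j \<epsilon>) p)
        = (\<Sum>j\<in>I. if i = j then - px (l i \<epsilon>) p * px (u i \<epsilon>) p else 0)"
      by (intro sum.cong) auto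
    then show ?thesis using finite_I i by (simp add: distrib_right sum.distrib sum.delta)
  qed
  ultimately show "pt (px (u i \<epsilon>)) p + l i \<epsilon> p * px (px (u i \<epsilon>)) p =
      (\<Sum>j\<in>I. (F i j \<epsilon> p + (if i = j then - px (l i \<epsilon>) p else 0)) * px (u j \<epsilon>) p)
      + (px (H i \<epsilon>) p + (\<Sum>j\<in>I. px (F i j \<epsilon>) p * u j \<epsilon> p))"
    by (simp only: sum.distrib)
qed

end

lemma subseq_replicate: "subseq cs (replicate m a) \<Longrightarrow> \<exists>k\<le>m. cs = replicate k a"
proof -
  assume s: "subseq cs (replicate m a)"
  have "set cs \<subseteq> set (replicate m a)" using s by (induction rule: list_emb.induct) auto
  then have "cs = replicate (length cs) a" by (intro replicate_eqI) (auto split: if_splits)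
  moreover have "length cs \<le> m" using list_emb_length[OF s] by simp
  ultimately show ?thesis by blast
qed

lemma subseq_count_list: "subseq cs bs \<Longrightarrow> count_list cs a \<le> count_list bs a"
  by (induction rule: list_emb.induct) auto

lemma subseq_lists: "subseq cs bs \<Longrightarrow> bs \<in> lists A \<Longrightarrow> cs \<in> lists A"
  by (induction rule: list_emb.induct) auto

abbreviation pxn :: "nat \<Rightarrow> (real \<times> real \<Rightarrow> real) \<Rightarrow> real \<times> real \<Rightarrow> real"
  where "pxn m \<equiv> partial_derivs (replicate m (1, 0))"

lemma pxn_px: "pxn m (px f) = pxn (Suc m) f"
proof -
  have "pxn m (px f) = partial_derivs (replicate m (1, 0) @ [(1, 0)]) f"
    by (simp only: partial_derivs_append partial_derivs_Cons partial_derivs_Nil)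
  then show ?thesis by (simp only: replicate_append_same replicate_Suc)
qed

lemma replicate_lists_Basis: "replicate m (1, 0) \<in> lists (Basis :: (real \<times> real) set)"
  by (auto simp: Basis_plane)

text \<open>F, H and u vary in the induction, since derivatives of u up to order
  \<open>Suc k\<close> are derivatives up to order k for the differentiated system. Its
  inhomogeneity involves u up to order k, which the induction hypothesis for the original system
  controls beforehand.\<close>

lemma transport_family_x_derivs:
  assumes "growth P" "transport_family I l F H u"
    and "\<And>i m. i \<in> I \<Longrightarrow> m \<le> k \<Longrightarrow> dominated P (\<lambda>\<epsilon>. pxn m (H i \<epsilon>))"
    and "\<And>i m. i \<in> I \<Longrightarrow> m \<le> k \<Longrightarrow> dominated P (\<lambda>\<epsilon> x. pxn m (u i \<epsilon>) (x, 0))"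
    and "i \<in> I" "m \<le> k"
  shows "dominated P (\<lambda>\<epsilon>. pxn m (u i \<epsilon>))"
  using assms(2-)
proof (induction k arbitrary: F H u i m)
  case 0
  have H: "dominated P (H i)" if "i \<in> I" for i using 0(2)[OF that, of 0] by simp
  have u0: "dominated P (\<lambda>\<epsilon> x. u i \<epsilon> (x, 0))" if "i \<in> I" for i using 0(3)[OF that, of 0] by simp
  have "m = 0" using 0(5) by simp
  then show ?case
    using transport_family.dominated_solution[OF 0(1) assms(1) H u0 0(4)] by simp
next
  case (Suc k)
  interpret growth P by (rule assms(1))
  interpret transport_family I l F H u by (rule Suc.prems(1))
  have u: "dominated P (\<lambda>\<epsilon>. pxn m (u i \<epsilon>))" if "i \<in> I" "m \<le> k" for i m
    by (rule Suc.IH[OF Suc.prems(1) Suc.prems(2)[OF _ le_SucI] Suc.prems(3)[OF _ le_SucI] that])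
  have mk: "m \<le> Suc k" by (rule Suc.prems(5))
  show ?case
  proof (cases m)
    case 0
    then show ?thesis using u[OF Suc.prems(4), of 0] by simp
  next
    case (Suc n)
    have nk: "n \<le> k" using mk unfolding Suc by (rule Suc_le_mono[THEN iffD1])
    let ?H = "\<lambda>i \<epsilon> p. px (H i \<epsilon>) p + (\<Sum>j\<in>I. px (F i j \<epsilon>) p * u j \<epsilon> p)"
    have dH: "dominated P (\<lambda>\<epsilon>. pxn m (?H i \<epsilon>))" if i: "i \<in> I" and m: "m \<le> k" for i m
    proof -
      have "dominated P (\<lambda>\<epsilon>. pxn m (\<lambda>p. px (F i j \<epsilon>) p * u j \<epsilon> p))" if j: "j \<in> I" for j
      proof (rule dominated_partial_derivs_mult[OF replicate_lists_Basis smooth_px[OF smooth_F[OF i j]] smooth_u[OF j]])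
        fix cs :: "(real \<times> real) list" assume "subseq cs (replicate m (1, 0))"
        from subseq_replicate[OF this] obtain n where n: "n \<le> m" "cs = replicate n (1, 0)" by blast
        have "(\<lambda>\<epsilon>. px (F i j \<epsilon>)) \<in> smooth_growth moderate"
          using smooth_growth_partial_deriv[OF moderate_F[OF i j], of "(1, 0)"] by (simp add: Basis_plane)
        then show "dominated moderate (\<lambda>\<epsilon>. partial_derivs cs (px (F i j \<epsilon>)))"
          unfolding n(2) by (rule smooth_growthD(2)[OF _ replicate_lists_Basis])
        show "dominated P (\<lambda>\<epsilon>. partial_derivs cs (u j \<epsilon>))"
          unfolding n(2) using n(1) m by (intro u[OF j]) simp
      qed
      then have d: "dominated P (\<lambda>\<epsilon> p. pxn (Suc m) (H i \<epsilon>) p + (\<Sum>j\<in>I. pxn m (\<lambda>p. px (F i j \<epsilon>) p * u j \<epsilon> p) p))"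
        using Suc.prems(2)[OF i, of "Suc m"] m by (intro dominated_add dominated_sum) auto
      show ?thesis
      proof (rule dominated_cong[OF d])
        fix \<epsilon> :: real assume e: "\<epsilon> \<in> {0<..1}"
        have sm: "smooth (\<lambda>p. px (F i j \<epsilon>) p * u j \<epsilon> p)" if "j \<in> I" for j
          by (rule smooth_mult[OF smooth_px[OF smooth_F[OF i that e]] smooth_u[OF that e]])
        show "pxn m (?H i \<epsilon>) = (\<lambda>p. pxn (Suc m) (H i \<epsilon>) p + (\<Sum>j\<in>I. pxn m (\<lambda>p. px (F i j \<epsilon>) p * u j \<epsilon> p) p))"
        proof -
          have "pxn m (?H i \<epsilon>) = (\<lambda>p. pxn m (px (H i \<epsilon>)) p + pxn m (\<lambda>p. \<Sum>j\<in>I. px (F i j \<epsilon>) p * u j \<epsilon> p) p)"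
            by (intro partial_derivs_add smooth_px smooth_H i e smooth_sum sm replicate_lists_Basis)
          also have "pxn m (\<lambda>p. \<Sum>j\<in>I. px (F i j \<epsilon>) p * u j \<epsilon> p) = (\<lambda>p. \<Sum>j\<in>I. pxn m (\<lambda>p. px (F i j \<epsilon>) p * u j \<epsilon> p) p)"
            by (intro partial_derivs_sum sm replicate_lists_Basis)
          finally show ?thesis by (simp only: pxn_px)
        qed
      qed
    qed
    have du0: "dominated P (\<lambda>\<epsilon> x. pxn m (px (u i \<epsilon>)) (x, 0))" if "i \<in> I" "m \<le> k" for i m
      unfolding pxn_px using that by (intro Suc.prems(3)) auto
    have "dominated P (\<lambda>\<epsilon>. pxn n (px (u i \<epsilon>)))"
      by (rule Suc.IH[OF px_family dH du0 Suc.prems(4) nk])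
    then show ?thesis unfolding pxn_px Suc .
  qed
qed

text \<open>After the pure x-derivatives, induction on the number q of time directions, with any
  number of space directions. Solving the equation for \<open>pt u\<close> trades one time direction
  for terms that contain at most q of them.\<close>

lemma (in transport_family) smooth_growth_solution:
  assumes "growth P"
    and H: "\<And>i. i \<in> I \<Longrightarrow> H i \<in> smooth_growth P"
    and u0: "\<And>i. i \<in> I \<Longrightarrow> (\<lambda>\<epsilon> x. u i \<epsilon> (x, 0)) \<in> smooth_growth P"
    and i: "i \<in> I"
  shows "u i \<in> smooth_growth P"
proof -
  interpret growth P by fact
  have x_derivs: "dominated P (\<lambda>\<epsilon>. pxn m (u i \<epsilon>))" if "i \<in> I" for i m
  proof (rule transport_family_x_derivs[OF assms(1) transport_family_axioms _ _ that order_refl])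
    show "dominated P (\<lambda>\<epsilon>. pxn m (H i \<epsilon>))" if "i \<in> I" for i m
      by (rule smooth_growthD(2)[OF H[OF that] replicate_lists_Basis])
    show "dominated P (\<lambda>\<epsilon> x. pxn m (u i \<epsilon>) (x, 0))" if "i \<in> I" for i m
    proof (rule dominated_cong)
      show "dominated P (\<lambda>\<epsilon>. partial_derivs (replicate m 1) (\<lambda>x. u i \<epsilon> (x, 0)))"
        by (rule smooth_growthD(2)[OF u0[OF that]]) auto
    qed (simp only: partial_derivs_replicate_at0[OF smooth_u[OF that]])
  qed
  have t_derivs: "dominated P (\<lambda>\<epsilon>. partial_derivs bs (u i \<epsilon>))"
    if "i \<in> I" "bs \<in> lists Basis" "count_list bs (0, 1) \<le> q" for q i bs
    using that
  proof (induction q arbitrary: i bs)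
    case 0
    then have "(0, 1) \<notin> set bs" by (simp add: count_list_0_iff)
    with 0(2) have "bs = replicate (length bs) (1, 0)" by (auto simp: Basis_plane intro!: replicate_eqI)
    then obtain n where bs: "bs = replicate n (1, 0)" ..
    show ?case unfolding bs by (rule x_derivs[OF 0(1)])
  next
    case (Suc q)
    show ?case
    proof (cases "(0, 1) \<in> set bs")
      case False
      then show ?thesis using Suc.IH[OF Suc.prems(1,2)] by simp
    next
      case True
      define cs where "cs = remove1 (0, 1) bs"
      have sub: "subseq cs bs" unfolding cs_def by (induction bs) auto
      have cs: "cs \<in> lists Basis" by (rule subseq_lists[OF sub Suc.prems(2)])
      have "count_list bs (0, 1) = Suc (count_list cs (0, 1))"
        using True unfolding cs_def by (induction bs) auto
      then have count: "count_list cs (0, 1) \<le> q" using Suc.prems(3) by simp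
      have cs': "bs' \<in> lists Basis" "count_list bs' (0, 1) \<le> q" if "subseq bs' cs" for bs'
        using subseq_lists[OF that cs] subseq_count_list[OF that, of "(0, 1)"] count by auto
      have 1: "dominated P (\<lambda>\<epsilon>. partial_derivs cs (\<lambda>p. F i j \<epsilon> p * u j \<epsilon> p))" if j: "j \<in> I" for j
        by (rule dominated_partial_derivs_mult[OF cs smooth_F[OF Suc.prems(1) j] smooth_u[OF j]
              smooth_growthD(2)[OF moderate_F[OF Suc.prems(1) j] cs'(1)] Suc.IH[OF j cs']])
      \<comment> \<open>The additional x-direction does not raise the number of time directions, so
        the induction hypothesis applies.\<close>
      have x: "dominated P (\<lambda>\<epsilon>. partial_derivs bs' (px (u i \<epsilon>)))" if "subseq bs' cs" for bs'
        using Suc.IH[OF Suc.prems(1), of "bs' @ [(1, 0)]"] cs'[OF that]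
        by (simp add: partial_derivs_append Basis_plane)
      have 2: "dominated P (\<lambda>\<epsilon>. partial_derivs cs (\<lambda>p. l i \<epsilon> p * px (u i \<epsilon>) p))"
        by (rule dominated_partial_derivs_mult[OF cs smooth_l[OF Suc.prems(1)] smooth_px[OF smooth_u[OF Suc.prems(1)]]
              smooth_growthD(2)[OF moderate_l[OF Suc.prems(1)] cs'(1)] x])
      have 3: "dominated P (\<lambda>\<epsilon>. partial_derivs cs (H i \<epsilon>))"
        by (rule smooth_growthD(2)[OF H[OF Suc.prems(1)] cs])
      have d: "dominated P (\<lambda>\<epsilon> p. ((\<Sum>j\<in>I. partial_derivs cs (\<lambda>p. F i j \<epsilon> p * u j \<epsilon> p) p) + partial_derivs cs (H i \<epsilon>) p)
          + - partial_derivs cs (\<lambda>p. l i \<epsilon> p * px (u i \<epsilon>) p) p)"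
        using 1 2 3 by (intro dominated_add dominated_sum) (simp_all add: dominated_uminus)
      show ?thesis
      proof (rule dominated_cong[OF d])
        fix \<epsilon> :: real assume e: "\<epsilon> \<in> {0<..1}"
        have lu: "smooth (\<lambda>p. l i \<epsilon> p * px (u i \<epsilon>) p)"
          by (intro smooth_mult smooth_px smooth_l smooth_u Suc.prems(1) e)
        have Fu: "smooth (\<lambda>p. F i j \<epsilon> p * u j \<epsilon> p)" if "j \<in> I" for j
          by (intro smooth_mult smooth_F smooth_u Suc.prems(1) e that)
        note sH = smooth_H[OF Suc.prems(1) e]
        have "partial_derivs bs (u i \<epsilon>) = partial_derivs cs (pt (u i \<epsilon>))"
          unfolding cs_def by (rule partial_derivs_remove1[OF smooth_u[OF Suc.prems(1) e] Suc.prems(2) True])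
        also have "pt (u i \<epsilon>) = (\<lambda>p. ((\<Sum>j\<in>I. F i j \<epsilon> p * u j \<epsilon> p) + H i \<epsilon> p) + - (l i \<epsilon> p * px (u i \<epsilon>) p))"
          using eq[OF Suc.prems(1) e] by (intro ext) (simp add: algebra_simps)
        also have "partial_derivs cs \<dots> = (\<lambda>p. ((\<Sum>j\<in>I. partial_derivs cs (\<lambda>p. F i j \<epsilon> p * u j \<epsilon> p) p) + partial_derivs cs (H i \<epsilon>) p)
          + - partial_derivs cs (\<lambda>p. l i \<epsilon> p * px (u i \<epsilon>) p) p)"
          by (simp only: partial_derivs_add[OF smooth_add[OF smooth_sum[OF Fu] sH] smooth_uminus[OF lu] cs]
              partial_derivs_add[OF smooth_sum[OF Fu] sH cs] partial_derivs_uminus[OF lu cs] partial_derivs_sum[OF Fu cs])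
        finally show "partial_derivs bs (u i \<epsilon>) = \<dots>" .
      qed
    qed
  qed
  show ?thesis
    unfolding smooth_growth_def mem_Collect_eq
    using smooth_u[OF i] t_derivs[OF i _ order_refl] by blast
qed

subsection \<open>The algebra of generalized random fields\<close>

text \<open>Treats \<open>EML0\<close> and \<open>NL0\<close> together; almost sure smoothness is
  contained in \<open>smooth_growth\<close>.\<close>

definition field_families :: "'w measure \<Rightarrow> ((real \<Rightarrow> real) \<Rightarrow> bool) \<Rightarrow> ('a::euclidean_space, 'w) family set"
  where "field_families M P = {u. (\<forall>\<epsilon>\<in>{0<..1}. \<forall>x. u \<epsilon> x \<in> borel_measurable M) \<and>
    (AE w in M. (\<lambda>\<epsilon> x. u \<epsilon> x w) \<in> smooth_growth P)}"

lemma field_familiesD: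
  assumes "u \<in> field_families M P"
  shows "\<epsilon> \<in> {0<..1} \<Longrightarrow> u \<epsilon> x \<in> borel_measurable M" "AE w in M. (\<lambda>\<epsilon> x. u \<epsilon> x w) \<in> smooth_growth P"
  using assms by (auto simp: field_families_def)

lemma field_familiesI:
  assumes "\<And>\<epsilon> x. \<epsilon> \<in> {0<..1} \<Longrightarrow> u \<epsilon> x \<in> borel_measurable M" "AE w in M. (\<lambda>\<epsilon> x. u \<epsilon> x w) \<in> smooth_growth P"
  shows "u \<in> field_families M P"
  using assms by (auto simp: field_families_def)

lemma EML0_eq:
  fixes M :: "'w measure"
  shows "(EML0 M :: ('a::euclidean_space, 'w) family set) = field_families M moderate"
proof -
  have "AE w in M. \<forall>\<epsilon>\<in>{0<..1}. smooth (\<lambda>x. u \<epsilon> x w)"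
    if "AE w in M. (\<lambda>\<epsilon> x. u \<epsilon> x w) \<in> smooth_growth moderate" for u :: "('a, 'w) family"
    using that by (rule eventually_mono) (auto dest: smooth_growthD(1))
  then show ?thesis unfolding EML0_def field_families_def EM_eq by blast
qed

lemma NL0_eq:
  fixes M :: "'w measure"
  shows "(NL0 M :: ('a::euclidean_space, 'w) family set) = field_families M negligible_family"
proof -
  have "AE w in M. \<forall>\<epsilon>\<in>{0<..1}. smooth (\<lambda>x. u \<epsilon> x w)"
    if "AE w in M. (\<lambda>\<epsilon> x. u \<epsilon> x w) \<in> smooth_growth negligible_family" for u :: "('a, 'w) family"
    using that by (rule eventually_mono) (auto dest: smooth_growthD(1))
  then show ?thesis unfolding NL0_def field_families_def NEG_eq by blast
qed

lemma smooth_growth_cong: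
  assumes "u \<in> smooth_growth P" "\<And>\<epsilon>. \<epsilon> \<in> {0<..1} \<Longrightarrow> v \<epsilon> = u \<epsilon>"
  shows "v \<in> smooth_growth P"
  unfolding smooth_growth_def mem_Collect_eq
proof (intro conjI ballI)
  fix bs :: "'a list" assume "bs \<in> lists Basis"
  then show "dominated P (\<lambda>\<epsilon>. partial_derivs bs (v \<epsilon>))"
    by (intro dominated_cong[OF smooth_growthD(2)[OF assms(1)]]) (simp_all add: assms(2))
qed (simp add: assms(2) smooth_growthD(1)[OF assms(1)])

context growth
begin

lemma field_families_add:
  assumes "u \<in> field_families M P" "v \<in> field_families M P"
  shows "(\<lambda>\<epsilon> x w. u \<epsilon> x w + v \<epsilon> x w) \<in> field_families M P"
proof (rule field_familiesI)
  show "AE w in M. (\<lambda>\<epsilon> x. u \<epsilon> x w + v \<epsilon> x w) \<in> smooth_growth P"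
    using field_familiesD(2)[OF assms(1)] field_familiesD(2)[OF assms(2)]
    by eventually_elim (rule smooth_growth_add)
qed (intro borel_measurable_add field_familiesD(1)[OF assms(1)] field_familiesD(1)[OF assms(2)])

lemma field_families_uminus:
  assumes "u \<in> field_families M P" shows "(\<lambda>\<epsilon> x w. - u \<epsilon> x w) \<in> field_families M P"
proof (rule field_familiesI)
  show "AE w in M. (\<lambda>\<epsilon> x. - u \<epsilon> x w) \<in> smooth_growth P"
    using field_familiesD(2)[OF assms(1)] by eventually_elim (rule smooth_growth_uminus)
qed (intro borel_measurable_uminus field_familiesD(1)[OF assms(1)])

lemma field_families_diff:
  assumes "u \<in> field_families M P" "v \<in> field_families M P"
  shows "(\<lambda>\<epsilon> x w. u \<epsilon> x w - v \<epsilon> x w) \<in> field_families M P"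
  using field_families_add[OF assms(1) field_families_uminus[OF assms(2)]] by simp

lemma field_families_mult:
  assumes "u \<in> field_families M moderate" "v \<in> field_families M P"
  shows "(\<lambda>\<epsilon> x w. u \<epsilon> x w * v \<epsilon> x w) \<in> field_families M P"
proof (rule field_familiesI)
  show "AE w in M. (\<lambda>\<epsilon> x. u \<epsilon> x w * v \<epsilon> x w) \<in> smooth_growth P"
    using field_familiesD(2)[OF assms(1)] field_familiesD(2)[OF assms(2)]
    by eventually_elim (rule smooth_growth_mult)
qed (intro borel_measurable_times field_familiesD(1)[OF assms(1)] field_familiesD(1)[OF assms(2)])

lemma field_families_zero: "(\<lambda>\<epsilon> x w. 0) \<in> field_families M P"
  by (rule field_familiesI) (simp_all add: smooth_growth_zero)

lemma field_families_sum:
  "(\<And>i. i \<in> I \<Longrightarrow> u i \<in> field_families M P) \<Longrightarrow> (\<lambda>\<epsilon> x w. \<Sum>i\<in>I. u i \<epsilon> x w) \<in> field_families M P"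
  by (induction I rule: infinite_finite_induct) (auto intro: field_families_zero field_families_add)

end

lemma EML0_ops:
  "u \<in> EML0 M \<Longrightarrow> v \<in> EML0 M \<Longrightarrow> (\<lambda>\<epsilon> x w. u \<epsilon> x w + v \<epsilon> x w) \<in> EML0 M"
  "u \<in> EML0 M \<Longrightarrow> v \<in> EML0 M \<Longrightarrow> (\<lambda>\<epsilon> x w. u \<epsilon> x w * v \<epsilon> x w) \<in> EML0 M"
  "u \<in> EML0 M \<Longrightarrow> (\<lambda>\<epsilon> x w. - u \<epsilon> x w) \<in> EML0 M"
  "u \<in> EML0 M \<Longrightarrow> v \<in> EML0 M \<Longrightarrow> (\<lambda>\<epsilon> x w. u \<epsilon> x w - v \<epsilon> x w) \<in> EML0 M"
  "(\<lambda>\<epsilon> x w. 0) \<in> EML0 M" "(\<lambda>\<epsilon> x w. 1) \<in> EML0 M"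
  "(\<And>i. i \<in> I \<Longrightarrow> f i \<in> EML0 M) \<Longrightarrow> (\<lambda>\<epsilon> x w. \<Sum>i\<in>I. f i \<epsilon> x w) \<in> EML0 M"
  unfolding EML0_eq
  by (fact moderate.field_families_add moderate.field_families_mult moderate.field_families_uminus
      moderate.field_families_diff moderate.field_families_zero moderate.field_families_sum
    | rule field_familiesI, simp, simp add: smooth_growth_const)+

lemma NL0_subset_EML0:
  fixes M :: "'w measure"
  shows "(NL0 M :: ('a::euclidean_space, 'w) family set) \<subseteq> EML0 M"
proof
  fix u :: "('a, 'w) family" assume "u \<in> NL0 M"
  then have u: "u \<in> field_families M negligible_family" by (simp add: NL0_eq)
  show "u \<in> EML0 M" unfolding EML0_eq
  proof (rule field_familiesI)
    show "AE w in M. (\<lambda>\<epsilon> x. u \<epsilon> x w) \<in> smooth_growth moderate"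
      using field_familiesD(2)[OF u] by eventually_elim (use NEG_subset_EM in \<open>auto simp: EM_eq NEG_eq\<close>)
  qed (rule field_familiesD(1)[OF u])
qed

lemma cring_EML0: "cring (EML0_ring M)"
proof (rule cringI)
  show "abelian_group (EML0_ring M)"
  proof (rule abelian_groupI)
    fix u assume "u \<in> carrier (EML0_ring M)"
    then show "\<exists>v\<in>carrier (EML0_ring M). v \<oplus>\<^bsub>EML0_ring M\<^esub> u = \<zero>\<^bsub>EML0_ring M\<^esub>"
      by (intro bexI[of _ "\<lambda>\<epsilon> x w. - u \<epsilon> x w"]) (auto simp: EML0_ring_def EML0_ops)
  qed (auto simp: EML0_ring_def EML0_ops add_ac)
  show "comm_monoid (EML0_ring M)"
    by (rule comm_monoidI) (auto simp: EML0_ring_def EML0_ops mult_ac)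
qed (auto simp: EML0_ring_def distrib_right)

lemma ideal_NL0:
  fixes M :: "'w measure"
  shows "ideal (NL0 M :: ('a::euclidean_space, 'w) family set) (EML0_ring M)"
proof (rule idealI)
  interpret cring "EML0_ring M :: ('a, 'w) family ring" by (rule cring_EML0)
  show "ring (EML0_ring M :: ('a, 'w) family ring)" by (rule ring_axioms)
  have inv: "inv\<^bsub>add_monoid (EML0_ring M)\<^esub> u = (\<lambda>\<epsilon> x w. - u \<epsilon> x w)" if "u \<in> EML0 M" for u :: "('a, 'w) family"
  proof -
    have "\<ominus>\<^bsub>EML0_ring M\<^esub> u = (\<lambda>\<epsilon> x w. - u \<epsilon> x w)"
      by (rule minus_equality) (use that in \<open>auto simp: EML0_ring_def EML0_ops\<close>)
    then show ?thesis by (simp add: a_inv_def)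
  qed
  show "subgroup (NL0 M :: ('a, 'w) family set) (add_monoid (EML0_ring M))"
  proof (rule group.subgroupI[OF a_group])
    show "(NL0 M :: ('a, 'w) family set) \<subseteq> carrier (add_monoid (EML0_ring M))"
      using NL0_subset_EML0[of M] by (simp add: EML0_ring_def)
    show "(NL0 M :: ('a, 'w) family set) \<noteq> {}"
      unfolding NL0_eq using negligible.field_families_zero[of M] by (rule ex_in_conv[THEN iffD1, OF exI])
    fix u v :: "('a, 'w) family" assume u: "u \<in> NL0 M" and v: "v \<in> NL0 M"
    show "inv\<^bsub>add_monoid (EML0_ring M)\<^esub> u \<in> NL0 M"
      using u inv[OF subsetD[OF NL0_subset_EML0 u]] by (simp add: NL0_eq negligible.field_families_uminus)
    show "u \<otimes>\<^bsub>add_monoid (EML0_ring M)\<^esub> v \<in> NL0 M"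
      using u v negligible.field_families_add[of u M v] by (simp add: NL0_eq EML0_ring_def)
  qed
  fix a x :: "('a, 'w) family" assume "a \<in> NL0 M" "x \<in> carrier (EML0_ring M)"
  then have "(\<lambda>\<epsilon> y w. x \<epsilon> y w * a \<epsilon> y w) \<in> NL0 M"
    by (simp add: NL0_eq EML0_ring_def EML0_eq negligible.field_families_mult)
  then show "x \<otimes>\<^bsub>EML0_ring M\<^esub> a \<in> NL0 M" "a \<otimes>\<^bsub>EML0_ring M\<^esub> x \<in> NL0 M"
    by (simp_all add: EML0_ring_def mult.commute)
qed

lemma carrier_EML0_ring [simp]: "carrier (EML0_ring M) = EML0 M"
  by (simp add: EML0_ring_def)

section \<open>Classes of random fields and their ring operations\<close>

lemma mem_GL0_class:
  "u \<in> GL0_class M v \<longleftrightarrow> (\<lambda>\<epsilon> x w. u \<epsilon> x w - v \<epsilon> x w) \<in> NL0 M"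
proof -
  have "GL0_class M v = (\<Union>h\<in>NL0 M. {\<lambda>\<epsilon> x w. h \<epsilon> x w + v \<epsilon> x w})"
    by (simp add: GL0_class_def a_r_coset_def' EML0_ring_def)
  moreover have "u = (\<lambda>\<epsilon> x w. h \<epsilon> x w + v \<epsilon> x w) \<longleftrightarrow> h = (\<lambda>\<epsilon> x w. u \<epsilon> x w - v \<epsilon> x w)" for h
    by (auto simp only: fun_eq_iff eq_diff_eq)
  ultimately show ?thesis by (simp only: UN_iff singleton_iff) blast
qed

lemma GL0_class_eq_iff:
  assumes u: "u \<in> EML0 M" and v: "v \<in> EML0 M"
  shows "GL0_class M u = GL0_class M v \<longleftrightarrow> (\<lambda>\<epsilon> x w. u \<epsilon> x w - v \<epsilon> x w) \<in> NL0 M"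
proof -
  interpret cring "EML0_ring M" by (rule cring_EML0)
  have "\<ominus>\<^bsub>EML0_ring M\<^esub> v = (\<lambda>\<epsilon> x w. - v \<epsilon> x w)"
    by (rule minus_equality) (use v in \<open>auto simp: EML0_ring_def EML0_ops\<close>)
  then have "u \<ominus>\<^bsub>EML0_ring M\<^esub> v = (\<lambda>\<epsilon> x w. u \<epsilon> x w - v \<epsilon> x w)"
    by (simp add: a_minus_def) (simp add: EML0_ring_def)
  then show ?thesis
    using quotient_eq_iff_same_a_r_cos[OF ideal_NL0, of u v] u v by (simp add: GL0_class_def)
qed

lemma GL0_class_eqI:
  assumes u: "u \<in> EML0 M" and v: "v \<in> EML0 M"
    and eq: "AE w in M. \<forall>\<epsilon>\<in>{0<..1}. \<forall>x. u \<epsilon> x w = v \<epsilon> x w"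
  shows "GL0_class M u = GL0_class M v"
  unfolding GL0_class_eq_iff[OF u v] NL0_eq
proof (rule field_familiesI)
  have "(\<lambda>\<epsilon> x w. u \<epsilon> x w - v \<epsilon> x w) \<in> field_families M moderate"
    using EML0_ops(4)[OF u v] by (simp add: EML0_eq)
  then show "(\<lambda>w. u \<epsilon> x w - v \<epsilon> x w) \<in> borel_measurable M" if "\<epsilon> \<in> {0<..1}" for \<epsilon> x
    using that by (rule field_familiesD(1))
  show "AE w in M. (\<lambda>\<epsilon> x. u \<epsilon> x w - v \<epsilon> x w) \<in> smooth_growth negligible_family"
    using eq by eventually_elim (rule smooth_growth_cong[OF negligible.smooth_growth_zero], auto)
qed

lemma mem_GL0_classD:
  assumes "u \<in> GL0_class M v" "v \<in> EML0 M"
  shows "u \<in> EML0 M" "GL0_class M u = GL0_class M v"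
proof -
  have n: "(\<lambda>\<epsilon> x w. u \<epsilon> x w - v \<epsilon> x w) \<in> NL0 M" using assms(1) by (simp only: mem_GL0_class)
  from EML0_ops(1)[OF subsetD[OF NL0_subset_EML0 n] assms(2)] show u: "u \<in> EML0 M" by simp
  show "GL0_class M u = GL0_class M v" using n by (simp add: GL0_class_eq_iff[OF u assms(2)])
qed

lemma GL0_class_self: "u \<in> GL0_class M u"
  using negligible.field_families_zero by (simp add: mem_GL0_class NL0_eq)

lemma ring_hom_GL0: "ring_hom_cring (EML0_ring M) (GL0 M) (GL0_class M)"
  using ideal.rcos_ring_hom_cring[OF ideal_NL0 cring_EML0]
  by (simp add: GL0_def GL0_class_def[abs_def])

lemma carrier_GL0: "carrier (GL0 M) = GL0_class M ` EML0 M"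
  by (auto simp: GL0_def FactRing_def A_RCOSETS_def' GL0_class_def)

lemma GL0_class_add:
  assumes "u \<in> EML0 M" "v \<in> EML0 M"
  shows "GL0_class M u \<oplus>\<^bsub>GL0 M\<^esub> GL0_class M v = GL0_class M (\<lambda>\<epsilon> x w. u \<epsilon> x w + v \<epsilon> x w)"
proof -
  interpret h: ring_hom_cring "EML0_ring M" "GL0 M" "GL0_class M" by (rule ring_hom_GL0)
  show ?thesis using h.hom_add[of u v] assms by (simp add: EML0_ring_def)
qed

lemma GL0_class_mult:
  assumes "u \<in> EML0 M" "v \<in> EML0 M"
  shows "GL0_class M u \<otimes>\<^bsub>GL0 M\<^esub> GL0_class M v = GL0_class M (\<lambda>\<epsilon> x w. u \<epsilon> x w * v \<epsilon> x w)"
proof -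
  interpret h: ring_hom_cring "EML0_ring M" "GL0 M" "GL0_class M" by (rule ring_hom_GL0)
  show ?thesis using h.hom_mult[of u v] assms by (simp add: EML0_ring_def)
qed

lemma GL0_class_finsum:
  assumes "finite A" "\<And>j. j \<in> A \<Longrightarrow> f j \<in> EML0 M"
  shows "(\<Oplus>\<^bsub>GL0 M\<^esub>j\<in>A. GL0_class M (f j)) = GL0_class M (\<lambda>\<epsilon> x w. \<Sum>j\<in>A. f j \<epsilon> x w)"
  using assms
proof (induction A)
  case empty
  interpret h: ring_hom_cring "EML0_ring M" "GL0 M" "GL0_class M" by (rule ring_hom_GL0)
  show ?case using h.hom_zero[symmetric] by (simp add: EML0_ring_def)
next
  case (insert a A)
  interpret h: ring_hom_cring "EML0_ring M" "GL0 M" "GL0_class M" by (rule ring_hom_GL0)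
  have "(\<Oplus>\<^bsub>GL0 M\<^esub>j\<in>insert a A. GL0_class M (f j)) = GL0_class M (f a) \<oplus>\<^bsub>GL0 M\<^esub> (\<Oplus>\<^bsub>GL0 M\<^esub>j\<in>A. GL0_class M (f j))"
    using insert.hyps insert.prems by (intro h.S.finsum_insert) (auto simp: carrier_GL0)
  also have "\<dots> = GL0_class M (f a) \<oplus>\<^bsub>GL0 M\<^esub> GL0_class M (\<lambda>\<epsilon> x w. \<Sum>j\<in>A. f j \<epsilon> x w)"
    using insert.prems by (subst insert.IH) auto
  also have "\<dots> = GL0_class M (\<lambda>\<epsilon> x w. f a \<epsilon> x w + (\<Sum>j\<in>A. f j \<epsilon> x w))"
    using insert.prems by (intro GL0_class_add EML0_ops(7)) auto
  finally show ?case using insert.hyps by simp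
qed

section \<open>Differentiation and restriction of classes\<close>

definition field_deriv :: "'a::euclidean_space \<Rightarrow> ('a, 'w) family \<Rightarrow> ('a, 'w) family"
  where "field_deriv b u = (\<lambda>\<epsilon> x w. partial_deriv b (\<lambda>y. u \<epsilon> y w) x)"

lemma (in complete_measure) borel_measurable_AE_eq:
  fixes f g :: "'a \<Rightarrow> real"
  assumes g: "g \<in> borel_measurable M" and eq: "AE x in M. f x = g x"
  shows "f \<in> borel_measurable M"
proof (rule borel_measurableI)
  fix S :: "real set" assume "open S"
  show "f -` S \<inter> space M \<in> sets M"
  proof (rule in_sets_AE)
    show "g -` S \<inter> space M \<in> sets M" using g \<open>open S\<close> by (intro measurable_sets[OF g]) auto
    show "AE x in M. (x \<in> g -` S \<inter> space M) = (x \<in> f -` S \<inter> space M)"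
      using eq by eventually_elim auto
  qed auto
qed

text \<open>A partial derivative is known to be a limit of difference quotients only for those w
  whose path is smooth, so measurability is obtained up to a null set; completeness of the measure
  removes the exception.\<close>

lemma field_deriv_families:
  fixes u :: "('a::euclidean_space, 'w) family"
  assumes "complete_measure M" and u: "u \<in> field_families M P" and b: "b \<in> Basis"
  shows "field_deriv b u \<in> field_families M P"
proof (rule field_familiesI)
  show "AE w in M. (\<lambda>\<epsilon> x. field_deriv b u \<epsilon> x w) \<in> smooth_growth P"
    using field_familiesD(2)[OF u] unfolding field_deriv_def
    by eventually_elim (rule smooth_growth_partial_deriv[OF _ b])
  fix \<epsilon> :: real and x :: 'a assume e: "\<epsilon> \<in> {0<..1}"
  let ?q = "\<lambda>n w. (u \<epsilon> (x + inverse (real (Suc n)) *\<^sub>R b) w - u \<epsilon> x w) / inverse (real (Suc n))"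
  show "field_deriv b u \<epsilon> x \<in> borel_measurable M"
  proof (rule complete_measure.borel_measurable_AE_eq[OF assms(1)])
    show "(\<lambda>w. lim (\<lambda>n. ?q n w)) \<in> borel_measurable M"
      by (intro borel_measurable_lim_metric borel_measurable_divide borel_measurable_diff field_familiesD(1)[OF u e] borel_measurable_const)
    show "AE w in M. field_deriv b u \<epsilon> x w = lim (\<lambda>n. ?q n w)"
      using field_familiesD(2)[OF u]
    proof eventually_elim
      case (elim w)
      from smooth_has_partial[OF smooth_growthD(1)[OF elim e] b, of x]
      have d: "((\<lambda>h. (u \<epsilon> (x + h *\<^sub>R b) w - u \<epsilon> x w) / h) \<longlongrightarrow> field_deriv b u \<epsilon> x w) (at 0)"
        by (simp add: DERIV_def field_deriv_def)
      have "filterlim (\<lambda>n. inverse (real (Suc n))) (at 0) sequentially"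
        by (rule filterlim_atI[OF LIMSEQ_inverse_real_of_nat]) simp
      from filterlim_compose[OF d this] show ?case by (rule limI[symmetric])
    qed
  qed
qed

text \<open>All classes in the union coincide: for almost every w differentiation commutes with
  differences, and the derivative of a negligible family is negligible.\<close>

lemma GL0_deriv_class:
  fixes u :: "('a::euclidean_space, 'w) family"
  assumes M: "complete_measure M" and u: "u \<in> EML0 M" and b: "b \<in> Basis"
  shows "GL0_deriv M b (GL0_class M u) = GL0_class M (field_deriv b u)"
proof -
  have "GL0_class M (field_deriv b v) = GL0_class M (field_deriv b u)" if v: "v \<in> GL0_class M u" for v
  proof -
    note v' = mem_GL0_classD(1)[OF v u]
    have d: "field_deriv b z \<in> EML0 M" if "z \<in> EML0 M" for z
      using field_deriv_families[OF M _ b] that by (simp add: EML0_eq)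
    let ?n = "\<lambda>\<epsilon> x w. v \<epsilon> x w - u \<epsilon> x w"
    have n: "?n \<in> NL0 M" using v by (simp add: mem_GL0_class)
    have "field_deriv b ?n \<in> NL0 M" using field_deriv_families[OF M _ b] n by (simp add: NL0_eq)
    note dn = this[unfolded NL0_eq]
    show ?thesis
      unfolding GL0_class_eq_iff[OF d[OF v'] d[OF u]] NL0_eq
    proof (rule field_familiesI)
      have "(\<lambda>\<epsilon> x w. field_deriv b v \<epsilon> x w - field_deriv b u \<epsilon> x w) \<in> field_families M moderate"
        using EML0_ops(4)[OF d[OF v'] d[OF u]] by (simp add: EML0_eq)
      then show "(\<lambda>w. field_deriv b v \<epsilon> x w - field_deriv b u \<epsilon> x w) \<in> borel_measurable M" if "\<epsilon> \<in> {0<..1}" for \<epsilon> x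
        using that by (rule field_familiesD(1))
      show "AE w in M. (\<lambda>\<epsilon> x. field_deriv b v \<epsilon> x w - field_deriv b u \<epsilon> x w) \<in> smooth_growth negligible_family"
        using field_familiesD(2)[OF dn] field_familiesD(2)[OF v'[unfolded EML0_eq]] field_familiesD(2)[OF u[unfolded EML0_eq]]
      proof eventually_elim
        case (elim w)
        show ?case
        proof (rule smooth_growth_cong[OF elim(1)])
          fix \<epsilon> :: real assume e: "\<epsilon> \<in> {0<..1}"
          note sm = smooth_growthD(1)[OF elim(2) e] smooth_growthD(1)[OF elim(3) e]
          show "(\<lambda>x. field_deriv b v \<epsilon> x w - field_deriv b u \<epsilon> x w) = (\<lambda>x. field_deriv b ?n \<epsilon> x w)"
            using partial_deriv_add[OF sm(1) smooth_uminus[OF sm(2)] b] partial_deriv_uminus[OF sm(2) b]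
            unfolding field_deriv_def by (simp only: diff_conv_add_uminus)
        qed
      qed
    qed
  qed
  then show ?thesis
    unfolding GL0_deriv_def field_deriv_def[symmetric] using GL0_class_self[of u M]
    by (intro SUP_eq_const) blast+
qed

lemma field_families_at0:
  fixes u :: "(real \<times> real, 'w) family"
  assumes "growth P" and u: "u \<in> field_families M P"
  shows "(\<lambda>\<epsilon> x. u \<epsilon> (x, 0)) \<in> field_families M P"
proof (rule field_familiesI)
  interpret growth P by fact
  show "AE w in M. (\<lambda>\<epsilon> x. u \<epsilon> (x, 0) w) \<in> smooth_growth P"
    using field_familiesD(2)[OF u] by eventually_elim (rule smooth_growth_at0)
qed (rule field_familiesD(1)[OF u])

lemma GL0_at_time0_class:
  assumes u: "u \<in> EML0 M"
  shows "GL0_at_time0 M (GL0_class M u) = GL0_class M (\<lambda>\<epsilon> x. u \<epsilon> (x, 0))"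
proof -
  have "GL0_class M (\<lambda>\<epsilon> x. v \<epsilon> (x, 0)) = GL0_class M (\<lambda>\<epsilon> x. u \<epsilon> (x, 0))" if v: "v \<in> GL0_class M u" for v
  proof -
    have d: "(\<lambda>\<epsilon> x. z \<epsilon> (x, 0)) \<in> EML0 M" if "z \<in> EML0 M" for z :: "(real \<times> real, 'a) family"
      using field_families_at0[OF moderate.growth_axioms] that by (simp add: EML0_eq)
    have "(\<lambda>\<epsilon> x w. v \<epsilon> x w - u \<epsilon> x w) \<in> NL0 M" using v by (simp add: mem_GL0_class)
    from field_families_at0[OF negligible.growth_axioms this[unfolded NL0_eq]]
    show ?thesis
      unfolding GL0_class_eq_iff[OF d[OF mem_GL0_classD(1)[OF v u]] d[OF u]] NL0_eq .
  qed
  then show ?thesis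
    unfolding GL0_at_time0_def using GL0_class_self[of u M]
    by (intro SUP_eq_const) blast+
qed

subsection \<open>The Cauchy problem for generalized random fields\<close>

text \<open>\<open>to_nat\<close> carries the finite index type over to a finite set of natural
  numbers, as the doubling construction requires.\<close>

definition cauchy_sol :: "('n::finite \<Rightarrow> real \<times> real \<Rightarrow> real) \<Rightarrow> ('n \<Rightarrow> 'n \<Rightarrow> real \<times> real \<Rightarrow> real) \<Rightarrow>
    ('n \<Rightarrow> real \<times> real \<Rightarrow> real) \<Rightarrow> ('n \<Rightarrow> real \<Rightarrow> real) \<Rightarrow> 'n \<Rightarrow> real \<times> real \<Rightarrow> real"
  where "cauchy_sol l F g v i = sol (range (to_nat :: 'n \<Rightarrow> nat)) (\<lambda>k. l (from_nat k)) (\<lambda>k m. F (from_nat k) (from_nat m))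
    (\<lambda>k. free_part (l (from_nat k)) (g (from_nat k)) (v (from_nat k))) (to_nat i)"

lemma cauchy_sol:
  fixes l :: "'n::finite \<Rightarrow> real \<times> real \<Rightarrow> real"
  assumes "\<And>i. speed (l i)" "\<And>i j. smooth (F i j)" "\<And>i. smooth (g i)" "\<And>i. smooth (v i)"
  shows "smooth (cauchy_sol l F g v i)"
    "pt (cauchy_sol l F g v i) p + l i p * px (cauchy_sol l F g v i) p = (\<Sum>j\<in>UNIV. F i j p * cauchy_sol l F g v j p) + g i p"
    "cauchy_sol l F g v i (x, 0) = v i x"
proof -
  let ?I = "range (to_nat :: 'n \<Rightarrow> nat)"
  have fin: "finite ?I" by simp
  have i: "to_nat i \<in> ?I" by simp
  note c = classical_solution[where I = ?I and l = "\<lambda>k. l (from_nat k)" and F = "\<lambda>k m. F (from_nat k) (from_nat m)"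
      and g = "\<lambda>k. g (from_nat k)" and v = "\<lambda>k. v (from_nat k)", OF fin assms(1) assms(2) assms(3) assms(4) i]
  show "smooth (cauchy_sol l F g v i)" using c(1) by (simp add: cauchy_sol_def[abs_def])
  show "cauchy_sol l F g v i (x, 0) = v i x" using c(3)[of x] by (simp add: cauchy_sol_def[abs_def])
  show "pt (cauchy_sol l F g v i) p + l i p * px (cauchy_sol l F g v i) p = (\<Sum>j\<in>UNIV. F i j p * cauchy_sol l F g v j p) + g i p"
    using c(2)[of p] by (simp add: cauchy_sol_def[abs_def] sum.reindex[OF inj_to_nat] o_def)
qed

lemma meas_cauchy_sol:
  fixes l :: "'n::finite \<Rightarrow> real \<times> real \<Rightarrow> 'w \<Rightarrow> real"
  assumes sp: "\<And>i w. speed (\<lambda>p. l i p w)" and F: "\<And>i j w. smooth (\<lambda>p. F i j p w)"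
    and g: "\<And>i w. smooth (\<lambda>p. g i p w)" and v: "\<And>i w. smooth (\<lambda>x. v i x w)"
    and m: "\<And>i p. l i p \<in> borel_measurable M" "\<And>i j p. F i j p \<in> borel_measurable M"
      "\<And>i p. g i p \<in> borel_measurable M" "\<And>i x. v i x \<in> borel_measurable M"
  shows "(\<lambda>w. cauchy_sol (\<lambda>i p. l i p w) (\<lambda>i j p. F i j p w) (\<lambda>i p. g i p w) (\<lambda>i x. v i x w) i p) \<in> borel_measurable M"
proof -
  have rs: "random_speed M (l i)" for i by (rule random_speed.intro[OF sp m(1)])
  show ?thesis
    unfolding cauchy_sol_def
  proof (rule meas_sol[where l = "\<lambda>k. l (from_nat k)" and F = "\<lambda>k m. F (from_nat k) (from_nat m)"
        and h = "\<lambda>k p w. free_part (\<lambda>p. l (from_nat k) p w) (\<lambda>p. g (from_nat k) p w) (\<lambda>x. v (from_nat k) x w) p"])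
    show "(\<lambda>w. free_part (\<lambda>p. l (from_nat k) p w) (\<lambda>p. g (from_nat k) p w) (\<lambda>x. v (from_nat k) x w) p) \<in> borel_measurable M" for k p
      by (rule random_speed.meas_free_part[OF rs g m(3) v m(4)])
    show "transport_system (range (to_nat :: 'n \<Rightarrow> nat)) (\<lambda>k p. l (from_nat k) p w) (\<lambda>k m p. F (from_nat k) (from_nat m) p w)
        (\<lambda>k p. free_part (\<lambda>p. l (from_nat k) p w) (\<lambda>p. g (from_nat k) p w) (\<lambda>x. v (from_nat k) x w) p)" for w
      by (rule transport_system.intro)
        (simp_all add: sp smooth_imp_continuous[OF F] smooth_imp_continuous[OF free_part(1)[OF sp g v]])
  qed (simp_all add: rs m)
qed

section \<open>Representatives with pathwise bounds\<close>

lemma abs_le_matrix_norm: "\<bar>A i j\<bar> \<le> matrix_norm A"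
proof -
  have "\<bar>A i j\<bar> \<le> (\<Sum>j\<in>UNIV. \<bar>A i j\<bar>)" by (rule member_le_sum) auto
  also have "\<dots> \<le> matrix_norm A" unfolding matrix_norm_def by (rule Max_ge) auto
  finally show ?thesis .
qed

text \<open>The exceptional null set in the definition depends on the compact set. Countably many
  squares exhaust the plane, so one null set serves all compact sets.\<close>

lemma ac_local_log_type_representative:
  assumes "ac_local_log_type M V"
  shows "\<exists>v. (\<forall>i j. v i j \<in> V i j) \<and> (AE w in M. \<forall>i j. log_type (\<lambda>\<epsilon> p. v i j \<epsilon> p w))"
proof -
  obtain v where v: "\<forall>i j. v i j \<in> V i j"
    and log: "\<And>K. compact K \<Longrightarrow> AE w in M. \<exists>c>0. \<forall>\<epsilon>\<in>{0<..1}. \<forall>p\<in>K. matrix_norm (\<lambda>i j. v i j \<epsilon> p w) \<le> c * \<bar>ln \<epsilon>\<bar>"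
    using assms unfolding ac_local_log_type_def by blast
  have "AE w in M. \<forall>n::nat. \<exists>c>0. \<forall>\<epsilon>\<in>{0<..1}. \<forall>p\<in>{- real n..real n} \<times> {- real n..real n}.
      matrix_norm (\<lambda>i j. v i j \<epsilon> p w) \<le> c * \<bar>ln \<epsilon>\<bar>"
    by (subst AE_all_countable) (intro allI log compact_box)
  then have "AE w in M. \<forall>i j. log_type (\<lambda>\<epsilon> p. v i j \<epsilon> p w)"
  proof eventually_elim
    case (elim w)
    show ?case
      unfolding log_type_def
    proof (intro allI impI)
      fix i j and K :: "(real \<times> real) set" assume "compact K"
      then obtain R where R: "\<forall>p\<in>K. norm p \<le> R" using compact_imp_bounded bounded_iff by blast
      obtain n :: nat where n: "R \<le> real n" using real_arch_simple by blast
      have K: "p \<in> {- real n..real n} \<times> {- real n..real n}" if "p \<in> K" for p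
      proof -
        have "\<bar>fst p\<bar> \<le> real n" "\<bar>snd p\<bar> \<le> real n"
          using R that n norm_fst_le[of "fst p" "snd p"] norm_snd_le[of "snd p" "fst p"] by auto
        then show ?thesis by (cases p) (auto simp: abs_le_iff)
      qed
      obtain c where c: "\<forall>\<epsilon>\<in>{0<..1}. \<forall>p\<in>{- real n..real n} \<times> {- real n..real n}.
          matrix_norm (\<lambda>i j. v i j \<epsilon> p w) \<le> c * \<bar>ln \<epsilon>\<bar>" using elim by blast
      have "\<forall>\<^sub>F \<epsilon> in at_right 0. \<forall>p\<in>K. \<bar>v i j \<epsilon> p w\<bar> \<le> c * \<bar>ln \<epsilon>\<bar>"
        using eventually_unit'
      proof eventually_elim
        case (elim \<epsilon>)
        show ?case
        proof
          fix p assume "p \<in> K"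
          then show "\<bar>v i j \<epsilon> p w\<bar> \<le> c * \<bar>ln \<epsilon>\<bar>"
            using abs_le_matrix_norm[of "\<lambda>i j. v i j \<epsilon> p w" i j] c[rule_format, OF elim K] by (meson order_trans)
        qed
      qed
      then show "\<exists>C. \<forall>\<^sub>F \<epsilon> in at_right 0. \<forall>p\<in>K. \<bar>v i j \<epsilon> p w\<bar> \<le> C * \<bar>ln \<epsilon>\<bar>" ..
    qed
  qed
  with v show ?thesis by blast
qed

text \<open>Exhausting the time axis by the intervals from -n to n yields one null set for all time
  bounds T.\<close>

lemma uniformly_bounded_representative:
  assumes "uniformly_bounded_on_strips M V"
  shows "\<exists>v. (\<forall>i j. v i j \<in> V i j) \<and> (AE w in M. \<forall>T. \<exists>c>0. \<forall>i j. \<forall>\<epsilon>\<in>{0<..1}. \<forall>x t. \<bar>t\<bar> \<le> T \<longrightarrow> \<bar>v i j \<epsilon> (x, t) w\<bar> \<le> c)"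
proof -
  obtain v where v: "\<forall>i j. v i j \<in> V i j"
    and bd: "\<And>a b. \<exists>c>0. AE w in M. \<forall>\<epsilon>\<in>{0<..1}. \<forall>x. \<forall>t\<in>{a..b}. matrix_norm (\<lambda>i j. v i j \<epsilon> (x, t) w) \<le> c"
    using assms unfolding uniformly_bounded_on_strips_def by blast
  have "AE w in M. \<forall>n::nat. \<exists>c>0. \<forall>\<epsilon>\<in>{0<..1}. \<forall>x. \<forall>t\<in>{- real n..real n}. matrix_norm (\<lambda>i j. v i j \<epsilon> (x, t) w) \<le> c"
  proof (subst AE_all_countable, rule allI)
    fix n :: nat
    obtain c where "c > 0" "AE w in M. \<forall>\<epsilon>\<in>{0<..1}. \<forall>x. \<forall>t\<in>{- real n..real n}. matrix_norm (\<lambda>i j. v i j \<epsilon> (x, t) w) \<le> c"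
      using bd by blast
    then show "AE w in M. \<exists>c>0. \<forall>\<epsilon>\<in>{0<..1}. \<forall>x. \<forall>t\<in>{- real n..real n}. matrix_norm (\<lambda>i j. v i j \<epsilon> (x, t) w) \<le> c"
      by (rule_tac eventually_mono) blast+
  qed
  then have "AE w in M. \<forall>T. \<exists>c>0. \<forall>i j. \<forall>\<epsilon>\<in>{0<..1}. \<forall>x t. \<bar>t\<bar> \<le> T \<longrightarrow> \<bar>v i j \<epsilon> (x, t) w\<bar> \<le> c"
  proof eventually_elim
    case (elim w)
    show ?case
    proof
      fix T :: real
      obtain n :: nat where n: "T \<le> real n" using real_arch_simple by blast
      obtain c where c: "c > 0" "\<forall>\<epsilon>\<in>{0<..1}. \<forall>x. \<forall>t\<in>{- real n..real n}. matrix_norm (\<lambda>i j. v i j \<epsilon> (x, t) w) \<le> c"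
        using elim by blast
      have "\<bar>v i j \<epsilon> (x, t) w\<bar> \<le> c" if "\<epsilon> \<in> {0<..1}" "\<bar>t\<bar> \<le> T" for i j \<epsilon> x t
      proof -
        have "t \<in> {- real n..real n}" using that(2) n by (auto simp: abs_le_iff)
        then show ?thesis
          using abs_le_matrix_norm[of "\<lambda>i j. v i j \<epsilon> (x, t) w" i j] c(2) that(1) by (meson order_trans)
      qed
      with c(1) show "\<exists>c>0. \<forall>i j. \<forall>\<epsilon>\<in>{0<..1}. \<forall>x t. \<bar>t\<bar> \<le> T \<longrightarrow> \<bar>v i j \<epsilon> (x, t) w\<bar> \<le> c" by blast
    qed
  qed
  with v show ?thesis by blast
qed

text \<open>The hypotheses on the coefficients for a single w, with no probability left.\<close>

definition good_coeffs :: "('n \<Rightarrow> real \<Rightarrow> real \<times> real \<Rightarrow> real) \<Rightarrow> ('n \<Rightarrow> 'n \<Rightarrow> real \<Rightarrow> real \<times> real \<Rightarrow> real) \<Rightarrow> bool"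
  where "good_coeffs L F \<longleftrightarrow>
    (\<forall>i. L i \<in> smooth_growth moderate \<and> log_type (\<lambda>\<epsilon>. px (L i \<epsilon>))) \<and>
    (\<forall>i j. F i j \<in> smooth_growth moderate \<and> log_type (F i j)) \<and>
    (\<forall>T. \<exists>c>0. \<forall>i. \<forall>\<epsilon>\<in>{0<..1}. \<forall>x t. \<bar>t\<bar> \<le> T \<longrightarrow> \<bar>L i \<epsilon> (x, t)\<bar> \<le> c)"

lemma good_coeffs_speed:
  assumes "good_coeffs L F" "\<epsilon> \<in> {0<..1}" shows "speed (L i \<epsilon>)"
proof (rule speed.intro)
  show "smooth (L i \<epsilon>)" using assms smooth_growthD(1) unfolding good_coeffs_def by blast
  show "strip_bounded (L i \<epsilon>)" using assms unfolding good_coeffs_def strip_bounded_def by blast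
qed

lemma good_coeffs_solution_growth:
  fixes L :: "'n::finite \<Rightarrow> real \<Rightarrow> real \<times> real \<Rightarrow> real"
  assumes P: "growth P" and good: "good_coeffs L F"
    and u: "\<And>i \<epsilon>. \<epsilon> \<in> {0<..1} \<Longrightarrow> smooth (u i \<epsilon>)"
    and H: "\<And>i. H i \<in> smooth_growth P"
    and eq: "\<And>i \<epsilon> p. \<epsilon> \<in> {0<..1} \<Longrightarrow>
      pt (u i \<epsilon>) p + L i \<epsilon> p * px (u i \<epsilon>) p = (\<Sum>j\<in>UNIV. F i j \<epsilon> p * u j \<epsilon> p) + H i \<epsilon> p"
    and u0: "\<And>i. (\<lambda>\<epsilon> x. u i \<epsilon> (x, 0)) \<in> smooth_growth P"
  shows "u i \<in> smooth_growth P"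
proof -
  have bd: "\<exists>c>0. \<forall>i\<in>UNIV. \<forall>\<epsilon>\<in>{0<..1}. \<forall>x t. \<bar>t\<bar> \<le> T \<longrightarrow> \<bar>L i \<epsilon> (x, t)\<bar> \<le> c" for T
    using good unfolding good_coeffs_def by blast
  have "transport_family UNIV L F H u"
    by (rule transport_family.intro[OF finite[of UNIV] good_coeffs_speed[OF good] bd])
      (use good u eq smooth_growthD(1)[OF H] in \<open>simp_all add: good_coeffs_def\<close>)
  then show ?thesis by (rule transport_family.smooth_growth_solution) (simp_all add: P H u0)
qed

lemma partial_deriv_diff:
  assumes "smooth f" "smooth g" "b \<in> Basis"
  shows "partial_deriv b (\<lambda>x. f x - g x) = (\<lambda>x. partial_deriv b f x - partial_deriv b g x)"
  using partial_deriv_add[OF assms(1) smooth_uminus[OF assms(2)] assms(3)] partial_deriv_uminus[OF assms(2,3)]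
  by (simp only: diff_conv_add_uminus)

lemma field_families_AE_all:
  fixes Z :: "'k::countable \<Rightarrow> ('a::euclidean_space, 'w) family"
  assumes "\<And>k. Z k \<in> field_families M P"
  shows "AE w in M. \<forall>k. (\<lambda>\<epsilon> p. Z k \<epsilon> p w) \<in> smooth_growth P"
  using field_familiesD(2)[OF assms] unfolding AE_all_countable by blast

lemma field_families_cut:
  assumes "z \<in> field_families M P" "\<epsilon> \<in> {0<..1}" "S \<in> sets M"
  shows "(\<lambda>w. if w \<in> S then z \<epsilon> p w else 0) \<in> borel_measurable M"
  using field_familiesD(1)[OF assms(1,2), of p] assms(3) by (intro measurable_If_set) auto

theorem theorem5p1:
  fixes M :: "'w measure"
    and lam :: "'n::finite \<Rightarrow> (real \<times> real, 'w) family set"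
    and f :: "'n \<Rightarrow> 'n \<Rightarrow> (real \<times> real, 'w) family set"
    and g :: "'n \<Rightarrow> (real \<times> real, 'w) family set"
    and u0 :: "'n \<Rightarrow> (real, 'w) family set"
  assumes "prob_space M" and "complete_measure M"
    and "\<And>i. lam i \<in> carrier (GL0 M)"
    and "\<And>i j. f i j \<in> carrier (GL0 M)"
    and "\<And>i. g i \<in> carrier (GL0 M)"
    and "\<And>i. u0 i \<in> carrier (GL0 M)"
    and "uniformly_bounded_on_strips M (diag M lam)"
    and "ac_local_log_type M (diag M (\<lambda>i. GL0_dx M (lam i)))"
    and "ac_local_log_type M f"
  shows "\<exists>!u :: 'n \<Rightarrow> (real \<times> real, 'w) family set.
    (\<forall>i. u i \<in> carrier (GL0 M)) \<and>
    (\<forall>i. GL0_dt M (u i) \<oplus>\<^bsub>GL0 M\<^esub> lam i \<otimes>\<^bsub>GL0 M\<^esub> GL0_dx M (u i) =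
         (\<Oplus>\<^bsub>GL0 M\<^esub>j\<in>UNIV. f i j \<otimes>\<^bsub>GL0 M\<^esub> u j) \<oplus>\<^bsub>GL0 M\<^esub> g i) \<and>
    (\<forall>i. GL0_at_time0 M (u i) = u0 i)"
proof -
  let ?cl = "GL0_class M" and ?cl1 = "GL0_class M :: (real, 'w) family \<Rightarrow> _"
  let ?Dx = "field_deriv (1, 0) :: (real \<times> real, 'w) family \<Rightarrow> _" and ?Dt = "field_deriv (0, 1) :: (real \<times> real, 'w) family \<Rightarrow> _"
  have Bx: "(1, 0) \<in> (Basis :: (real \<times> real) set)" and Bt: "(0, 1) \<in> (Basis :: (real \<times> real) set)"
    by (simp_all add: Basis_plane)
  note cm = assms(2)
  have rep: "z \<in> EML0 M \<and> ?cl z = Z" if "z \<in> Z" "Z \<in> carrier (GL0 M)" for z Z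
    using that mem_GL0_classD[of z M] unfolding carrier_GL0 by blast

  obtain Lm where Lm: "\<And>i j. Lm i j \<in> diag M lam i j"
    "AE w in M. \<forall>T. \<exists>c>0. \<forall>i j. \<forall>\<epsilon>\<in>{0<..1}. \<forall>x t. \<bar>t\<bar> \<le> T \<longrightarrow> \<bar>Lm i j \<epsilon> (x, t) w\<bar> \<le> c"
    using uniformly_bounded_representative[OF assms(7)] by blast
  \<comment> \<open>The off-diagonal representatives belong to the zero class and are dropped; the
    matrix bound controls each diagonal entry.\<close>
  define L where "L i = Lm i i" for i
  have L: "L i \<in> EML0 M" "?cl (L i) = lam i" for i
    using rep[OF _ assms(3), of "L i" i] Lm(1)[of i i] by (simp_all add: L_def diag_def)
  obtain V where V: "\<And>i j. V i j \<in> diag M (\<lambda>i. GL0_dx M (lam i)) i j"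
    "AE w in M. \<forall>i j. log_type (\<lambda>\<epsilon> p. V i j \<epsilon> p w)"
    using ac_local_log_type_representative[OF assms(8)] by blast
  obtain F where F': "\<And>i j. F i j \<in> f i j" and log_F: "AE w in M. \<forall>i j. log_type (\<lambda>\<epsilon> p. F i j \<epsilon> p w)"
    using ac_local_log_type_representative[OF assms(9)] by blast
  have F: "F i j \<in> EML0 M" "?cl (F i j) = f i j" for i j
    using rep[OF F' assms(4)] by simp_all
  have "\<forall>i. \<exists>G. G \<in> EML0 M \<and> ?cl G = g i" using assms(5) unfolding carrier_GL0 by (metis imageE)
  then obtain G where G: "\<And>i. G i \<in> EML0 M" "\<And>i. ?cl (G i) = g i" by metis
  have "\<forall>i. \<exists>U. U \<in> EML0 M \<and> ?cl1 U = u0 i" using assms(6) unfolding carrier_GL0 by (metis imageE)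
  then obtain U where U: "\<And>i. U i \<in> EML0 M" "\<And>i. ?cl1 (U i) = u0 i" by metis

  have D: "?Dx z \<in> EML0 M" "?Dt z \<in> EML0 M" if "z \<in> EML0 M" for z
    using field_deriv_families[OF cm _ Bx] field_deriv_families[OF cm _ Bt] that by (simp_all add: EML0_eq)
  have dx: "GL0_dx M (?cl z) = ?cl (?Dx z)" and dt: "GL0_dt M (?cl z) = ?cl (?Dt z)" if "z \<in> EML0 M" for z
    using GL0_deriv_class[OF cm that Bx] GL0_deriv_class[OF cm that Bt] by simp_all

  \<comment> \<open>The representative \<open>V\<close> that witnesses the logarithmic bound need
    not be the derivative of the chosen \<open>L\<close>. The two differ by a negligible family,
    which is itself of logarithmic type.\<close>
  have log_L: "AE w in M. log_type (\<lambda>\<epsilon>. px (\<lambda>p. L i \<epsilon> p w))" for i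
  proof -
    have "V i i \<in> ?cl (?Dx (L i))" using V(1)[of i i] dx[OF L(1)[of i]] by (simp add: diag_def L(2))
    then have "(\<lambda>\<epsilon> p w. V i i \<epsilon> p w - ?Dx (L i) \<epsilon> p w) \<in> field_families M negligible_family"
      by (simp only: mem_GL0_class NL0_eq)
    from field_familiesD(2)[OF this] V(2) show ?thesis
    proof eventually_elim
      case (elim w)
      have "log_type (\<lambda>\<epsilon> p. V i i \<epsilon> p w + - (V i i \<epsilon> p w - ?Dx (L i) \<epsilon> p w))"
        using log_type_negligible[OF smooth_growthD(3)[OF elim(1)]] elim(2)
        by (intro log_type_add) (simp_all only: log_type_uminus)
      then show ?case by (simp add: field_deriv_def)
    qed
  qed

  define good where "good w \<longleftrightarrow> good_coeffs (\<lambda>i \<epsilon> p. L i \<epsilon> p w) (\<lambda>i j \<epsilon> p. F i j \<epsilon> p w) \<and>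
      (\<forall>i. (\<lambda>\<epsilon> p. G i \<epsilon> p w) \<in> smooth_growth moderate \<and> (\<lambda>\<epsilon> x. U i \<epsilon> x w) \<in> smooth_growth moderate)" for w
  have AE_F: "AE w in M. \<forall>k. (\<lambda>\<epsilon> p. F (fst k) (snd k) \<epsilon> p w) \<in> smooth_growth moderate"
    by (rule field_families_AE_all[of "\<lambda>k. F (fst k) (snd k)"]) (rule F(1)[unfolded EML0_eq])
  have AE_log_L: "AE w in M. \<forall>i. log_type (\<lambda>\<epsilon>. px (\<lambda>p. L i \<epsilon> p w))"
    unfolding AE_all_countable using log_L by blast
  have AE_good: "AE w in M. good w"
    using field_families_AE_all[of L, OF L(1)[unfolded EML0_eq]] field_families_AE_all[of G, OF G(1)[unfolded EML0_eq]]
      field_families_AE_all[of U, OF U(1)[unfolded EML0_eq]] AE_F log_F Lm(2) AE_log_L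
  proof eventually_elim
    case (elim w)
    have "\<exists>c>0. \<forall>i. \<forall>\<epsilon>\<in>{0<..1}. \<forall>x t. \<bar>t\<bar> \<le> T \<longrightarrow> \<bar>L i \<epsilon> (x, t) w\<bar> \<le> c" for T
      using elim(6) unfolding L_def by blast
    moreover have "(\<lambda>\<epsilon> p. F i j \<epsilon> p w) \<in> smooth_growth moderate" for i j
      using elim(4)[rule_format, of "(i, j)"] by simp
    ultimately show ?case using elim(1,2,3,5,7) unfolding good_def good_coeffs_def by blast
  qed
  \<comment> \<open>Measurable because its complement is a null set of a complete measure.\<close>
  define S where "S = {w \<in> space M. good w}"
  have S: "S \<in> sets M"
  proof -
    have "{w \<in> space M. \<not> good w} \<in> null_sets M"
      using AE_good complete_measure.AE_iff_null_sets[OF cm] by blast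
    then have "space M - {w \<in> space M. \<not> good w} \<in> sets M" by (intro sets.compl_sets) auto
    then show ?thesis by (simp add: S_def set_diff_eq conj_commute cong: conj_cong)
  qed
  have AE_S: "AE w in M. w \<in> S" using AE_good AE_space by eventually_elim (simp add: S_def)
  have goodS: "good w" if "w \<in> S" for w using that by (simp add: S_def)

  \<comment> \<open>Off S all data are replaced by 0, so the classical construction applies for
    every w and gives a family measurable in w; the change affects a null set only.\<close>
  define u where "u i \<epsilon> p w = cauchy_sol (\<lambda>i p. if w \<in> S then L i \<epsilon> p w else 0)
      (\<lambda>i j p. if w \<in> S then F i j \<epsilon> p w else 0) (\<lambda>i p. if w \<in> S then G i \<epsilon> p w else 0)
      (\<lambda>i x. if w \<in> S then U i \<epsilon> x w else 0) i p" for i \<epsilon> p w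
  have smooth_data: "speed (\<lambda>p. if w \<in> S then L i \<epsilon> p w else 0)" "smooth (\<lambda>p. if w \<in> S then F i j \<epsilon> p w else 0)"
      "smooth (\<lambda>p. if w \<in> S then G i \<epsilon> p w else 0)" "smooth (\<lambda>x. if w \<in> S then U i \<epsilon> x w else 0)"
    if e: "\<epsilon> \<in> {0<..1}" for \<epsilon> i j w
  proof -
    have sp0: "speed (\<lambda>p. 0)"
      by (rule speed.intro) (auto simp: strip_bounded_def intro: exI[of _ 1])
    show "speed (\<lambda>p. if w \<in> S then L i \<epsilon> p w else 0)"
      using good_coeffs_speed[OF _ e, of "\<lambda>i \<epsilon> p. L i \<epsilon> p w" "\<lambda>i j \<epsilon> p. F i j \<epsilon> p w" i] goodS[of w] sp0
      by (cases "w \<in> S") (simp_all add: good_def)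
    show "smooth (\<lambda>p. if w \<in> S then F i j \<epsilon> p w else 0)"
      using smooth_growthD(1)[where u = "\<lambda>\<epsilon> p. F i j \<epsilon> p w" and P = moderate, OF _ e] goodS[of w]
      by (cases "w \<in> S") (simp_all add: good_def good_coeffs_def)
    show "smooth (\<lambda>p. if w \<in> S then G i \<epsilon> p w else 0)"
      using smooth_growthD(1)[where u = "\<lambda>\<epsilon> p. G i \<epsilon> p w" and P = moderate, OF _ e] goodS[of w]
      by (cases "w \<in> S") (simp_all add: good_def)
    show "smooth (\<lambda>x. if w \<in> S then U i \<epsilon> x w else 0)"
      using smooth_growthD(1)[where u = "\<lambda>\<epsilon> x. U i \<epsilon> x w" and P = moderate, OF _ e] goodS[of w]
      by (cases "w \<in> S") (simp_all add: good_def)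
  qed
  note cut = field_families_cut[OF _ _ S, where P = moderate, folded EML0_eq]
  have u_meas: "u i \<epsilon> p \<in> borel_measurable M" if e: "\<epsilon> \<in> {0<..1}" for i \<epsilon> p
    unfolding u_def[abs_def]
    by (rule meas_cauchy_sol[where l = "\<lambda>i p w. if w \<in> S then L i \<epsilon> p w else 0"
          and F = "\<lambda>i j p w. if w \<in> S then F i j \<epsilon> p w else 0"
          and g = "\<lambda>i p w. if w \<in> S then G i \<epsilon> p w else 0"
          and v = "\<lambda>i x w. if w \<in> S then U i \<epsilon> x w else 0"])
      (rule smooth_data[OF e] cut[OF L(1) e] cut[OF F(1) e] cut[OF G(1) e] cut[OF U(1) e])+
  have u_sol: "smooth (\<lambda>p. u i \<epsilon> p w)"
      "pt (\<lambda>p. u i \<epsilon> p w) p + L i \<epsilon> p w * px (\<lambda>p. u i \<epsilon> p w) p = (\<Sum>j\<in>UNIV. F i j \<epsilon> p w * u j \<epsilon> p w) + G i \<epsilon> p w"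
      "u i \<epsilon> (x, 0) w = U i \<epsilon> x w"
    if "\<epsilon> \<in> {0<..1}" "w \<in> S" for i \<epsilon> p x w
    using cauchy_sol[where l = "\<lambda>i p. if w \<in> S then L i \<epsilon> p w else 0"
        and F = "\<lambda>i j p. if w \<in> S then F i j \<epsilon> p w else 0" and g = "\<lambda>i p. if w \<in> S then G i \<epsilon> p w else 0"
        and v = "\<lambda>i x. if w \<in> S then U i \<epsilon> x w else 0" and i = i,
        OF smooth_data[OF that(1)]] that(2)
    by (simp_all add: u_def)
  have u_EM: "u i \<in> EML0 M" for i
    unfolding EML0_eq
  proof (rule field_familiesI[OF u_meas])
    show "AE w in M. (\<lambda>\<epsilon> p. u i \<epsilon> p w) \<in> smooth_growth moderate"
      using AE_S
    proof eventually_elim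
      case (elim w)
      note gw = goodS[OF elim, unfolded good_def]
      show ?case
      proof (rule good_coeffs_solution_growth[OF moderate.growth_axioms conjunct1[OF gw],
            where u = "\<lambda>i \<epsilon> p. u i \<epsilon> p w" and H = "\<lambda>i \<epsilon> p. G i \<epsilon> p w"])
        show "(\<lambda>\<epsilon> x. u i \<epsilon> (x, 0) w) \<in> smooth_growth moderate" for i
          by (rule smooth_growth_cong[of "\<lambda>\<epsilon> x. U i \<epsilon> x w"]) (use gw u_sol(3)[OF _ elim] in auto)
      qed (use gw u_sol[OF _ elim] in auto)
    qed
  qed

  \<comment> \<open>The two sides of the equation for representatives. By \<open>lhs\<close> and
    \<open>rhs\<close> they are compatible with classes, so an equation in the quotient becomes one
    modulo negligible families.\<close>
  define A where "A i z = (\<lambda>\<epsilon> p w. ?Dt z \<epsilon> p w + L i \<epsilon> p w * ?Dx z \<epsilon> p w)" for i z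
  define B where "B i z = (\<lambda>\<epsilon> p w. (\<Sum>j\<in>UNIV. F i j \<epsilon> p w * z j \<epsilon> p w) + G i \<epsilon> p w)" for i and z :: "'n \<Rightarrow> (real \<times> real, 'w) family"
  have A_EM: "A i z \<in> EML0 M" if "z \<in> EML0 M" for i z
    unfolding A_def by (intro EML0_ops(1,2) D L(1) that)
  have B_EM: "B i z \<in> EML0 M" if "\<And>j. z j \<in> EML0 M" for i z
    unfolding B_def by (intro EML0_ops(1) EML0_ops(7) EML0_ops(2) F(1) G(1) that)
  have lhs: "GL0_dt M (?cl z) \<oplus>\<^bsub>GL0 M\<^esub> lam i \<otimes>\<^bsub>GL0 M\<^esub> GL0_dx M (?cl z) = ?cl (A i z)" if z: "z \<in> EML0 M" for i z
    unfolding dx[OF z] dt[OF z] L(2)[symmetric] GL0_class_mult[OF L(1) D(1)[OF z]]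
      GL0_class_add[OF D(2)[OF z] EML0_ops(2)[OF L(1) D(1)[OF z]]] A_def ..
  have rhs: "(\<Oplus>\<^bsub>GL0 M\<^esub>j\<in>UNIV. f i j \<otimes>\<^bsub>GL0 M\<^esub> ?cl (z j)) \<oplus>\<^bsub>GL0 M\<^esub> g i = ?cl (B i z)"
    if z: "\<And>j. z j \<in> EML0 M" for i z
  proof -
    have "(\<Oplus>\<^bsub>GL0 M\<^esub>j\<in>UNIV. f i j \<otimes>\<^bsub>GL0 M\<^esub> ?cl (z j)) = ?cl (\<lambda>\<epsilon> p w. \<Sum>j\<in>UNIV. F i j \<epsilon> p w * z j \<epsilon> p w)"
      unfolding F(2)[symmetric] GL0_class_mult[OF F(1) z]
      by (rule GL0_class_finsum) (simp_all add: EML0_ops(2)[OF F(1) z])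
    then show ?thesis
      unfolding G(2)[symmetric] B_def
      by (simp only: GL0_class_add[OF EML0_ops(7)[OF EML0_ops(2)[OF F(1) z]] G(1)])
  qed
  have u_eq: "?cl (A i (u i)) = ?cl (B i u)" for i
  proof (rule GL0_class_eqI[OF A_EM[OF u_EM]])
    show "B i u \<in> EML0 M" by (rule B_EM) (rule u_EM)
    show "AE w in M. \<forall>\<epsilon>\<in>{0<..1}. \<forall>p. A i (u i) \<epsilon> p w = B i u \<epsilon> p w"
      using AE_S
    proof eventually_elim
      case (elim w)
      then show ?case using u_sol(2)[OF _ elim] unfolding A_def B_def field_deriv_def by blast
    qed
  qed
  have at0: "GL0_at_time0 M (?cl z) = ?cl1 (\<lambda>\<epsilon> x. z \<epsilon> (x, 0))" "(\<lambda>\<epsilon> x. z \<epsilon> (x, 0)) \<in> EML0 M" if "z \<in> EML0 M" for z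
    using GL0_at_time0_class[OF that] field_families_at0[OF moderate.growth_axioms] that by (simp_all add: EML0_eq)
  have u_init: "?cl1 (\<lambda>\<epsilon> x. u i \<epsilon> (x, 0)) = u0 i" for i
  proof -
    have "?cl1 (\<lambda>\<epsilon> x. u i \<epsilon> (x, 0)) = ?cl1 (U i)"
    proof (rule GL0_class_eqI[OF at0(2)[OF u_EM] U(1)])
      show "AE w in M. \<forall>\<epsilon>\<in>{0<..1}. \<forall>x. u i \<epsilon> (x, 0) w = U i \<epsilon> x w"
        using AE_S by eventually_elim (simp add: u_sol(3))
    qed
    then show ?thesis by (simp only: U(2))
  qed

  have unique: "?cl (z i) = ?cl (u i)"
    if z: "\<And>j. z j \<in> EML0 M" and z_eq: "\<And>i. ?cl (A i (z i)) = ?cl (B i z)"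
      and z_init: "\<And>i. ?cl1 (\<lambda>\<epsilon> x. z i \<epsilon> (x, 0)) = u0 i" for z i
  proof -
    \<comment> \<open>A solution in the quotient solves the equation for representatives up to a
      negligible residual.\<close>
    have res: "(\<lambda>\<epsilon> p w. A i (y i) \<epsilon> p w - B i y \<epsilon> p w) \<in> field_families M negligible_family"
      if "\<And>j. y j \<in> EML0 M" "\<And>i. ?cl (A i (y i)) = ?cl (B i y)" for y i
    proof -
      have B: "B i y \<in> EML0 M" by (rule B_EM) (rule that(1))
      show ?thesis using that(2)[of i] unfolding GL0_class_eq_iff[OF A_EM[OF that(1)] B] NL0_eq .
    qed
    have res_z: "(\<lambda>\<epsilon> p w. A i (z i) \<epsilon> p w - B i z \<epsilon> p w) \<in> field_families M negligible_family" for i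
      by (rule res) (rule z, rule z_eq)
    have res_u: "(\<lambda>\<epsilon> p w. A i (u i) \<epsilon> p w - B i u \<epsilon> p w) \<in> field_families M negligible_family" for i
      by (rule res) (rule u_EM, rule u_eq)
    have init: "(\<lambda>\<epsilon> x w. z i \<epsilon> (x, 0) w - u i \<epsilon> (x, 0) w) \<in> field_families M negligible_family" for i
      using z_init[of i] unfolding u_init[of i, symmetric] GL0_class_eq_iff[OF at0(2)[OF z] at0(2)[OF u_EM]] NL0_eq .
    show ?thesis
      unfolding GL0_class_eq_iff[OF z u_EM] NL0_eq
    proof (rule field_familiesI)
      show "(\<lambda>w. z i \<epsilon> p w - u i \<epsilon> p w) \<in> borel_measurable M" if "\<epsilon> \<in> {0<..1}" for \<epsilon> p
        using z[of i] u_meas[OF that] field_familiesD(1)[of "z i" M moderate \<epsilon> p] that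
        by (intro borel_measurable_diff) (auto simp: EML0_eq)
      show "AE w in M. (\<lambda>\<epsilon> p. z i \<epsilon> p w - u i \<epsilon> p w) \<in> smooth_growth negligible_family"
        using AE_S field_families_AE_all[of z, OF z[unfolded EML0_eq]] field_families_AE_all[of u, OF u_EM[unfolded EML0_eq]]
          field_families_AE_all[of "\<lambda>i \<epsilon> p w. A i (z i) \<epsilon> p w - B i z \<epsilon> p w", OF res_z]
          field_families_AE_all[of "\<lambda>i \<epsilon> p w. A i (u i) \<epsilon> p w - B i u \<epsilon> p w", OF res_u]
          field_families_AE_all[of "\<lambda>i \<epsilon> x w. z i \<epsilon> (x, 0) w - u i \<epsilon> (x, 0) w", OF init]
      proof eventually_elim
        case (elim w)
        note gw = goodS[OF elim(1), unfolded good_def]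
        \<comment> \<open>The difference z - u solves the system exactly when the difference of the
          two residuals is taken as inhomogeneity. That inhomogeneity and the initial values are
          negligible, so the growth theorem applies with negligible families.\<close>
        let ?H = "\<lambda>i \<epsilon> p. (A i (z i) \<epsilon> p w - B i z \<epsilon> p w) + - (A i (u i) \<epsilon> p w - B i u \<epsilon> p w)"
        show ?case
        proof (rule good_coeffs_solution_growth[OF negligible.growth_axioms conjunct1[OF gw],
              where u = "\<lambda>i \<epsilon> p. z i \<epsilon> p w - u i \<epsilon> p w" and H = ?H])
          show "?H i \<in> smooth_growth negligible_family" for i
            by (rule negligible.smooth_growth_add[OF elim(4)[rule_format] negligible.smooth_growth_uminus[OF elim(5)[rule_format]]])
          show "(\<lambda>\<epsilon> x. z i \<epsilon> (x, 0) w - u i \<epsilon> (x, 0) w) \<in> smooth_growth negligible_family" for i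
            by (rule elim(6)[rule_format])
          fix i \<epsilon> p assume e: "\<epsilon> \<in> {0<..1::real}"
          note sm = smooth_growthD(1)[OF elim(2)[rule_format] e] smooth_growthD(1)[OF elim(3)[rule_format] e]
          show "smooth (\<lambda>p. z i \<epsilon> p w - u i \<epsilon> p w)" by (rule smooth_diff[OF sm])
          show "pt (\<lambda>p. z i \<epsilon> p w - u i \<epsilon> p w) p + L i \<epsilon> p w * px (\<lambda>p. z i \<epsilon> p w - u i \<epsilon> p w) p
              = (\<Sum>j\<in>UNIV. F i j \<epsilon> p w * (z j \<epsilon> p w - u j \<epsilon> p w)) + ?H i \<epsilon> p"
            unfolding partial_deriv_diff[OF sm Bx] partial_deriv_diff[OF sm Bt] A_def B_def field_deriv_def
            by (simp add: right_diff_distrib sum_subtractf)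
        qed
      qed
    qed
  qed

  have rhs_u: "(\<Oplus>\<^bsub>GL0 M\<^esub>j\<in>UNIV. f i j \<otimes>\<^bsub>GL0 M\<^esub> ?cl (u j)) \<oplus>\<^bsub>GL0 M\<^esub> g i = ?cl (B i u)" for i
    by (rule rhs) (rule u_EM)
  show ?thesis
  proof (rule ex1I[of _ "\<lambda>i. ?cl (u i)"])
    show "(\<forall>i. ?cl (u i) \<in> carrier (GL0 M)) \<and>
      (\<forall>i. GL0_dt M (?cl (u i)) \<oplus>\<^bsub>GL0 M\<^esub> lam i \<otimes>\<^bsub>GL0 M\<^esub> GL0_dx M (?cl (u i)) =
         (\<Oplus>\<^bsub>GL0 M\<^esub>j\<in>UNIV. f i j \<otimes>\<^bsub>GL0 M\<^esub> ?cl (u j)) \<oplus>\<^bsub>GL0 M\<^esub> g i) \<and>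
      (\<forall>i. GL0_at_time0 M (?cl (u i)) = u0 i)"
      unfolding lhs[OF u_EM] rhs_u at0(1)[OF u_EM] carrier_GL0
      using u_eq u_init u_EM by blast
  next
    fix W :: "'n \<Rightarrow> (real \<times> real, 'w) family set"
    assume W: "(\<forall>i. W i \<in> carrier (GL0 M)) \<and>
      (\<forall>i. GL0_dt M (W i) \<oplus>\<^bsub>GL0 M\<^esub> lam i \<otimes>\<^bsub>GL0 M\<^esub> GL0_dx M (W i) =
         (\<Oplus>\<^bsub>GL0 M\<^esub>j\<in>UNIV. f i j \<otimes>\<^bsub>GL0 M\<^esub> W j) \<oplus>\<^bsub>GL0 M\<^esub> g i) \<and>
      (\<forall>i. GL0_at_time0 M (W i) = u0 i)"
    then have "\<forall>i. \<exists>z. z \<in> EML0 M \<and> W i = ?cl z" unfolding carrier_GL0 by (metis imageE)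
    then obtain z where z: "\<And>i. z i \<in> EML0 M" "\<And>i. W i = ?cl (z i)" by metis
    have rhs_z: "(\<Oplus>\<^bsub>GL0 M\<^esub>j\<in>UNIV. f i j \<otimes>\<^bsub>GL0 M\<^esub> ?cl (z j)) \<oplus>\<^bsub>GL0 M\<^esub> g i = ?cl (B i z)" for i
      by (rule rhs) (rule z(1))
    have z': "?cl (A i (z i)) = ?cl (B i z)" "?cl1 (\<lambda>\<epsilon> x. z i \<epsilon> (x, 0)) = u0 i" for i
      using W unfolding z(2) lhs[OF z(1)] rhs_z at0(1)[OF z(1)] by blast+
    show "W = (\<lambda>i. ?cl (u i))"
    proof
      fix i
      show "W i = ?cl (u i)" unfolding z(2) by (rule unique) (rule z(1), rule z'(1), rule z'(2))
    qed
  qed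
qed

end
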